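(* If $A,B\subset\mathbb{R}^3$ are circles such that $A+B$ is a non-planar $\lambda$-circled surface of Möbius degree $d$, then $(\lambda,d)=(2,8)$.
   Context: A surface means a real irreducible algebraic surface, and $A+B=\{a+b\mid a\in A,\ b\in B\}\subset\mathbb{R}^3$. $S^3\subset\mathbb{R}^4$ is the unit sphere and $\mu\colon S^3\dashrightarrow\mathbb{R}^3$, $\mu(y)=(y_1,y_2,y_3)/(1-y_4)$, is stereographic projection from $(0,0,0,1)$. The Möbius degree of a surface $Z\subset\mathbb{R}^3$ is the degree of the Zariski closure of $\mu^{-1}(Z)$ in $\mathbb{P}^4$. The surface $Z$ is $\lambda$-circled ($\lambda\in\mathbb{Z}_{\ge0}\cup\{\infty\}$) if the Zariski closure of $\mu^{-1}(Z)$ contains at least $\lambda$ circles through a general point; if $\lambda<\infty$ it is moreover required that $Z$ is not $(\lambda+1)$-circled. Circles in $\mathbb{R}^3$ are genuine circles (not lines). *)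

theory Defs
  imports "HOL-Analysis.Analysis" "HOL-Library.Extended_Nat"
begin

definition is_circle :: "'a::euclidean_space set \<Rightarrow> bool" where
  "is_circle C \<longleftrightarrow> (\<exists>c r P. r > 0 \<and> affine P \<and> aff_dim P = 2 \<and> c \<in> P \<and> C = sphere c r \<inter> P)"

definition real_zariski_closed :: "'a::real_normed_vector set \<Rightarrow> bool" where
  "real_zariski_closed V \<longleftrightarrow>
     (\<exists>P \<subseteq> Collect real_polynomial_function. V = {x. \<forall>p\<in>P. p x = 0})"

definition real_irreducible :: "'a::real_normed_vector set \<Rightarrow> bool" where
  "real_irreducible V \<longleftrightarrow> real_zariski_closed V \<and> V \<noteq> {} \<and>
     (\<forall>V1 V2. real_zariski_closed V1 \<longrightarrow> real_zariski_closed V2 \<longrightarrow> V = V1 \<union> V2 \<longrightarrow> V = V1 \<or> V = V2)"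

definition irreducible_chain :: "'a::real_normed_vector set \<Rightarrow> nat \<Rightarrow> bool" where
  "irreducible_chain V n \<longleftrightarrow>
     (\<exists>W. (\<forall>i\<le>n. real_irreducible (W i) \<and> W i \<subseteq> V) \<and> (\<forall>i<n. W i \<subset> W (Suc i)))"

text \<open>
  Krull dimension; for a real algebraic set \<open>V\<close> it is the dimension of the ring of polynomial
  functions on \<open>V\<close>, hence also the dimension of the complexification.
\<close>
definition real_zariski_dim :: "'a::real_normed_vector set \<Rightarrow> nat \<Rightarrow> bool" where
  "real_zariski_dim V n \<longleftrightarrow> irreducible_chain V n \<and> \<not> irreducible_chain V (Suc n)"

text \<open>
  As usual for parametrized surfaces, a point set counts as a surface when its Zariski closure is
  one: a Minkowski sum of two circles is compact, but it need not be Zariski closed. For example,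
  the closure of \<open>{(cos s + cos t, sin s, sin t) | s t}\<close> contains all points \<open>(0, y, y)\<close>.
\<close>
definition real_surface :: "'a::real_normed_vector set \<Rightarrow> bool" where
  "real_surface Z \<longleftrightarrow>
     real_irreducible (real_zariski_closed hull Z) \<and> real_zariski_dim (real_zariski_closed hull Z) 2"

inductive complex_polynomial_function :: "(complex^'n \<Rightarrow> complex) \<Rightarrow> bool" where
  coord: "complex_polynomial_function (\<lambda>v. v $ i)"
| const: "complex_polynomial_function (\<lambda>v. c)"
| add: "complex_polynomial_function f \<Longrightarrow> complex_polynomial_function g
         \<Longrightarrow> complex_polynomial_function (\<lambda>v. f v + g v)"
| mult: "complex_polynomial_function f \<Longrightarrow> complex_polynomial_function g
         \<Longrightarrow> complex_polynomial_function (\<lambda>v. f v * g v)"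

definition homogeneous_form :: "(complex^'n \<Rightarrow> complex) \<Rightarrow> bool" where
  "homogeneous_form F \<longleftrightarrow>
     complex_polynomial_function F \<and> (\<exists>k::nat. \<forall>c v. F (c *s v) = c ^ k * F v)"

text \<open>
  A point of projective space is the set of its homogeneous coordinate vectors; thus
  \<open>complex^5\<close> yields the points of complex projective 4-space.
\<close>
definition proj_point :: "complex^'n \<Rightarrow> (complex^'n) set" where
  "proj_point v = {c *s v | c. c \<noteq> 0}"

definition proj_zariski_closed :: "(complex^'n) set set \<Rightarrow> bool" where
  "proj_zariski_closed X \<longleftrightarrow>
     (\<exists>H \<subseteq> Collect homogeneous_form. X = {proj_point v | v. v \<noteq> 0 \<and> (\<forall>F\<in>H. F v = 0)})"

text \<open>
  The degree of a surface: the number of its points on a general linear subspace of codimension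
  two. Such a subspace is given by two linear equations with coefficient matrix \<open>L\<close>, and
  \<open>general\<close> means that some fixed nonzero polynomial in the entries of \<open>L\<close> does not vanish.
\<close>
definition surface_degree :: "(complex^'n) set set \<Rightarrow> nat \<Rightarrow> bool" where
  "surface_degree X d \<longleftrightarrow>
     (\<exists>D. complex_polynomial_function D \<and> (\<exists>L. D L \<noteq> 0) \<and>
        (\<forall>L :: complex^(2 \<times> 'n). D L \<noteq> 0 \<longrightarrow>
           (let S = X \<inter> {proj_point v | v. v \<noteq> 0 \<and> (\<forall>i. (\<Sum>j\<in>UNIV. L $ (i, j) * v $ j) = 0)}
            in finite S \<and> card S = d)))"

text \<open>At the centre of projection, where \<open>y $ 4 = 1\<close>, the value is irrelevant.\<close>
definition stereo :: "real^4 \<Rightarrow> real^3" where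
  "stereo y = (1 / (1 - y $ 4)) *\<^sub>R vector [y $ 1, y $ 2, y $ 3]"

definition stereo_preimage :: "(real^3) set \<Rightarrow> (real^4) set" where
  "stereo_preimage Z = {y \<in> sphere 0 1. y $ 4 \<noteq> 1 \<and> stereo y \<in> Z}"

definition proj_embed :: "real^4 \<Rightarrow> (complex^5) set" where
  "proj_embed y = proj_point (vector [1, complex_of_real (y $ 1), complex_of_real (y $ 2),
                                      complex_of_real (y $ 3), complex_of_real (y $ 4)])"

definition moebius_closure :: "(real^3) set \<Rightarrow> (complex^5) set set" where
  "moebius_closure Z = proj_zariski_closed hull (proj_embed ` stereo_preimage Z)"

definition moebius_degree :: "(real^3) set \<Rightarrow> nat \<Rightarrow> bool" where
  "moebius_degree Z d \<longleftrightarrow> surface_degree (moebius_closure Z) d"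

definition circles_through :: "(complex^5) set set \<Rightarrow> real^4 \<Rightarrow> (real^4) set set" where
  "circles_through X y = {C. is_circle C \<and> C \<subseteq> sphere 0 1 \<and> proj_embed ` C \<subseteq> X \<and> y \<in> C}"

definition ecard :: "'a set \<Rightarrow> enat" where
  "ecard S = (if finite S then enat (card S) else \<infinity>)"

text \<open>
  A general point is a real point outside some proper algebraic subset \<open>W\<close>. All real points of the
  closure of the preimage lie on the sphere, so none of them is at infinity.
\<close>
definition at_least_circled :: "enat \<Rightarrow> (real^3) set \<Rightarrow> bool" where
  "at_least_circled l Z \<longleftrightarrow>
     (\<exists>W. proj_zariski_closed W \<and> \<not> moebius_closure Z \<subseteq> W \<and>
        (\<forall>y. proj_embed y \<in> moebius_closure Z - W \<longrightarrow>
           l \<le> ecard (circles_through (moebius_closure Z) y)))"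

definition circled :: "enat \<Rightarrow> (real^3) set \<Rightarrow> bool" where
  "circled l Z \<longleftrightarrow> at_least_circled l Z \<and> (l < \<infinity> \<longrightarrow> \<not> at_least_circled (l + 1) Z)"

end

theory Submission
  imports Defs "HOL-Computational_Algebra.Fundamental_Theorem_Algebra"
begin

text \<open>
  Since the sum is not coplanar, the planes of the two circles are not parallel and share a
  unit direction \<open>u\<close>. Complete \<open>u\<close> to orthonormal bases \<open>u, v\<close> and \<open>u, w\<close> of the two plane
  directions and put \<open>k = v \<bullet> w\<close>, so that \<open>k\<^sup>2 < 1\<close>. By \<open>circle_sum_parametrization\<close> the sum is
  \<open>{c + (p + q) u + s v + r w | p\<^sup>2 + s\<^sup>2 = a\<^sup>2, q\<^sup>2 + r\<^sup>2 = b\<^sup>2}\<close>. With \<open>x = p + q\<close> it satisfies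
  the quartic \<open>(x\<^sup>2 + a\<^sup>2 - b\<^sup>2 + r\<^sup>2 - s\<^sup>2)\<^sup>2 = 4 x\<^sup>2 (a\<^sup>2 - s\<^sup>2)\<close>. Where \<open>x \<noteq> 0\<close>, the quartic in turn
  yields \<open>p\<close> and \<open>q\<close> as rational functions of \<open>x, s, r\<close> (\<open>quartic_point\<close>). Let \<open>h\<close> be the linear form
  on projective 4-space that vanishes on the tangent hyperplane of the sphere at the projection
  centre. The closure \<open>X\<close> of the preimage lies on the quartic, homogenized by \<open>h\<close>, and on the
  quadric \<open>h m = x\<^sup>2 + s\<^sup>2 + r\<^sup>2 + 2 k s r\<close>, which is the sphere. For \<open>h = 0\<close> the two equations
  give \<open>s = 0\<close> or \<open>r = 0\<close> (\<open>quartic_at_infinity\<close>); both the circle count and the degree rest on this.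
  
  Through a point with \<open>x \<noteq> 0\<close> pass a translate of \<open>A\<close> and a translate of \<open>B\<close>. Let \<open>C\<close> be
  any circle in \<open>X\<close> through the point, parametrized by the complex numbers \<open>\<zeta>\<close> of modulus 1. Along
  \<open>C\<close> the linear forms \<open>h, x, s, r, m\<close> become, up to the common factor \<open>\<zeta>\<close>, quadratic polynomials in
  \<open>\<zeta>\<close>. At a root of \<open>h\<close> one of \<open>s, r\<close> vanishes, and since the polynomials are real on \<open>C\<close>, it
  vanishes at the conjugate root as well. Hence \<open>s\<close> or \<open>r\<close> is a constant multiple of \<open>h\<close> on \<open>C\<close>
  (\<open>circle_on_quartic\<close>), that is, \<open>C\<close> projects into a plane \<open>s = const\<close> or \<open>r = const\<close>. Such a plane
  meets the sum in at most two circles, and only one of them passes through the given point. If \<open>C\<close>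
  passes through the projection centre, the argument with the two roots is replaced by a look at
  the leading coefficients of the quartic along a line (\<open>line_on_quartic\<close>).
  
  For the degree, put \<open>a z = p + \<i> s\<close> and \<open>b w = q + \<i> r\<close>. Then \<open>x, s, r\<close> and \<open>m\<close> are Laurent
  polynomials, and clearing denominators gives a map with biquadratic components from pairs
  \<open>z, w \<noteq> 0\<close> onto the part \<open>h \<noteq> 0\<close> of \<open>X\<close>. This map is injective where \<open>x \<noteq> 0\<close>. A linear
  section of codimension two is thereby given by two quadratic equations for \<open>w\<close> with coefficients
  depending on \<open>z\<close>; eliminating \<open>w\<close> leaves a polynomial of degree 8 in \<open>z\<close>. There are exactly 8
  points if this eliminant has 8 distinct nonzero roots and the section avoids \<open>h = 0\<close> and \<open>x = 0\<close>.
  These conditions survive small perturbations of the section (\<open>no_common_root_stable\<close>), and an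
  explicit family contains a section that satisfies them (\<open>eight_solutions_generically\<close>). As the zero
  set of a nonzero polynomial contains no nonempty open set, the number of points on a general
  section is 8 too.
\<close>

section \<open>Polynomial functions and projective Zariski closures\<close>

lemma complex_polynomial_function_uminus:
  "complex_polynomial_function f \<Longrightarrow> complex_polynomial_function (\<lambda>v. - f v)"
  using complex_polynomial_function.mult[OF complex_polynomial_function.const[of "-1"]] by simp

lemma complex_polynomial_function_diff:
  "complex_polynomial_function f \<Longrightarrow> complex_polynomial_function g
    \<Longrightarrow> complex_polynomial_function (\<lambda>v. f v - g v)"
  using complex_polynomial_function.add[OF _ complex_polynomial_function_uminus] by fastforce

lemma complex_polynomial_function_power:
  "complex_polynomial_function f \<Longrightarrow> complex_polynomial_function (\<lambda>v. f v ^ n)"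
  by (induction n) (auto intro: complex_polynomial_function.intros)

lemmas complex_polynomial_function_intros =
  complex_polynomial_function.intros complex_polynomial_function_diff
  complex_polynomial_function_uminus complex_polynomial_function_power

text \<open>
  Whether a form vanishes on the closure is decided below along curves with polynomial components,
  where it becomes a question about a polynomial in one variable.
\<close>
lemma complex_polynomial_function_along_curve:
  assumes "complex_polynomial_function F"
    and "\<And>j. \<exists>q. \<forall>z. g z $ j = poly q z"
  shows "\<exists>p. \<forall>z. F (g z) = poly p z"
  using assms(1)
proof induction
  case (coord i)
  then show ?case using assms(2) by blast
next
  case (const c)
  then show ?case by (intro exI[of _ "[:c:]"]) simp
next
  case (add f h)
  then obtain p q where "\<forall>z. f (g z) = poly p z" "\<forall>z. h (g z) = poly q z" by blast
  then show ?case by (intro exI[of _ "p + q"]) simp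
next
  case (mult f h)
  then obtain p q where "\<forall>z. f (g z) = poly p z" "\<forall>z. h (g z) = poly q z" by blast
  then show ?case by (intro exI[of _ "p * q"]) simp
qed

definition is_poly_fun :: "(complex \<Rightarrow> complex) \<Rightarrow> bool" where
  "is_poly_fun f \<longleftrightarrow> (\<exists>p. \<forall>z. f z = poly p z)"

lemma is_poly_fun_intros:
  "is_poly_fun (\<lambda>z. z)" "is_poly_fun (\<lambda>z. t)"
  "is_poly_fun f \<Longrightarrow> is_poly_fun g \<Longrightarrow> is_poly_fun (\<lambda>z. f z + g z)"
  "is_poly_fun f \<Longrightarrow> is_poly_fun g \<Longrightarrow> is_poly_fun (\<lambda>z. f z - g z)"
  "is_poly_fun f \<Longrightarrow> is_poly_fun g \<Longrightarrow> is_poly_fun (\<lambda>z. f z * g z)"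
  "is_poly_fun f \<Longrightarrow> is_poly_fun (\<lambda>z. f z / t)"
  "is_poly_fun f \<Longrightarrow> is_poly_fun (\<lambda>z. - f z)"
  "is_poly_fun f \<Longrightarrow> is_poly_fun (\<lambda>z. f z ^ n)"
proof -
  have "\<forall>z::complex. z = poly [:0, 1:] z" "\<forall>z::complex. t = poly [:t:] z" by simp_all
  then show "is_poly_fun (\<lambda>z. z)" "is_poly_fun (\<lambda>z. t)" unfolding is_poly_fun_def by blast+
  assume "is_poly_fun f"
  then obtain p where p: "\<forall>z. f z = poly p z" unfolding is_poly_fun_def by blast
  have "\<forall>z. f z / t = poly (smult (1 / t) p) z" "\<forall>z. f z ^ n = poly (p ^ n) z" "\<forall>z. - f z = poly (- p) z"
    using p by simp_all
  then show "is_poly_fun (\<lambda>z. f z / t)" "is_poly_fun (\<lambda>z. - f z)" "is_poly_fun (\<lambda>z. f z ^ n)" unfolding is_poly_fun_def by blast+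
  assume "is_poly_fun g"
  then obtain q where q: "\<forall>z. g z = poly q z" unfolding is_poly_fun_def by blast
  have "\<forall>z. f z + g z = poly (p + q) z" "\<forall>z. f z - g z = poly (p - q) z" "\<forall>z. f z * g z = poly (p * q) z"
    using p q by simp_all
  then show "is_poly_fun (\<lambda>z. f z + g z)" "is_poly_fun (\<lambda>z. f z - g z)" "is_poly_fun (\<lambda>z. f z * g z)"
    unfolding is_poly_fun_def by blast+
qed

lemma infinite_unit_circle: "infinite {z::complex. cmod z = 1}"
proof -
  have "connected (sphere (0::complex) 1)" by (rule connected_sphere) simp
  moreover have "1 \<in> sphere (0::complex) 1" "-1 \<in> sphere (0::complex) 1" by auto
  moreover have "sphere (0::complex) 1 = {z. cmod z = 1}" by auto
  ultimately show ?thesis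
    by (metis connected_finite_iff_sing empty_iff one_neq_neg_one singletonD)
qed

text \<open>
  These turn cosine and sine of a point of the unit circle into rational functions of the point, the
  first step of every passage from real to complex parameters.
\<close>
lemma unit_circle_identities:
  fixes z :: complex
  assumes "cmod z = 1"
  shows "2 * z * Re z = z^2 + 1" "2 * \<i> * z * Im z = z^2 - 1"
proof -
  have n: "(Re z)^2 + (Im z)^2 = 1" using assms cmod_power2[of z] by simp
  show "2 * z * Re z = z^2 + 1" "2 * \<i> * z * Im z = z^2 - 1"
    using n by (auto simp: complex_eq_iff power2_eq_square algebra_simps)
qed

text \<open>
  Polynomial relations between real points of a circle extend to all complex parameters.
\<close>
lemma poly_eq_0_if_unit_circle:
  fixes p :: "complex poly"
  assumes "\<And>z. cmod z = 1 \<Longrightarrow> poly p z = 0"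
  shows "p = 0"
proof (rule ccontr)
  assume "p \<noteq> 0"
  then have "finite {z. poly p z = 0}" by (rule poly_roots_finite)
  then show False
    using infinite_unit_circle assms finite_subset[of "{z. cmod z = 1}" "{z. poly p z = 0}"] by auto
qed

text \<open>
  On the line from \<open>L0\<close> to \<open>L1\<close> the function \<open>D\<close> is a nonzero polynomial, so its finitely many zeros
  stay away from a punctured neighbourhood of \<open>L0\<close>. A number attached to general \<open>L\<close> can
  therefore be computed on any nonempty open set.
\<close>
lemma nonzero_in_every_open_set:
  fixes D :: "complex^'n \<Rightarrow> complex"
  assumes D: "complex_polynomial_function D" "D L1 \<noteq> 0"
    and ev: "eventually P (nhds L0)"
  shows "\<exists>L. P L \<and> D L \<noteq> 0"
proof -
  define g where "g = (\<lambda>t::complex. L0 + t *s (L1 - L0))"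
  have "\<forall>z. g z $ j = poly [:L0 $ j, L1 $ j - L0 $ j:] z" for j
    by (simp add: g_def right_diff_distrib)
  then have "\<exists>p. \<forall>z. D (g z) = poly p z"
    by (intro complex_polynomial_function_along_curve[OF D(1)]) blast
  then obtain p where p: "\<And>z. D (g z) = poly p z" by blast
  have "poly p 1 \<noteq> 0" using p[of 1] D(2) by (simp add: g_def)
  then have fin: "finite {z. poly p z = 0}"
    by (metis poly_0 poly_roots_finite)
  have "(g \<longlongrightarrow> g 0) (at 0)"
  proof (rule vec_tendstoI)
    fix i
    have "((\<lambda>t. L0 $ i + t * (L1 $ i - L0 $ i)) \<longlongrightarrow> L0 $ i + 0 * (L1 $ i - L0 $ i)) (at 0)"
      by (intro tendsto_intros)
    moreover have gi: "g t $ i = L0 $ i + t * (L1 $ i - L0 $ i)" for t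
      by (simp add: g_def right_diff_distrib)
    ultimately show "((\<lambda>t. g t $ i) \<longlongrightarrow> g 0 $ i) (at 0)" unfolding gi by simp
  qed
  then have ev1: "eventually (\<lambda>t. P (g t)) (at 0)"
    using ev by (simp add: filterlim_iff g_def)
  have ev2: "eventually (\<lambda>t. t \<notin> {z. poly p z = 0}) (at 0)"
    using islimpt_finite[OF fin, of 0] unfolding islimpt_iff_eventually by blast
  have "\<exists>t. P (g t) \<and> t \<notin> {z. poly p z = 0}"
    by (rule eventually_happens'[OF _ eventually_conj[OF ev1 ev2]]) simp
  then show ?thesis using p by auto
qed

lemma proj_point_self: "v \<in> proj_point v"
  unfolding proj_point_def by (auto intro!: exI[of _ "1::complex"])

lemma proj_point_eq_iff: "proj_point v = proj_point v' \<longleftrightarrow> (\<exists>c. c \<noteq> 0 \<and> v = c *s v')"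
proof
  assume "proj_point v = proj_point v'"
  then show "\<exists>c. c \<noteq> 0 \<and> v = c *s v'"
    using proj_point_self[of v] unfolding proj_point_def by auto
next
  assume "\<exists>c. c \<noteq> 0 \<and> v = c *s v'"
  then obtain c where c: "c \<noteq> 0" "v = c *s v'" by auto
  show "proj_point v = proj_point v'"
  proof (intro equalityI subsetI)
    fix x assume "x \<in> proj_point v"
    then show "x \<in> proj_point v'"
      using c by (auto simp: proj_point_def vector_smult_assoc)
  next
    fix x assume "x \<in> proj_point v'"
    then obtain d where "d \<noteq> 0" "x = d *s v'" by (auto simp: proj_point_def)
    then have "x = (d / c) *s v" "d / c \<noteq> 0" using c by (auto simp: vector_smult_assoc)
    then show "x \<in> proj_point v" by (auto simp: proj_point_def)
  qed
qed

lemma homogeneous_form_scale_zero: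
  assumes "homogeneous_form F" "c \<noteq> 0"
  shows "F (c *s v) = 0 \<longleftrightarrow> F v = 0"
  using assms unfolding homogeneous_form_def by force

lemma proj_zariski_closed_mem_iff:
  assumes "H \<subseteq> Collect homogeneous_form"
  shows "proj_point v \<in> {proj_point v | v. v \<noteq> 0 \<and> (\<forall>F\<in>H. F v = 0)} \<longleftrightarrow> v \<noteq> 0 \<and> (\<forall>F\<in>H. F v = 0)"
proof
  assume "proj_point v \<in> {proj_point v | v. v \<noteq> 0 \<and> (\<forall>F\<in>H. F v = 0)}"
  then obtain v' where v': "proj_point v = proj_point v'" "v' \<noteq> 0" "\<forall>F\<in>H. F v' = 0" by auto
  then obtain c where c: "c \<noteq> 0" "v = c *s v'" using proj_point_eq_iff by blast
  then show "v \<noteq> 0 \<and> (\<forall>F\<in>H. F v = 0)"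
    using v' assms by (auto simp: homogeneous_form_scale_zero subset_iff)
qed auto

text \<open>
  Together with \<open>proj_hull_memI\<close> this describes the closure of \<open>S\<close> as the set of common zeros of all
  forms that vanish on \<open>S\<close>.
\<close>
lemma proj_hull_form_zero:
  assumes F: "homogeneous_form F"
    and S: "\<And>s. s \<in> S \<Longrightarrow> \<exists>v. v \<noteq> 0 \<and> s = proj_point v \<and> F v = 0"
    and v: "proj_point v \<in> proj_zariski_closed hull S"
  shows "F v = 0"
proof -
  let ?V = "{proj_point v | v. v \<noteq> 0 \<and> (\<forall>F\<in>{F}. F v = 0)}"
  have "proj_zariski_closed ?V"
    unfolding proj_zariski_closed_def using F by (intro exI[of _ "{F}"]) auto
  moreover have "S \<subseteq> ?V" using S by blast
  ultimately have "proj_zariski_closed hull S \<subseteq> ?V" by (intro hull_minimal)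
  then have "proj_point v \<in> ?V" using v by blast
  then show ?thesis using proj_zariski_closed_mem_iff[of "{F}" v] F by auto
qed

lemma proj_hull_memI:
  assumes v: "v \<noteq> 0"
    and F: "\<And>F. homogeneous_form F \<Longrightarrow> (\<And>s. proj_point s \<in> S \<Longrightarrow> F s = 0) \<Longrightarrow> F v = 0"
  shows "proj_point v \<in> proj_zariski_closed hull S"
  unfolding hull_def
proof (intro InterI)
  fix T assume "T \<in> {t. proj_zariski_closed t \<and> S \<subseteq> t}"
  then obtain H where H: "H \<subseteq> Collect homogeneous_form"
    "T = {proj_point v | v. v \<noteq> 0 \<and> (\<forall>F\<in>H. F v = 0)}" and "S \<subseteq> T"
    unfolding proj_zariski_closed_def by auto
  have "G v = 0" if "G \<in> H" for G
    using F[of G] that H \<open>S \<subseteq> T\<close> proj_zariski_closed_mem_iff[OF H(1)] by blast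
  then show "proj_point v \<in> T" using v H(2) by blast
qed

section \<open>Vectors of length four and five\<close>

lemma exhaust_5:
  fixes x :: 5
  shows "x = 1 \<or> x = 2 \<or> x = 3 \<or> x = 4 \<or> x = 5"
proof (induct x)
  case (of_int z)
  then have "z = 0 \<or> z = 1 \<or> z = 2 \<or> z = 3 \<or> z = 4" by fastforce
  then show ?case by auto
qed

lemma forall_5: "(\<forall>i::5. P i) \<longleftrightarrow> P 1 \<and> P 2 \<and> P 3 \<and> P 4 \<and> P 5"
  by (metis exhaust_5)

lemma UNIV_5: "UNIV = {1, 2, 3, 4, 5::5}"
  using exhaust_5 by auto

lemma sum_5: "sum f (UNIV::5 set) = f 1 + f 2 + f 3 + f 4 + f 5"
  unfolding UNIV_5 by (simp add: ac_simps)

lemma vector_4 [simp]: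
  "(vector [p,q,r,s] :: ('a::zero)^4) $ 1 = p"
  "(vector [p,q,r,s] :: ('a::zero)^4) $ 2 = q"
  "(vector [p,q,r,s] :: ('a::zero)^4) $ 3 = r"
  "(vector [p,q,r,s] :: ('a::zero)^4) $ 4 = s"
  unfolding vector_def by simp_all

lemma vector_5 [simp]:
  "(vector [p,q,r,s,t] :: ('a::zero)^5) $ 1 = p"
  "(vector [p,q,r,s,t] :: ('a::zero)^5) $ 2 = q"
  "(vector [p,q,r,s,t] :: ('a::zero)^5) $ 3 = r"
  "(vector [p,q,r,s,t] :: ('a::zero)^5) $ 4 = s"
  "(vector [p,q,r,s,t] :: ('a::zero)^5) $ 5 = t"
  unfolding vector_def by simp_all

section \<open>Roots of polynomials under perturbation\<close>

text \<open>
  Convergence of each coefficient. It does not bound the degrees, which is why the lemmas on values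
  and roots carry a common degree bound.
\<close>
definition coeffs_tendsto :: "('a \<Rightarrow> complex poly) \<Rightarrow> complex poly \<Rightarrow> 'a filter \<Rightarrow> bool" where
  "coeffs_tendsto p q F \<longleftrightarrow> (\<forall>i. ((\<lambda>x. coeff (p x) i) \<longlongrightarrow> coeff q i) F)"

lemma coeffs_tendsto_add:
  "coeffs_tendsto p p' F \<Longrightarrow> coeffs_tendsto q q' F \<Longrightarrow> coeffs_tendsto (\<lambda>x. p x + q x) (p' + q') F"
  unfolding coeffs_tendsto_def by (auto intro!: tendsto_intros)

lemma coeffs_tendsto_diff:
  "coeffs_tendsto p p' F \<Longrightarrow> coeffs_tendsto q q' F \<Longrightarrow> coeffs_tendsto (\<lambda>x. p x - q x) (p' - q') F"
  unfolding coeffs_tendsto_def by (auto intro!: tendsto_intros)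

lemma coeffs_tendsto_mult:
  "coeffs_tendsto p p' F \<Longrightarrow> coeffs_tendsto q q' F \<Longrightarrow> coeffs_tendsto (\<lambda>x. p x * q x) (p' * q') F"
  unfolding coeffs_tendsto_def coeff_mult by (auto intro!: tendsto_intros)

lemma coeffs_tendsto_pderiv:
  "coeffs_tendsto p p' F \<Longrightarrow> coeffs_tendsto (\<lambda>x. pderiv (p x)) (pderiv p') F"
  unfolding coeffs_tendsto_def coeff_pderiv by (auto intro!: tendsto_intros)

lemma coeffs_tendsto_pCons:
  assumes "(c \<longlongrightarrow> c') F" "coeffs_tendsto p p' F"
  shows "coeffs_tendsto (\<lambda>x. pCons (c x) (p x)) (pCons c' p') F"
  using assms unfolding coeffs_tendsto_def coeff_pCons by (auto split: nat.split)

lemma coeffs_tendsto_const: "coeffs_tendsto (\<lambda>x. p) p F"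
  unfolding coeffs_tendsto_def by auto

lemma poly_eq_sum_le:
  fixes p :: "'a::comm_semiring_1 poly"
  assumes "degree p \<le> n"
  shows "poly p z = (\<Sum>i\<le>n. coeff p i * z ^ i)"
  unfolding poly_altdef
  by (rule sum.mono_neutral_left) (use assms in \<open>auto intro: le_degree\<close>)

lemma coeffs_tendsto_uniform:
  assumes p: "coeffs_tendsto p q F" and deg: "\<And>x. degree (p x) \<le> n" "degree q \<le> n"
    and B: "B \<ge> 0" and e: "e > 0"
  shows "\<forall>\<^sub>F x in F. \<forall>z. cmod z \<le> B \<longrightarrow> cmod (poly (p x) z - poly q z) < e"
proof -
  define s where "s = (\<lambda>x. \<Sum>i\<le>n. cmod (coeff (p x) i - coeff q i) * B ^ i)"
  have "(s \<longlongrightarrow> (\<Sum>i\<le>n. cmod (coeff q i - coeff q i) * B ^ i)) F"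
    unfolding s_def using p unfolding coeffs_tendsto_def by (intro tendsto_intros) auto
  then have "(s \<longlongrightarrow> 0) F" by simp
  then have "\<forall>\<^sub>F x in F. s x < e" using e by (rule order_tendstoD)
  then show ?thesis
  proof (eventually_elim, intro allI impI)
    fix x z assume s: "s x < e" and z: "cmod z \<le> B"
    have "poly (p x) z - poly q z = (\<Sum>i\<le>n. (coeff (p x) i - coeff q i) * z ^ i)"
      by (simp add: poly_eq_sum_le[OF deg(1)] poly_eq_sum_le[OF deg(2)] sum_subtractf left_diff_distrib)
    also have "cmod \<dots> \<le> s x"
      unfolding s_def
      by (rule sum_norm_le) (auto simp: norm_mult norm_power intro!: mult_left_mono power_mono z)
    finally show "cmod (poly (p x) z - poly q z) < e" using s by simp
  qed
qed

text \<open>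
  Cauchy's root bound. At a root the leading term equals the rest in absolute value, and for
  \<open>\<bar>z\<bar> \<ge> 1\<close> each lower power is at most \<open>\<bar>z\<bar>\<^sup>n\<close>.
\<close>
lemma root_norm_bound:
  fixes p :: "complex poly"
  assumes deg: "degree p \<le> Suc n" and lc: "coeff p (Suc n) \<noteq> 0" and root: "poly p z = 0"
    and z: "cmod z \<ge> 1"
  shows "cmod z \<le> (\<Sum>i\<le>n. cmod (coeff p i)) / cmod (coeff p (Suc n))"
proof -
  have "coeff p (Suc n) * z ^ Suc n = - (\<Sum>i\<le>n. coeff p i * z ^ i)"
    using root poly_eq_sum_le[OF deg, of z] by (simp add: eq_neg_iff_add_eq_0 add.commute)
  then have "cmod (coeff p (Suc n)) * cmod z ^ Suc n = cmod (\<Sum>i\<le>n. coeff p i * z ^ i)"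
    by (metis norm_minus_cancel norm_mult norm_power)
  also have "\<dots> \<le> (\<Sum>i\<le>n. cmod (coeff p i) * cmod z ^ n)"
    by (rule sum_norm_le)
       (auto simp: norm_mult norm_power intro!: mult_left_mono power_increasing z)
  also have "\<dots> = (\<Sum>i\<le>n. cmod (coeff p i)) * cmod z ^ n" by (simp add: sum_distrib_right)
  finally have "(cmod (coeff p (Suc n)) * cmod z) * cmod z ^ n \<le> (\<Sum>i\<le>n. cmod (coeff p i)) * cmod z ^ n"
    by (simp add: mult_ac)
  moreover have "cmod z ^ n > 0" using z by (intro zero_less_power) linarith
  ultimately have "cmod (coeff p (Suc n)) * cmod z \<le> (\<Sum>i\<le>n. cmod (coeff p i))"
    by (rule mult_right_le_imp_le)
  then show ?thesis using lc by (simp add: field_simps)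
qed

lemma roots_eventually_bounded:
  assumes p: "coeffs_tendsto p p0 F" and deg: "\<And>x. degree (p x) \<le> Suc n" and lc: "coeff p0 (Suc n) \<noteq> 0"
  obtains B where "B \<ge> 0" "\<forall>\<^sub>F x in F. \<forall>z. poly (p x) z = 0 \<longrightarrow> cmod z \<le> B"
proof -
  define b where "b = (\<lambda>x. (\<Sum>i\<le>n. cmod (coeff (p x) i)) / cmod (coeff (p x) (Suc n)))"
  define b0 where "b0 = (\<Sum>i\<le>n. cmod (coeff p0 i)) / cmod (coeff p0 (Suc n))"
  have "(b \<longlongrightarrow> b0) F"
    unfolding b_def b0_def using p lc unfolding coeffs_tendsto_def by (intro tendsto_intros) auto
  then have 1: "\<forall>\<^sub>F x in F. b x < b0 + 1" by (rule order_tendstoD) simp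
  have 2: "\<forall>\<^sub>F x in F. coeff (p x) (Suc n) \<noteq> 0"
    using p lc unfolding coeffs_tendsto_def by (intro tendsto_imp_eventually_ne) auto
  have b0: "b0 \<ge> 0" unfolding b0_def by (auto intro!: divide_nonneg_nonneg sum_nonneg)
  have "\<forall>\<^sub>F x in F. \<forall>z. poly (p x) z = 0 \<longrightarrow> cmod z \<le> b0 + 1"
    using 1 2
  proof (eventually_elim, intro allI impI)
    fix x z assume *: "b x < b0 + 1" "coeff (p x) (Suc n) \<noteq> 0" "poly (p x) z = 0"
    show "cmod z \<le> b0 + 1"
      using root_norm_bound[OF deg *(2,3)] *(1) b0 unfolding b_def by (cases "cmod z \<ge> 1") auto
  qed
  then show ?thesis using that[of "b0 + 1"] b0 by simp
qed

text \<open>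
  The roots of \<open>p x\<close> eventually stay in a fixed disc. On this disc \<open>\<bar>p0\<bar> + \<bar>q0\<bar>\<close> has a positive
  minimum, whereas it would be arbitrarily small at a common root of polynomials close to \<open>p0\<close> and \<open>q0\<close>.
\<close>
lemma no_common_root_stable:
  assumes p: "coeffs_tendsto p p0 F" "\<And>x. degree (p x) \<le> Suc n" "degree p0 \<le> Suc n" "coeff p0 (Suc n) \<noteq> 0"
    and q: "coeffs_tendsto q q0 F" "\<And>x. degree (q x) \<le> m" "degree q0 \<le> m"
    and none: "\<And>z. poly p0 z = 0 \<Longrightarrow> poly q0 z \<noteq> 0"
  shows "\<forall>\<^sub>F x in F. \<forall>z. poly (p x) z = 0 \<longrightarrow> poly (q x) z \<noteq> 0"
proof -
  obtain B where B: "B \<ge> 0" "\<forall>\<^sub>F x in F. \<forall>z. poly (p x) z = 0 \<longrightarrow> cmod z \<le> B"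
    using roots_eventually_bounded[OF p(1,2,4)] by blast
  define f where "f = (\<lambda>z. cmod (poly p0 z) + cmod (poly q0 z))"
  have "\<exists>z0\<in>cball 0 B. \<forall>z\<in>cball 0 B. f z0 \<le> f z"
    unfolding f_def using B(1) by (intro continuous_attains_inf) (auto intro!: continuous_intros)
  then obtain z0 where "\<forall>z\<in>cball 0 B. f z0 \<le> f z" by blast
  then have z0: "\<And>z. cmod z \<le> B \<Longrightarrow> f z0 \<le> f z" by simp
  define e where "e = f z0 / 2"
  have "f z0 > 0" unfolding f_def using none[of z0]
    by (smt (verit, ccfv_SIG) norm_ge_zero zero_less_norm_iff)
  then have e: "e > 0" by (simp add: e_def)
  show ?thesis
    using B(2) coeffs_tendsto_uniform[OF p(1,2,3) B(1) e] coeffs_tendsto_uniform[OF q(1,2,3) B(1) e]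
  proof (eventually_elim, intro allI impI notI)
    fix x z
    assume x: "\<forall>z. poly (p x) z = 0 \<longrightarrow> cmod z \<le> B"
      "\<forall>z. cmod z \<le> B \<longrightarrow> cmod (poly (p x) z - poly p0 z) < e"
      "\<forall>z. cmod z \<le> B \<longrightarrow> cmod (poly (q x) z - poly q0 z) < e"
      "poly (p x) z = 0" "poly (q x) z = 0"
    then have z: "cmod z \<le> B" by blast
    have "cmod (poly p0 z) < e" "cmod (poly q0 z) < e"
      using x(2)[rule_format, OF z] x(3)[rule_format, OF z] x(4,5) by auto
    then have "f z < 2 * e" unfolding f_def by simp
    then show False using z0[OF z] by (simp add: e_def)
  qed
qed

lemma card_roots_eq_degree:
  fixes p :: "complex poly"
  assumes "p \<noteq> 0" "\<And>z. poly p z = 0 \<Longrightarrow> poly (pderiv p) z \<noteq> 0"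
  shows "card {z. poly p z = 0} = degree p"
proof -
  have "rsquarefree p" using assms by (auto simp: rsquarefree_roots)
  then have "p = smult (lead_coeff p) (\<Prod>z|poly p z = 0. [:-z, 1:])"
    by (simp add: complex_poly_decompose_rsquarefree)
  then have "degree p = degree (\<Prod>z|poly p z = 0. [:-z, 1:])"
    using assms(1) by (metis degree_smult_eq leading_coeff_0_iff)
  also have "\<dots> = (\<Sum>z|poly p z = 0. degree [:-z, 1:])"
    by (rule degree_prod_eq_sum_degree) auto
  finally show ?thesis by simp
qed

section \<open>Two biquadratic equations\<close>

text \<open>
  The difference \<open>M13\<^sup>2 - M12 M23\<close> is the resultant of the two quadratics. If it vanishes while
  \<open>M13 \<noteq> 0\<close>, then \<open>M12 \<noteq> 0\<close>, and the common root is the quotient \<open>- M13 / M12\<close>.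
\<close>
lemma common_root_of_quadratics:
  fixes A1 B1 C1 A2 B2 C2 w :: complex
  defines "M12 \<equiv> A1 * B2 - A2 * B1" and "M13 \<equiv> A1 * C2 - A2 * C1" and "M23 \<equiv> B1 * C2 - B2 * C1"
  shows "A1 * w^2 + B1 * w + C1 = 0 \<Longrightarrow> A2 * w^2 + B2 * w + C2 = 0 \<Longrightarrow>
      M12 * w = - M13 \<and> M13^2 = M12 * M23"
    and "M13^2 = M12 * M23 \<Longrightarrow> M13 \<noteq> 0 \<Longrightarrow>
      A1 * (- M13 / M12)^2 + B1 * (- M13 / M12) + C1 = 0 \<and> A2 * (- M13 / M12)^2 + B2 * (- M13 / M12) + C2 = 0"
proof -
  assume 1: "A1 * w^2 + B1 * w + C1 = 0" and 2: "A2 * w^2 + B2 * w + C2 = 0"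
  have "M12 * w + M13 = A1 * (A2 * w^2 + B2 * w + C2) - A2 * (A1 * w^2 + B1 * w + C1)"
    unfolding M12_def M13_def by (simp add: algebra_simps power2_eq_square)
  then have a: "M12 * w = - M13" using 1 2 by (simp add: eq_neg_iff_add_eq_0)
  have "w * (M13 * w + M23) = C2 * (A1 * w^2 + B1 * w + C1) - C1 * (A2 * w^2 + B2 * w + C2)"
    unfolding M13_def M23_def by (simp add: algebra_simps power2_eq_square)
  then have "w = 0 \<or> M13 * w = - M23" using 1 2 by (auto simp: eq_neg_iff_add_eq_0)
  then have "M13^2 = M12 * M23"
  proof
    assume "w = 0"
    then have "C1 = 0" "C2 = 0" using 1 2 by auto
    then show ?thesis unfolding M13_def M23_def by simp
  next
    assume "M13 * w = - M23"
    then have "M23 = - (M13 * w)" by simp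
    then have "M12 * M23 = - (M12 * w) * M13" by simp
    then show ?thesis using a by (simp add: power2_eq_square)
  qed
  with a show "M12 * w = - M13 \<and> M13^2 = M12 * M23" by blast
next
  assume r: "M13^2 = M12 * M23" and "M13 \<noteq> 0"
  then have m: "M12 \<noteq> 0" by auto
  have sq: "(- M13 / M12)^2 = M23 / M12" using r m by (simp add: power_divide power2_eq_square)
  have "A * M23 - B * M13 + C * M12 = 0 \<Longrightarrow> A * (- M13 / M12)^2 + B * (- M13 / M12) + C = 0" for A B C
    unfolding sq using m by (simp add: field_simps)
  moreover have "A1 * M23 - B1 * M13 + C1 * M12 = 0" "A2 * M23 - B2 * M13 + C2 * M12 = 0"
    unfolding M12_def M13_def M23_def by (simp_all add: algebra_simps)
  ultimately show "A1 * (- M13 / M12)^2 + B1 * (- M13 / M12) + C1 = 0 \<and> A2 * (- M13 / M12)^2 + B2 * (- M13 / M12) + C2 = 0"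
    by blast
qed

text \<open>
  Writing \<open>z = p + \<i> s\<close>, \<open>1/z = p - \<i> s\<close>, \<open>w = q + \<i> r\<close> and \<open>1/w = q - \<i> r\<close>, the five components are
  \<open>z w\<close> times \<open>1\<close>, \<open>2 (a p + b q)\<close>, \<open>2 \<i> s\<close>, \<open>2 \<i> r\<close> and \<open>4 (p q + k s r)\<close>. Up to a linear change of
  coordinates this is the point of the sphere that belongs to a sum of circles of radii \<open>a\<close> and \<open>b\<close>.
\<close>
definition biquad :: "real \<Rightarrow> real \<Rightarrow> real \<Rightarrow> complex \<Rightarrow> complex \<Rightarrow> complex^5" where
  "biquad a b k z w = vector
     [z * w,
      a * w * (z^2 + 1) + b * z * (w^2 + 1),
      w * (z^2 - 1),
      z * (w^2 - 1),
      (1 - k) * (z^2 * w^2 + 1) + (1 + k) * (z^2 + w^2)]"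

definition lin_comb :: "complex^5 \<Rightarrow> complex^5 \<Rightarrow> complex" where
  "lin_comb q e = (\<Sum>j\<in>UNIV. q $ j * e $ j)"

definition coefA :: "real \<Rightarrow> real \<Rightarrow> real \<Rightarrow> complex^5 \<Rightarrow> complex poly" where
  "coefA a b k q = [:(1 + k) * q $ 5, b * q $ 2 + q $ 4, (1 - k) * q $ 5:]"
definition coefB :: "real \<Rightarrow> real \<Rightarrow> real \<Rightarrow> complex^5 \<Rightarrow> complex poly" where
  "coefB a b k q = [:a * q $ 2 - q $ 3, q $ 1, a * q $ 2 + q $ 3:]"
definition coefC :: "real \<Rightarrow> real \<Rightarrow> real \<Rightarrow> complex^5 \<Rightarrow> complex poly" where
  "coefC a b k q = [:(1 - k) * q $ 5, b * q $ 2 - q $ 4, (1 + k) * q $ 5:]"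

lemma lin_comb_biquad:
  "lin_comb q (biquad a b k z w) =
    poly (coefA a b k q) z * w^2 + poly (coefB a b k q) z * w + poly (coefC a b k q) z"
  by (simp add: lin_comb_def biquad_def sum_5 coefA_def coefB_def coefC_def algebra_simps power2_eq_square)

definition minor12 :: "real \<Rightarrow> real \<Rightarrow> real \<Rightarrow> (complex^5) \<times> (complex^5) \<Rightarrow> complex poly" where
  "minor12 a b k x = coefA a b k (fst x) * coefB a b k (snd x) - coefA a b k (snd x) * coefB a b k (fst x)"
definition minor13 :: "real \<Rightarrow> real \<Rightarrow> real \<Rightarrow> (complex^5) \<times> (complex^5) \<Rightarrow> complex poly" where
  "minor13 a b k x = coefA a b k (fst x) * coefC a b k (snd x) - coefA a b k (snd x) * coefC a b k (fst x)"
definition minor23 :: "real \<Rightarrow> real \<Rightarrow> real \<Rightarrow> (complex^5) \<times> (complex^5) \<Rightarrow> complex poly" where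
  "minor23 a b k x = coefB a b k (fst x) * coefC a b k (snd x) - coefB a b k (snd x) * coefC a b k (fst x)"

text \<open>
  The resultant with respect to \<open>w\<close> of the two equations with coefficient vectors \<open>fst x\<close> and \<open>snd x\<close>.
\<close>
definition eliminant :: "real \<Rightarrow> real \<Rightarrow> real \<Rightarrow> (complex^5) \<times> (complex^5) \<Rightarrow> complex poly" where
  "eliminant a b k x = minor13 a b k x * minor13 a b k x - minor12 a b k x * minor23 a b k x"

definition solutions :: "real \<Rightarrow> real \<Rightarrow> real \<Rightarrow> (complex^5) \<times> (complex^5) \<Rightarrow> (complex \<times> complex) set" where
  "solutions a b k x = {(z, w). z \<noteq> 0 \<and> w \<noteq> 0 \<and>
     lin_comb (fst x) (biquad a b k z w) = 0 \<and> lin_comb (snd x) (biquad a b k z w) = 0}"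

text \<open>
  The closure meets the hyperplane \<open>e $ 1 = 0\<close> in the four lines \<open>e $ 3 = 0\<close>, \<open>e $ 2 = s b e $ 4\<close> and
  \<open>e $ 4 = 0\<close>, \<open>e $ 2 = s a e $ 3\<close>, where \<open>s = \<plusminus>1\<close> and \<open>e $ 5\<close> is free. On each line the two equations
  form a square linear system, and the inequalities say that its determinant is not zero.
\<close>
definition misses_infinity :: "real \<Rightarrow> real \<Rightarrow> (complex^5) \<times> (complex^5) \<Rightarrow> bool" where
  "misses_infinity a b x \<longleftrightarrow>
     (\<forall>s\<in>{-1, 1::complex}.
        (s * b * fst x $ 2 + fst x $ 4) * snd x $ 5 \<noteq> (s * b * snd x $ 2 + snd x $ 4) * fst x $ 5 \<and>
        (s * a * fst x $ 2 + fst x $ 3) * snd x $ 5 \<noteq> (s * a * snd x $ 2 + snd x $ 3) * fst x $ 5)"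

text \<open>
  The condition \<open>z \<noteq> 0\<close> appears as the nonvanishing of a polynomial, so that all clauses about
  roots have the form treated in \<open>no_common_root_stable\<close>. Nonvanishing of \<open>minor13\<close> at the roots makes
  the other unknown unique and different from 0.
\<close>
definition regular_system :: "real \<Rightarrow> real \<Rightarrow> real \<Rightarrow> (complex^5) \<times> (complex^5) \<Rightarrow> bool" where
  "regular_system a b k x \<longleftrightarrow> coeff (eliminant a b k x) 8 \<noteq> 0 \<and>
     (\<forall>z. poly (eliminant a b k x) z = 0 \<longrightarrow>
        poly (pderiv (eliminant a b k x)) z \<noteq> 0 \<and> poly (minor13 a b k x) z \<noteq> 0 \<and> poly [:0, 1:] z \<noteq> 0) \<and>
     misses_infinity a b x"

lemma degree_mult_le_add: "degree p \<le> m \<Longrightarrow> degree q \<le> n \<Longrightarrow> degree (p * q) \<le> m + n"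
  for p q :: "complex poly"
  using degree_mult_le[of p q] by linarith

lemma degree_minor:
  "degree (minor12 a b k x) \<le> 4" "degree (minor13 a b k x) \<le> 4" "degree (minor23 a b k x) \<le> 4"
proof -
  have A: "degree (coefA a b k q) \<le> 2" and B: "degree (coefB a b k q) \<le> 2" and C: "degree (coefC a b k q) \<le> 2" for q
    by (simp_all add: coefA_def coefB_def coefC_def)
  show "degree (minor12 a b k x) \<le> 4" "degree (minor13 a b k x) \<le> 4" "degree (minor23 a b k x) \<le> 4"
    unfolding minor12_def minor13_def minor23_def
    using degree_mult_le_add[OF A B] degree_mult_le_add[OF A C] degree_mult_le_add[OF B C]
    by (auto intro!: degree_diff_le)
qed

lemma degree_eliminant: "degree (eliminant a b k x) \<le> 8"
  unfolding eliminant_def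
  using degree_mult_le_add[OF degree_minor(2,2)[of a b k x]]
        degree_mult_le_add[OF degree_minor(1) degree_minor(3), of a b k x a b k x]
  by (auto intro!: degree_diff_le)

lemma minor12_nonzero:
  assumes "regular_system a b k x" "poly (eliminant a b k x) z = 0"
  shows "poly (minor12 a b k x) z \<noteq> 0"
proof
  assume "poly (minor12 a b k x) z = 0"
  then have "poly (minor13 a b k x) z = 0"
    using assms(2) by (simp add: eliminant_def)
  then show False using assms unfolding regular_system_def by blast
qed

text \<open>
  At a root of the eliminant both minors are nonzero, so there is exactly one common root \<open>w\<close>, and
  this root is nonzero.
\<close>
lemma solutions_eq_graph:
  assumes "regular_system a b k x"
  shows "solutions a b k x =
    (\<lambda>z. (z, - poly (minor13 a b k x) z / poly (minor12 a b k x) z)) ` {z. poly (eliminant a b k x) z = 0}"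
proof -
  let ?r = "eliminant a b k x"
  let ?R = "{z. poly ?r z = 0}"
  let ?w = "\<lambda>z. - poly (minor13 a b k x) z / poly (minor12 a b k x) z"
  have R: "\<And>z. poly ?r z = 0 \<Longrightarrow> poly (minor13 a b k x) z \<noteq> 0" "\<And>z. poly ?r z = 0 \<Longrightarrow> z \<noteq> 0"
    using assms unfolding regular_system_def by auto
  have ev: "poly ?r z = poly (minor13 a b k x) z ^ 2 - poly (minor12 a b k x) z * poly (minor23 a b k x) z" for z
    by (simp add: eliminant_def power2_eq_square)
  show ?thesis
  proof (intro equalityI subsetI)
    fix y assume "y \<in> solutions a b k x"
    then obtain z w where y: "y = (z, w)" and zw: "z \<noteq> 0" "w \<noteq> 0"
      and eq: "lin_comb (fst x) (biquad a b k z w) = 0" "lin_comb (snd x) (biquad a b k z w) = 0"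
      by (auto simp: solutions_def)
    note * = common_root_of_quadratics(1)[OF eq[unfolded lin_comb_biquad]]
    then have root: "poly ?r z = 0" unfolding ev minor12_def minor13_def minor23_def by simp
    have m: "poly (minor12 a b k x) z * w = - poly (minor13 a b k x) z"
      using * unfolding minor12_def minor13_def by simp
    have "w = ?w z"
      unfolding nonzero_eq_divide_eq[OF minor12_nonzero[OF assms root]] using m by (simp only: mult.commute)
    then show "y \<in> (\<lambda>z. (z, ?w z)) ` ?R" using y root by auto
  next
    fix y assume "y \<in> (\<lambda>z. (z, ?w z)) ` ?R"
    then obtain z where z: "poly ?r z = 0" and y: "y = (z, ?w z)" by auto
    have m13: "poly (minor13 a b k x) z \<noteq> 0" and z0: "z \<noteq> 0" using R z by auto
    have rel: "poly (minor13 a b k x) z ^ 2 = poly (minor12 a b k x) z * poly (minor23 a b k x) z"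
      using z ev by simp
    have m12: "poly (minor12 a b k x) z \<noteq> 0" using minor12_nonzero[OF assms z] .
    have "lin_comb (fst x) (biquad a b k z (?w z)) = 0 \<and> lin_comb (snd x) (biquad a b k z (?w z)) = 0"
      unfolding lin_comb_biquad
      using common_root_of_quadratics(2)[of "poly (coefA a b k (fst x)) z" "poly (coefC a b k (snd x)) z"
          "poly (coefA a b k (snd x)) z" "poly (coefC a b k (fst x)) z" "poly (coefB a b k (snd x)) z"
          "poly (coefB a b k (fst x)) z"] rel m13
      by (simp add: minor12_def minor13_def minor23_def)
    then show "y \<in> solutions a b k x" using y z0 m12 m13 by (auto simp: solutions_def)
  qed
qed

lemma card_solutions:
  assumes "regular_system a b k x"
  shows "finite (solutions a b k x)" and "card (solutions a b k x) = 8"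
proof -
  let ?r = "eliminant a b k x"
  let ?R = "{z. poly ?r z = 0}"
  have c8: "coeff ?r 8 \<noteq> 0" and R: "\<And>z. poly ?r z = 0 \<Longrightarrow> poly (pderiv ?r) z \<noteq> 0"
    using assms unfolding regular_system_def by auto
  have deg: "degree ?r = 8"
    using c8 degree_eliminant[of a b k x] le_degree[of ?r 8] by linarith
  have r0: "?r \<noteq> 0" using c8 by auto
  have "card ?R = 8" using card_roots_eq_degree[OF r0 R] deg by simp
  moreover have "finite ?R" using r0 by (rule poly_roots_finite)
  moreover have "inj_on (\<lambda>z. (z, - poly (minor13 a b k x) z / poly (minor12 a b k x) z)) ?R"
    by (auto simp: inj_on_def)
  ultimately show "finite (solutions a b k x)" "card (solutions a b k x) = 8"
    unfolding solutions_eq_graph[OF assms] by (simp_all add: card_image)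
qed

lemma coeffs_tendsto_minor:
  "coeffs_tendsto (minor12 a b k) (minor12 a b k x) (nhds x)"
  "coeffs_tendsto (minor13 a b k) (minor13 a b k x) (nhds x)"
  "coeffs_tendsto (minor23 a b k) (minor23 a b k x) (nhds x)"
proof -
  have t: "((\<lambda>y. fst y $ i) \<longlongrightarrow> fst x $ i) (nhds x)" "((\<lambda>y. snd y $ i) \<longlongrightarrow> snd x $ i) (nhds x)" for i
    by (intro tendsto_vec_nth tendsto_fst tendsto_snd filterlim_ident)+
  have c: "coeffs_tendsto (\<lambda>y. coefA a b k (fst y)) (coefA a b k (fst x)) (nhds x)"
       "coeffs_tendsto (\<lambda>y. coefB a b k (fst y)) (coefB a b k (fst x)) (nhds x)"
       "coeffs_tendsto (\<lambda>y. coefC a b k (fst y)) (coefC a b k (fst x)) (nhds x)"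
       "coeffs_tendsto (\<lambda>y. coefA a b k (snd y)) (coefA a b k (snd x)) (nhds x)"
       "coeffs_tendsto (\<lambda>y. coefB a b k (snd y)) (coefB a b k (snd x)) (nhds x)"
       "coeffs_tendsto (\<lambda>y. coefC a b k (snd y)) (coefC a b k (snd x)) (nhds x)"
    unfolding coefA_def coefB_def coefC_def
    by (intro coeffs_tendsto_pCons coeffs_tendsto_const tendsto_intros t)+
  note mm = coeffs_tendsto_diff[OF coeffs_tendsto_mult coeffs_tendsto_mult]
  show "coeffs_tendsto (minor12 a b k) (minor12 a b k x) (nhds x)"
    using mm[OF c(1,5,4,2)] unfolding minor12_def[abs_def] .
  show "coeffs_tendsto (minor13 a b k) (minor13 a b k x) (nhds x)"
    using mm[OF c(1,6,4,3)] unfolding minor13_def[abs_def] .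
  show "coeffs_tendsto (minor23 a b k) (minor23 a b k x) (nhds x)"
    using mm[OF c(2,6,5,3)] unfolding minor23_def[abs_def] .
qed

lemma coeffs_tendsto_eliminant: "coeffs_tendsto (eliminant a b k) (eliminant a b k x) (nhds x)"
  unfolding eliminant_def[abs_def]
  by (intro coeffs_tendsto_diff coeffs_tendsto_mult coeffs_tendsto_minor)

lemma eliminant_no_common_root_stable:
  assumes "coeff (eliminant a b k x) 8 \<noteq> 0"
    and "coeffs_tendsto q (q x) (nhds x)" "\<And>x. degree (q x) \<le> m"
    and "\<And>z. poly (eliminant a b k x) z = 0 \<Longrightarrow> poly (q x) z \<noteq> 0"
  shows "\<forall>\<^sub>F y in nhds x. \<forall>z. poly (eliminant a b k y) z = 0 \<longrightarrow> poly (q y) z \<noteq> 0"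
  using no_common_root_stable[OF coeffs_tendsto_eliminant, of a b k 7 x q "q x" m]
    assms degree_eliminant by simp

lemma misses_infinity_stable:
  assumes "misses_infinity a b x"
  shows "\<forall>\<^sub>F y in nhds x. misses_infinity a b y"
proof -
  have t: "((\<lambda>y. fst y $ i) \<longlongrightarrow> fst x $ i) (nhds x)" "((\<lambda>y. snd y $ i) \<longlongrightarrow> snd x $ i) (nhds x)" for i
    by (intro tendsto_vec_nth tendsto_fst tendsto_snd tendsto_ident_at filterlim_ident)+
  have ne: "\<forall>\<^sub>F y in nhds x. f y \<noteq> g y"
    if "(f \<longlongrightarrow> f x) (nhds x)" "(g \<longlongrightarrow> g x) (nhds x)" "f x \<noteq> g x" for f g :: "_ \<Rightarrow> complex"
    using tendsto_imp_eventually_ne[OF tendsto_diff[OF that(1,2)], of 0] that(3) by simp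
  show ?thesis
    using assms unfolding misses_infinity_def
    by (auto intro!: eventually_conj ne tendsto_intros t)
qed

lemma regular_system_stable:
  assumes "regular_system a b k x"
  shows "\<forall>\<^sub>F y in nhds x. regular_system a b k y"
proof -
  have c8: "coeff (eliminant a b k x) 8 \<noteq> 0"
    and R: "\<And>z. poly (eliminant a b k x) z = 0 \<Longrightarrow> poly (pderiv (eliminant a b k x)) z \<noteq> 0"
    "\<And>z. poly (eliminant a b k x) z = 0 \<Longrightarrow> poly (minor13 a b k x) z \<noteq> 0"
    "\<And>z. poly (eliminant a b k x) z = 0 \<Longrightarrow> poly [:0, 1:] z \<noteq> 0"
    and inf: "misses_infinity a b x"
    using assms unfolding regular_system_def by auto
  have "\<forall>\<^sub>F y in nhds x. coeff (eliminant a b k y) 8 \<noteq> 0"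
    using coeffs_tendsto_eliminant[of a b k x] c8
    unfolding coeffs_tendsto_def by (intro tendsto_imp_eventually_ne) auto
  moreover have "degree (pderiv (eliminant a b k y)) \<le> 8" for y
    using degree_eliminant[of a b k y] by (simp add: degree_pderiv)
  then have "\<forall>\<^sub>F y in nhds x. \<forall>z. poly (eliminant a b k y) z = 0 \<longrightarrow> poly (pderiv (eliminant a b k y)) z \<noteq> 0"
    by (intro eliminant_no_common_root_stable[OF c8 coeffs_tendsto_pderiv[OF coeffs_tendsto_eliminant] _ R(1)])
  moreover have "\<forall>\<^sub>F y in nhds x. \<forall>z. poly (eliminant a b k y) z = 0 \<longrightarrow> poly (minor13 a b k y) z \<noteq> 0"
    by (rule eliminant_no_common_root_stable[OF c8 coeffs_tendsto_minor(2) degree_minor(2) R(2)])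
  moreover have "degree [:0, 1::complex:] \<le> 1" by simp
  then have "\<forall>\<^sub>F y in nhds x. \<forall>z. poly (eliminant a b k y) z = 0 \<longrightarrow> poly [:0, 1:] z \<noteq> 0"
    by (rule eliminant_no_common_root_stable[OF c8 coeffs_tendsto_const _ R(3)])
  moreover note misses_infinity_stable[OF inf]
  ultimately show ?thesis
  proof eventually_elim
    case (elim y)
    then show ?case unfolding regular_system_def by blast
  qed
qed

section \<open>A system with eight solutions\<close>

text \<open>
  Different parameters can have the same image only where the second component of \<open>biquad\<close> vanishes.
\<close>
definition off_double_curve :: "real \<Rightarrow> real \<Rightarrow> real \<Rightarrow> (complex^5) \<times> (complex^5) \<Rightarrow> bool" where
  "off_double_curve a b k x \<longleftrightarrow> (\<forall>(z, w) \<in> solutions a b k x. biquad a b k z w $ 2 \<noteq> 0)"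

text \<open>
  The second component of \<open>biquad\<close> at the common root \<open>w = - minor13 / minor12\<close>, multiplied by the
  square of \<open>minor12\<close>.
\<close>
definition double_poly :: "real \<Rightarrow> real \<Rightarrow> real \<Rightarrow> (complex^5) \<times> (complex^5) \<Rightarrow> complex poly" where
  "double_poly a b k x = [:0, b:] * (minor13 a b k x * minor13 a b k x + minor12 a b k x * minor12 a b k x)
     - [:a, 0, a:] * (minor12 a b k x * minor13 a b k x)"

lemma off_double_curve_iff:
  assumes "regular_system a b k x"
  shows "off_double_curve a b k x \<longleftrightarrow>
    (\<forall>z. poly (eliminant a b k x) z = 0 \<longrightarrow> poly (double_poly a b k x) z \<noteq> 0)"
proof -
  have *: "biquad a b k z w $ 2 * m12^2 = poly (double_poly a b k x) z"
    if "w = - m13 / m12" "m12 \<noteq> 0" "m12 = poly (minor12 a b k x) z" "m13 = poly (minor13 a b k x) z" for z w m12 m13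
  proof -
    have "w * m12 = - m13" using that by simp
    then have "(w * m12)^2 = m13^2" by simp
    have "biquad a b k z w $ 2 * m12^2 = a * (z^2+1) * (w * m12) * m12 + b * z * ((w * m12)^2 + m12^2)"
      by (simp add: biquad_def algebra_simps power2_eq_square)
    also have "\<dots> = b * z * (m13^2 + m12^2) - a * (z^2 + 1) * (m12 * m13)"
      using \<open>w * m12 = - m13\<close> by (simp add: algebra_simps)
    also have "\<dots> = poly (double_poly a b k x) z"
      unfolding double_poly_def that(3,4) by (simp add: algebra_simps power2_eq_square)
    finally show ?thesis .
  qed
  show ?thesis
    unfolding off_double_curve_def solutions_eq_graph[OF assms]
    using * minor12_nonzero[OF assms] by fastforce
qed

lemma off_double_curve_stable:
  assumes reg: "regular_system a b k x" and off: "off_double_curve a b k x"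
  shows "\<forall>\<^sub>F y in nhds x. regular_system a b k y \<and> off_double_curve a b k y"
proof -
  have c8: "coeff (eliminant a b k x) 8 \<noteq> 0" using reg unfolding regular_system_def by blast
  have t: "coeffs_tendsto (double_poly a b k) (double_poly a b k x) (nhds x)"
    unfolding double_poly_def[abs_def]
    by (intro coeffs_tendsto_diff coeffs_tendsto_mult coeffs_tendsto_add coeffs_tendsto_const coeffs_tendsto_minor)
  have d: "degree (double_poly a b k y) \<le> 10" for y
  proof -
    have 1: "degree (minor13 a b k y * minor13 a b k y + minor12 a b k y * minor12 a b k y) \<le> 8"
      using degree_mult_le_add[OF degree_minor(2,2)[of a b k y]]
        degree_mult_le_add[OF degree_minor(1,1)[of a b k y]] by (auto intro!: degree_add_le)
    have 2: "degree (minor12 a b k y * minor13 a b k y) \<le> 8"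
      using degree_mult_le_add[OF degree_minor(1,2)[of a b k y]] by simp
    have 3: "degree [:0, b::complex:] \<le> 2" "degree [:a, 0, a::complex:] \<le> 2" by simp_all
    show ?thesis
      unfolding double_poly_def
      using degree_mult_le_add[OF 3(1) 1] degree_mult_le_add[OF 3(2) 2] by (auto intro!: degree_diff_le)
  qed
  have "\<forall>\<^sub>F y in nhds x. \<forall>z. poly (eliminant a b k y) z = 0 \<longrightarrow> poly (double_poly a b k y) z \<noteq> 0"
    by (rule eliminant_no_common_root_stable[OF c8 t d]) (use off off_double_curve_iff[OF reg] in blast)
  with regular_system_stable[OF reg] show ?thesis
    by eventually_elim (use off_double_curve_iff in blast)
qed

text \<open>
  In the notation \<open>z = p + \<i> s\<close>, \<open>w = q + \<i> r\<close> the two equations are \<open>s - r = c\<close> and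
  \<open>4 (p q + k s r) = \<i>\<close>. For \<open>c = 0\<close> the first one means \<open>w = z\<close> or \<open>z w = - 1\<close>, which makes the
  eliminant factor. The constant \<open>\<i>\<close> is chosen because it is not real.
\<close>
definition sample_system :: "real \<Rightarrow> (complex^5) \<times> (complex^5)" where
  "sample_system c = (vector [- 2 * \<i> * c, 0, 1, -1, 0], vector [- \<i>, 0, 0, 0, 1])"

text \<open>
  The factors \<open>f\<close> and \<open>g\<close> express the second equation for \<open>w = z\<close> and for \<open>w = - 1/z\<close>. Each way in
  which nonzero roots could degenerate leads to an equation with real coefficients except for one
  term that involves \<open>\<i>\<close>.
\<close>
lemma regular_sample_system:
  assumes k: "k^2 < 1"
  shows "regular_system a b k (sample_system 0)"
proof -
  have k1: "- 1 < k" "k < 1" using k abs_square_less_1[of k] by auto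
  define m where "m = 2 * (1 + complex_of_real k) - \<i>"
  define m' where "m' = 2 * (1 - complex_of_real k) + \<i>"
  define f where "f = [:1 - complex_of_real k, 0, m, 0, 1 - complex_of_real k:]"
  define g where "g = [:1 + complex_of_real k, 0, m', 0, 1 + complex_of_real k:]"
  let ?x = "sample_system 0"
  have k2: "1 - complex_of_real k \<noteq> 0" "1 + complex_of_real k \<noteq> 0"
    using k1 by (auto simp: complex_eq_iff)
  have r: "eliminant a b k ?x = f * g"
    by (simp add: eliminant_def minor12_def minor13_def minor23_def coefA_def coefB_def coefC_def sample_system_def
          f_def g_def m_def m'_def algebra_simps)
  have m13: "minor13 a b k ?x = [:0, -2, 0, -2:]"
    by (simp add: minor13_def coefA_def coefC_def sample_system_def algebra_simps)
  have pf: "poly f z = complex_of_real (1 - k) * ((z^2)^2 + 1) + m * z^2" for z :: complex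
    by (simp add: f_def algebra_simps power2_eq_square)
  have pg: "poly g z = complex_of_real (1 + k) * ((z^2)^2 + 1) + m' * z^2" for z :: complex
    by (simp add: g_def algebra_simps power2_eq_square)
  have df: "poly (pderiv f) z = 2 * z * (2 * complex_of_real (1 - k) * z^2 + m)" for z :: complex
    by (simp add: f_def pderiv_pCons algebra_simps power2_eq_square)
  have dg: "poly (pderiv g) z = 2 * z * (2 * complex_of_real (1 + k) * z^2 + m')" for z :: complex
    by (simp add: g_def pderiv_pCons algebra_simps power2_eq_square)
  \<comment> \<open>A multiple root of a palindromic quadratic in \<open>Z = z\<^sup>2\<close> is \<open>1\<close> or \<open>- 1\<close>, and then the middle
    coefficient is real.\<close>
  have sqf: "False" if "q * (Z^2 + 1) + n * Z = 0" "2 * q * Z + n = 0" "q = complex_of_real s" "s \<noteq> 0" "Im n \<noteq> 0" for q n s Z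
  proof -
    have n: "n = - 2 * q * Z" using that(2) by (simp add: eq_neg_iff_add_eq_0 add.commute)
    have "q * (1 - Z^2) = 0" using that(1) unfolding n by (simp add: algebra_simps power2_eq_square)
    then have "Z^2 = 1" using that(3,4) by simp
    then have "Z = 1 \<or> Z = -1" by (simp add: power2_eq_1_iff)
    then show False using n that(3,5) by auto
  qed
  have Im: "Im m \<noteq> 0" "Im m' \<noteq> 0" by (auto simp: m_def m'_def)
  have nz: "z \<noteq> 0" if "poly f z = 0 \<or> poly g z = 0" for z
    using that k2 pf[of 0] pg[of 0] by auto
  have cancel: "2 * x * y = 0 \<Longrightarrow> x \<noteq> 0 \<Longrightarrow> y = 0" for x y :: complex by simp
  have cancel2: "x * y^2 = 0 \<Longrightarrow> y \<noteq> 0 \<Longrightarrow> x = 0" for x y :: complex by simp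
  have f': "poly (pderiv f) z \<noteq> 0" if "poly f z = 0" for z
  proof
    assume "poly (pderiv f) z = 0"
    then have "2 * z * (2 * complex_of_real (1 - k) * z^2 + m) = 0" unfolding df .
    moreover have "z \<noteq> 0" using nz that by blast
    ultimately have 2: "2 * complex_of_real (1 - k) * z^2 + m = 0" by (rule cancel)
    have 1: "complex_of_real (1 - k) * ((z^2)^2 + 1) + m * z^2 = 0"
      using that unfolding pf .
    have 3: "1 - k \<noteq> 0" using k1 by linarith
    show False using sqf[OF 1 2 refl 3] Im(1) by simp
  qed
  have g': "poly (pderiv g) z \<noteq> 0" if "poly g z = 0" for z
  proof
    assume "poly (pderiv g) z = 0"
    then have "2 * z * (2 * complex_of_real (1 + k) * z^2 + m') = 0" unfolding dg .
    moreover have "z \<noteq> 0" using nz that by blast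
    ultimately have 2: "2 * complex_of_real (1 + k) * z^2 + m' = 0" by (rule cancel)
    have 1: "complex_of_real (1 + k) * ((z^2)^2 + 1) + m' * z^2 = 0"
      using that unfolding pg .
    have 3: "1 + k \<noteq> 0" using k1 by linarith
    show False using sqf[OF 1 2 refl 3] Im(2) by simp
  qed
  have fg: "False" if "poly f z = 0" "poly g z = 0" for z
  proof -
    have "(m * complex_of_real (1 + k) - m' * complex_of_real (1 - k)) * z^2 =
      complex_of_real (1 + k) * poly f z - complex_of_real (1 - k) * poly g z"
      unfolding pf pg by (simp add: algebra_simps)
    then have "(m * complex_of_real (1 + k) - m' * complex_of_real (1 - k)) * z^2 = 0"
      unfolding that by simp
    moreover have "z \<noteq> 0" using nz that by blast
    ultimately have "m * complex_of_real (1 + k) - m' * complex_of_real (1 - k) = 0" by (rule cancel2)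
    then have "Im (m * complex_of_real (1 + k) - m' * complex_of_real (1 - k)) = 0" by (metis zero_complex.sel(2))
    then show False by (simp add: m_def m'_def)
  qed
  have i: "poly [:0, -2, 0, -2::complex:] z \<noteq> 0" if "poly f z = 0 \<or> poly g z = 0" for z
  proof
    assume *: "poly [:0, -2, 0, -2::complex:] z = 0"
    have "poly [:0, -2, 0, -2::complex:] z = 2 * z * (- 1 - z^2)"
      by (simp add: algebra_simps power2_eq_square)
    then have "2 * z * (- 1 - z^2) = 0" using * by metis
    moreover have "z \<noteq> 0" using nz that by blast
    ultimately have "- 1 - z^2 = 0" by (rule cancel)
    then have zz: "z^2 = -1" by (metis eq_iff_diff_eq_0)
    have "Im (poly f z) = - Im m" "Im (poly g z) = - Im m'" unfolding pf pg zz by simp_all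
    then show False using Im that by auto
  qed
  have c8: "coeff (f * g) 8 \<noteq> 0"
  proof -
    have "degree f = 4" "degree g = 4" using k2 by (simp_all add: f_def g_def)
    then have "coeff (f * g) 8 = coeff f 4 * coeff g 4"
      using coeff_mult_degree_sum[of f g] by simp
    then show ?thesis using k2 by (simp add: f_def g_def numeral_eq_Suc)
  qed
  have inf: "misses_infinity a b ?x"
    by (simp add: misses_infinity_def sample_system_def)
  show ?thesis
    unfolding regular_system_def r m13
  proof (intro conjI allI impI)
    fix z assume "poly (f * g) z = 0"
    then have fz: "poly f z = 0 \<or> poly g z = 0" by simp
    show "poly [:0, -2, 0, -2::complex:] z \<noteq> 0" using i fz by blast
    show "poly [:0, 1:] z \<noteq> 0" using nz[OF fz] by simp
    from fz show "poly (pderiv (f * g)) z \<noteq> 0"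
    proof
      assume "poly f z = 0"
      then show ?thesis using f'[of z] fg[of z] by (auto simp: pderiv_mult)
    next
      assume "poly g z = 0"
      then show ?thesis using g'[of z] fg[of z] by (auto simp: pderiv_mult)
    qed
  qed (use c8 inf in auto)
qed

text \<open>
  On the double curve \<open>a p = - b q\<close>. Squaring and substituting \<open>s = r + c\<close> gives an equation for
  \<open>r\<close> of degree at most two with real coefficients, whose discriminant is a positive multiple of
  \<open>(a\<^sup>2 - b\<^sup>2)\<^sup>2 + (a b c)\<^sup>2\<close>. So \<open>r\<close> is real, hence also \<open>s\<close> and \<open>p q = - (b/a) q\<^sup>2\<close>, which contradicts
  \<open>4 (p q + k s r) = \<i>\<close>.
\<close>
lemma sample_system_off_double_curve:
  assumes "a > 0" "b > 0" "c \<noteq> 0"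
  shows "off_double_curve a b k (sample_system c)"
  unfolding off_double_curve_def
proof (clarify)
  fix z w :: complex
  assume sol: "(z, w) \<in> solutions a b k (sample_system c)" and e2: "biquad a b k z w $ 2 = 0"
  have zw: "z \<noteq> 0" "w \<noteq> 0" using sol by (auto simp: solutions_def)
  define p q s r where "p = (z + 1/z)/2" and "q = (w + 1/w)/2" and "s = (z - 1/z)/(2*\<i>)" and "r = (w - 1/w)/(2*\<i>)"
  have circ: "p^2 = 1 - s^2" "q^2 = 1 - r^2"
    using zw by (simp_all add: p_def q_def s_def r_def field_simps power2_eq_square)
  have zp: "2 * z * p = z^2 + 1" and wq: "2 * w * q = w^2 + 1"
    and zs: "2 * \<i> * z * s = z^2 - 1" and wr: "2 * \<i> * w * r = w^2 - 1"
    using zw by (simp_all add: p_def q_def s_def r_def field_simps power2_eq_square)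
  have e1: "biquad a b k z w $ 1 = z * w" by (simp add: biquad_def)
  have "biquad a b k z w $ 2 = a * w * (2 * z * p) + b * z * (2 * w * q)"
    unfolding zp wq by (simp add: biquad_def)
  then have e2': "biquad a b k z w $ 2 = 2 * z * w * (a * p + b * q)" by (simp add: algebra_simps)
  have "biquad a b k z w $ 3 = w * (2 * \<i> * z * s)" "biquad a b k z w $ 4 = z * (2 * \<i> * w * r)"
    unfolding zs wr by (simp_all add: biquad_def)
  then have e34: "biquad a b k z w $ 3 = 2 * \<i> * z * w * s" "biquad a b k z w $ 4 = 2 * \<i> * z * w * r"
    by (simp_all add: mult_ac)
  have "biquad a b k z w $ 5 = (2 * z * p) * (2 * w * q) - k * ((2 * \<i> * z * s) * (2 * \<i> * w * r))"
    unfolding zp wq zs wr by (simp add: biquad_def algebra_simps)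
  then have e5: "biquad a b k z w $ 5 = 4 * z * w * (p * q + k * s * r)" by (simp add: algebra_simps)
  note e = e1 e2' e34 e5
  have "2 * z * w * (a * p + b * q) = 0" using e2 unfolding e(2) .
  then have "a * p + b * q = 0" using zw by simp
  then have 1: "a * p = - (b * q)" by (simp add: eq_neg_iff_add_eq_0)
  have "lin_comb (fst (sample_system c)) (biquad a b k z w) = 2 * \<i> * z * w * (s - r - c)"
    by (simp add: lin_comb_def sum_5 e sample_system_def algebra_simps)
  then have "2 * \<i> * z * w * (s - r - c) = 0" using sol unfolding solutions_def by auto
  then have "s - r - c = 0" using zw by simp
  then have sr: "s = r + c" by (simp add: algebra_simps)
  have "lin_comb (snd (sample_system c)) (biquad a b k z w) = z * w * (4 * (p * q + k * s * r) - \<i>)"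
    by (simp add: lin_comb_def sum_5 e sample_system_def algebra_simps)
  then have 2: "4 * (p * q + k * s * r) = \<i>" using sol zw by (simp add: solutions_def)
  have "(a * p)^2 = (b * q)^2" using 1 by simp
  then have "a^2 * (1 - (r + c)^2) = complex_of_real b^2 * (1 - r^2)"
    unfolding power_mult_distrib circ sr by simp
  then have re: "Re (a^2 * (1 - (r + c)^2)) = Re (complex_of_real b^2 * (1 - r^2))"
    and im: "Im (a^2 * (1 - (r + c)^2)) = Im (complex_of_real b^2 * (1 - r^2))" by simp_all
  \<comment> \<open>The equation is \<open>g r\<^sup>2 + 2 a\<^sup>2 c r + a\<^sup>2 c\<^sup>2 - g = 0\<close> with \<open>g = a\<^sup>2 - b\<^sup>2\<close>. For \<open>r = X + \<i> Y\<close> with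
    \<open>Y \<noteq> 0\<close> its imaginary part determines \<open>g X\<close>; inserted into \<open>g\<close> times the real part, this leaves a
    sum of squares.\<close>
  have "Im r = 0"
  proof (rule ccontr)
    assume y: "Im r \<noteq> 0"
    define g X Y where "g = a^2 - b^2" and "X = Re r" and "Y = Im r"
    have "2 * ((g * X + a^2 * c) * Y) = Im (complex_of_real b^2 * (1 - r^2)) - Im (a^2 * (1 - (r + c)^2))"
      by (simp add: g_def X_def Y_def power2_eq_square algebra_simps)
    then have "(g * X + a^2 * c) * Y = 0" using im by simp
    then have "g * X + a^2 * c = 0" using y by (simp add: Y_def)
    then have gX: "g * X = - (a^2 * c)" by simp
    have "g * (1 - X^2 + Y^2) - 2 * a^2 * c * X - a^2 * c^2 =
        Re (a^2 * (1 - (r + c)^2)) - Re (complex_of_real b^2 * (1 - r^2))"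
      by (simp add: g_def X_def Y_def power2_eq_square algebra_simps)
    then have re0: "g * (1 - X^2 + Y^2) - 2 * a^2 * c * X - a^2 * c^2 = 0" using re by simp
    have "g^2 - (g * X)^2 + g^2 * Y^2 - 2 * a^2 * c * (g * X) - g * a^2 * c^2 =
        g * (g * (1 - X^2 + Y^2) - 2 * a^2 * c * X - a^2 * c^2)"
      by (simp add: power2_eq_square algebra_simps)
    then have re1: "g^2 - (g * X)^2 + g^2 * Y^2 - 2 * a^2 * c * (g * X) - g * a^2 * c^2 = 0"
      unfolding re0 by simp
    have "g^2 - (- (a^2 * c))^2 + g^2 * Y^2 - 2 * a^2 * c * (- (a^2 * c)) - g * a^2 * c^2 =
        g^2 + g^2 * Y^2 + (a * b * c)^2"
      by (simp add: g_def power2_eq_square algebra_simps)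
    then have "g^2 + g^2 * Y^2 + (a * b * c)^2 = 0"
      using re1 unfolding gX by simp
    moreover have "(a * b * c)^2 > 0" using assms by simp
    moreover have "g^2 \<ge> 0" "g^2 * Y^2 \<ge> 0" by simp_all
    ultimately show False by linarith
  qed
  then have r': "r = complex_of_real r'" if "r' = Re r" for r' using that by (simp add: complex_eq_iff)
  define r' where "r' = Re r"
  note r' = r'[OF r'_def]
  have "p = a * p / a" using assms by simp
  then have "p = - (b * q) / a" unfolding 1 .
  then have "p * q = - (b / a) * q^2" by (simp add: power2_eq_square)
  then have "p * q = complex_of_real (- (b / a) * (1 - r'^2))" unfolding circ r' by simp
  then have "4 * (p * q + k * s * r) = complex_of_real (4 * (- (b / a) * (1 - r'^2) + k * (r' + c) * r'))"
    unfolding sr r' by simp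
  then have "Im (4 * (p * q + k * s * r)) = 0" by (metis Im_complex_of_real)
  then show False unfolding 2 by simp
qed

text \<open>
  The system with \<open>c = 0\<close> is regular, and so are those with small \<open>c \<noteq> 0\<close>, which in addition
  avoid the double curve. Both properties then hold for all systems nearby.
\<close>
theorem eight_solutions_generically:
  assumes "a > 0" "b > 0" "k^2 < 1"
  shows "\<exists>x0. \<forall>\<^sub>F x in nhds x0. finite (solutions a b k x) \<and> card (solutions a b k x) = 8 \<and>
    off_double_curve a b k x \<and> misses_infinity a b x"
proof -
  have first: "((\<lambda>c. - (2 * \<i> * complex_of_real c)) \<longlongrightarrow> 0) (at 0)"
    by (auto intro!: tendsto_eq_intros)
  have "(sample_system \<longlongrightarrow> sample_system 0) (at 0)"
    unfolding sample_system_def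
  proof (intro tendsto_Pair tendsto_const)
    show "((\<lambda>c::real. vector [- 2 * \<i> * c, 0, 1, -1, 0]) \<longlongrightarrow>
        (vector [- 2 * \<i> * complex_of_real 0, 0, 1, -1, 0] :: complex^5)) (at 0)"
    proof (rule vec_tendstoI)
      fix i :: 5
      show "((\<lambda>c. (vector [- 2 * \<i> * complex_of_real c, 0, 1, -1, 0] :: complex^5) $ i) \<longlongrightarrow>
          (vector [- 2 * \<i> * complex_of_real 0, 0, 1, -1, 0] :: complex^5) $ i) (at 0)"
        using exhaust_5[of i] first by auto
    qed
  qed
  then have "\<forall>\<^sub>F c in at 0. regular_system a b k (sample_system c)"
    using regular_system_stable[OF regular_sample_system[OF assms(3)]] by (simp add: filterlim_iff)
  moreover have "\<forall>\<^sub>F c in at 0. (c::real) \<noteq> 0" by (simp add: eventually_at_filter)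
  ultimately have "\<forall>\<^sub>F c in at (0::real). regular_system a b k (sample_system c) \<and> c \<noteq> 0"
    by eventually_elim simp
  then obtain c where c: "regular_system a b k (sample_system c)" "c \<noteq> 0"
    using eventually_happens'[of "at (0::real)"] by auto
  have "\<forall>\<^sub>F x in nhds (sample_system c). regular_system a b k x \<and> off_double_curve a b k x"
    using off_double_curve_stable[OF c(1) sample_system_off_double_curve[OF assms(1,2) c(2)]] .
  then have "\<forall>\<^sub>F x in nhds (sample_system c). finite (solutions a b k x) \<and> card (solutions a b k x) = 8 \<and>
    off_double_curve a b k x \<and> misses_infinity a b x"
  proof eventually_elim
    case (elim x)
    then show ?case using card_solutions[of a b k x] unfolding regular_system_def by blast
  qed
  then show ?thesis by blast
qed

section \<open>Circles\<close>

lemma norm_eq_iff_square: "0 \<le> r \<Longrightarrow> norm x = r \<longleftrightarrow> (norm x)^2 = r^2"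
  by simp

lemma obtain_unit_vector:
  fixes L :: "'a::euclidean_space set"
  assumes "subspace L" "dim L \<ge> 1"
  obtains u where "u \<in> L" "norm u = 1"
proof -
  have "\<not> L \<subseteq> {0}"
  proof
    assume "L \<subseteq> {0}"
    then have "dim L \<le> dim {0::'a}" by (rule dim_subset)
    moreover have "dim {0::'a} = 0" by simp
    ultimately show False using assms(2) by linarith
  qed
  then obtain t where t: "t \<in> L" "t \<noteq> 0" by auto
  then have "(1 / norm t) *\<^sub>R t \<in> L" "norm ((1 / norm t) *\<^sub>R t) = 1"
    using assms(1) by (auto simp: subspace_scale)
  then show ?thesis using that by blast
qed

lemma span_pair: "span {u, v} = {x *\<^sub>R u + y *\<^sub>R v | x y. True}" for u v :: "'a::real_vector"
proof (intro equalityI subsetI)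
  fix t assume "t \<in> span {u, v}"
  then obtain x where "t - x *\<^sub>R u \<in> span {v}" using span_breakdown_eq by blast
  then obtain y where "t - x *\<^sub>R u - y *\<^sub>R v = 0" unfolding span_breakdown_eq[of _ v "{}"] by auto
  then have "t = x *\<^sub>R u + y *\<^sub>R v" by (simp add: algebra_simps)
  then show "t \<in> {x *\<^sub>R u + y *\<^sub>R v | x y. True}" by blast
next
  fix t assume "t \<in> {x *\<^sub>R u + y *\<^sub>R v | x y. True}"
  then show "t \<in> span {u, v}"
    by (auto intro!: span_add span_scale intro: span_base)
qed

lemma independent_pair:
  fixes u v :: "'a::euclidean_space"
  assumes "\<And>x y. x *\<^sub>R u + y *\<^sub>R v = 0 \<Longrightarrow> x = 0 \<and> y = 0"
  shows "independent {u, v}" "u \<noteq> v"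
proof -
  have "v \<noteq> 0" using assms[of 0 1] by auto
  have "u \<notin> span {v}"
  proof
    assume "u \<in> span {v}"
    then obtain y where "u - y *\<^sub>R v = 0" unfolding span_breakdown_eq[of _ v "{}"] by auto
    then show False using assms[of 1 "-y"] by simp
  qed
  then show "independent {u, v}" "u \<noteq> v"
    using \<open>v \<noteq> 0\<close> by (auto simp: independent_insert span_base)
qed

lemma dim_span_pair:
  fixes u v :: "'a::euclidean_space"
  assumes "\<And>x y. x *\<^sub>R u + y *\<^sub>R v = 0 \<Longrightarrow> x = 0 \<and> y = 0"
  shows "dim (span {u, v}) = 2"
proof -
  have "independent {u, v}" using assms by (rule independent_pair(1))
  moreover have "u \<noteq> v" using assms by (rule independent_pair(2))
  ultimately show ?thesis by (simp add: dim_eq_card_independent)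
qed

lemma dim_span_orthonormal_pair:
  fixes u v :: "'a::euclidean_space"
  assumes "norm u = 1" "norm v = 1" "u \<bullet> v = 0"
  shows "dim (span {u, v}) = 2"
proof (rule dim_span_pair)
  fix x y assume 0: "x *\<^sub>R u + y *\<^sub>R v = 0"
  have "(x *\<^sub>R u + y *\<^sub>R v) \<bullet> u = x" "(x *\<^sub>R u + y *\<^sub>R v) \<bullet> v = y"
    using assms by (simp_all add: inner_add_left norm_eq_1 inner_commute[of v u])
  then show "x = 0 \<and> y = 0" unfolding 0 by simp
qed

lemma plane_basis:
  fixes L :: "'a::euclidean_space set"
  assumes L: "subspace L" "dim L = 2" and u: "u \<in> L" "norm u = 1"
  obtains v where "v \<in> L" "norm v = 1" "u \<bullet> v = 0" "L = {x *\<^sub>R u + y *\<^sub>R v | x y. True}"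
proof -
  have "\<not> L \<subseteq> span {u}"
  proof
    assume "L \<subseteq> span {u}"
    then have "dim L \<le> dim (span {u})" by (rule dim_subset)
    also have "\<dots> \<le> 1" using dim_le_card'[of "{u}"] by simp
    finally show False using L by simp
  qed
  then obtain t where t: "t \<in> L" "t \<notin> span {u}" by auto
  define s where "s = t - (t \<bullet> u) *\<^sub>R u"
  have "s \<in> L" unfolding s_def using t u L(1) by (intro subspace_diff subspace_scale)
  have "s \<noteq> 0"
  proof
    assume "s = 0"
    then have "t = (t \<bullet> u) *\<^sub>R u" by (simp add: s_def)
    then show False using t(2) by (metis span_base span_scale singletonI)
  qed
  have uu: "u \<bullet> u = 1" using u by (simp add: norm_eq_1)
  have us: "u \<bullet> s = 0" using uu by (simp add: s_def inner_diff_right inner_commute)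
  define v where "v = (1 / norm s) *\<^sub>R s"
  have v: "v \<in> L" "norm v = 1" "u \<bullet> v = 0"
    using \<open>s \<in> L\<close> \<open>s \<noteq> 0\<close> us L(1) by (auto simp: v_def subspace_scale)
  have "span {u, v} = L"
    using dim_span_orthonormal_pair[OF u(2) v(2,3)] L u v
    by (intro subspace_dim_equal subspace_span span_minimal) auto
  then show ?thesis using that[OF v] span_pair by metis
qed

lemma is_circle_iff_subspace:
  "is_circle C \<longleftrightarrow> (\<exists>c r L. r > 0 \<and> subspace L \<and> dim L = 2 \<and> C = {c + l | l. l \<in> L \<and> norm l = r})"
proof
  assume "is_circle C"
  then obtain c r P where *: "r > 0" "affine P" "aff_dim P = 2" "c \<in> P" "C = sphere c r \<inter> P"
    unfolding is_circle_def by blast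
  define L where "L = (\<lambda>x. (-c) + x) ` P"
  have L: "subspace L" unfolding L_def using *(2,4) by (rule affine_diffs_subspace)
  moreover have "dim L = 2"
    using aff_dim_translation_eq[of "-c" P] aff_dim_subspace[OF L] *(3) by (simp add: L_def)
  moreover have "C = {c + l | l. l \<in> L \<and> norm l = r}"
  proof (intro equalityI subsetI)
    fix y assume "y \<in> C"
    then have "y = c + (-c + y)" "-c + y \<in> L" "norm (-c + y) = r"
      unfolding * L_def by (auto simp: dist_norm norm_minus_commute)
    then show "y \<in> {c + l | l. l \<in> L \<and> norm l = r}" by blast
  next
    fix y assume "y \<in> {c + l | l. l \<in> L \<and> norm l = r}"
    then obtain l where "y = c + l" "l \<in> L" "norm l = r" by blast
    then show "y \<in> C" unfolding * L_def by (auto simp: dist_norm)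
  qed
  ultimately show "\<exists>c r L. r > 0 \<and> subspace L \<and> dim L = 2 \<and> C = {c + l | l. l \<in> L \<and> norm l = r}"
    using *(1) by blast
next
  assume "\<exists>c r L. r > 0 \<and> subspace L \<and> dim L = 2 \<and> C = {c + l | l. l \<in> L \<and> norm l = r}"
  then obtain c r L where *: "r > 0" "subspace L" "dim L = 2" "C = {c + l | l. l \<in> L \<and> norm l = r}"
    by blast
  define P where "P = (+) c ` L"
  have "affine P" unfolding P_def using * by (simp add: affine_translation[symmetric] subspace_imp_affine)
  moreover have "aff_dim P = 2" unfolding P_def using * by (simp add: aff_dim_translation_eq aff_dim_subspace)
  moreover have "c \<in> P" unfolding P_def using subspace_0[OF *(2)] by force
  moreover have "C = sphere c r \<inter> P" unfolding *(4) P_def by (auto simp: dist_norm)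
  ultimately show "is_circle C" unfolding is_circle_def using *(1) by blast
qed

lemma circle_in_basis:
  assumes "norm u = 1" "norm v = 1" "u \<bullet> v = 0" "r > 0"
  shows "{c + l | l. l \<in> {x *\<^sub>R u + y *\<^sub>R v | x y. True} \<and> norm l = r} =
    {c + x *\<^sub>R u + y *\<^sub>R v | x y. x^2 + y^2 = r^2}"
proof -
  have "(norm (x *\<^sub>R u + y *\<^sub>R v))^2 = x^2 + y^2" for x y
    unfolding power2_norm_eq_inner using assms
    by (simp add: inner_add_left inner_add_right norm_eq_1 inner_commute power2_eq_square)
  then have "norm (x *\<^sub>R u + y *\<^sub>R v) = r \<longleftrightarrow> x^2 + y^2 = r^2" for x y
    using assms(4) norm_eq_iff_square[of r "x *\<^sub>R u + y *\<^sub>R v" for x y] by simp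
  then show ?thesis by (auto simp: add.assoc)
qed

lemma is_circle_param:
  assumes "norm u = 1" "norm v = 1" "u \<bullet> v = 0" "r > 0"
  shows "is_circle {c + x *\<^sub>R u + y *\<^sub>R v | x y. x^2 + y^2 = r^2}"
proof -
  let ?L = "{x *\<^sub>R u + y *\<^sub>R v | x y. True}"
  have "subspace ?L" "dim ?L = 2"
    using dim_span_orthonormal_pair[OF assms(1-3)] subspace_span[of "{u, v}"] unfolding span_pair by auto
  then show ?thesis
    unfolding is_circle_iff_subspace circle_in_basis[OF assms, symmetric] using assms(4) by blast
qed

lemma circle_paramE:
  assumes "is_circle C"
  obtains c u v r where "r > 0" "norm u = 1" "norm v = 1" "u \<bullet> v = 0"
    "C = {c + x *\<^sub>R u + y *\<^sub>R v | x y. x^2 + y^2 = r^2}"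
proof -
  obtain c r L where *: "r > 0" "subspace L" "dim L = 2" "C = {c + l | l. l \<in> L \<and> norm l = r}"
    using assms unfolding is_circle_iff_subspace by blast
  obtain u where u: "u \<in> L" "norm u = 1" using obtain_unit_vector[OF *(2)] *(3) by auto
  obtain v where v: "v \<in> L" "norm v = 1" "u \<bullet> v = 0" "L = {x *\<^sub>R u + y *\<^sub>R v | x y. True}"
    by (rule plane_basis[OF *(2,3) u])
  have "C = {c + x *\<^sub>R u + y *\<^sub>R v | x y. x^2 + y^2 = r^2}"
    unfolding *(4) v(4) by (rule circle_in_basis[OF u(2) v(2,3) *(1)])
  then show ?thesis by (rule that[OF *(1) u(2) v(2,3)])
qed

lemma infinite_circle:
  assumes "is_circle C"
  shows "infinite C"
proof -
  obtain c u v r where C: "r > 0" "norm u = 1" "norm v = 1" "u \<bullet> v = 0"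
    "C = {c + x *\<^sub>R u + y *\<^sub>R v | x y. x^2 + y^2 = r^2}" using assms by (rule circle_paramE)
  define f where "f = (\<lambda>x. c + x *\<^sub>R u + sqrt (r^2 - x^2) *\<^sub>R v)"
  have "inj_on f {0..r}"
  proof (rule inj_onI)
    fix x y assume "f x = f y"
    then have "f x \<bullet> u = f y \<bullet> u" by simp
    then show "x = y" using C(1-4) by (auto simp: f_def inner_add_left norm_eq_1 inner_commute[of v u])
  qed
  moreover have "f ` {0..r} \<subseteq> C"
  proof
    fix y assume "y \<in> f ` {0..r}"
    then obtain x where x: "0 \<le> x" "x \<le> r" "y = f x" by auto
    then have "x^2 \<le> r^2" by (intro power_mono) auto
    then have "x^2 + (sqrt (r^2 - x^2))^2 = r^2" by simp
    then show "y \<in> C" unfolding C(5) x(3) f_def by blast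
  qed
  moreover have "infinite {0..r}" using C(1) by simp
  ultimately show ?thesis using finite_imageD finite_subset by blast
qed

lemma is_circle_sphere_section:
  fixes P :: "'a::euclidean_space set"
  assumes P: "affine P" "aff_dim P = 2" and y: "y1 \<in> sphere 0 1 \<inter> P" "y2 \<in> sphere 0 1 \<inter> P" "y1 \<noteq> y2"
  shows "is_circle (sphere 0 1 \<inter> P)"
proof -
  define L where "L = (\<lambda>x. (-y1) + x) ` P"
  have y1: "y1 \<in> P" using y by simp
  have L: "subspace L" unfolding L_def using P(1) y1 by (rule affine_diffs_subspace)
  have dimL: "dim L = 2"
    using aff_dim_translation_eq[of "-y1" P] aff_dim_subspace[OF L] P(2) by (simp add: L_def)
  obtain p where p: "p \<in> L" "norm p = 1" using obtain_unit_vector[OF L] dimL by auto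
  obtain q where q0: "q \<in> L" and q: "norm q = 1" "p \<bullet> q = 0" "L = {x *\<^sub>R p + y *\<^sub>R q | x y. True}"
    by (rule plane_basis[OF L dimL p])
  have PL: "t \<in> P \<longleftrightarrow> t - y1 \<in> L" for t unfolding L_def by (auto simp: image_iff)
  \<comment> \<open>The point of the plane that is closest to the origin is the centre of the circle.\<close>
  define c where "c = y1 - (y1 \<bullet> p) *\<^sub>R p - (y1 \<bullet> q) *\<^sub>R q"
  have pp: "p \<bullet> p = 1" "q \<bullet> q = 1" "q \<bullet> p = 0" using p q by (auto simp: norm_eq_1 inner_commute)
  have cp: "c \<bullet> p = 0" "c \<bullet> q = 0" using pp q(2) by (simp_all add: c_def inner_diff_left)
  have "c - y1 = (- (y1 \<bullet> p)) *\<^sub>R p + (- (y1 \<bullet> q)) *\<^sub>R q" by (simp add: c_def)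
  then have cL: "c - y1 \<in> L" unfolding q(3) by blast
  have Pc: "t \<in> P \<longleftrightarrow> t - c \<in> L" for t
    unfolding PL using cL L subspace_add[OF L, of "t - c" "c - y1"] subspace_diff[OF L, of "t - y1" "c - y1"] by auto
  have perp: "c \<bullet> l = 0" if "l \<in> L" for l using that cp unfolding q(3) by (auto simp: inner_add_right)
  have norm: "(norm (c + l))^2 = (norm c)^2 + (norm l)^2" if "l \<in> L" for l
    using perp[OF that] unfolding power2_norm_eq_inner by (simp add: inner_add_left inner_add_right inner_commute)
  define r where "r = sqrt (1 - (norm c)^2)"
  have sph: "norm (c + l) = 1 \<longleftrightarrow> (norm l)^2 = 1 - (norm c)^2" if "l \<in> L" for l
  proof -
    have "norm (c + l) = 1 \<longleftrightarrow> (norm (c + l))^2 = 1"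
      using norm_eq_iff_square[of 1 "c + l"] by simp
    then show ?thesis using norm[OF that] by linarith
  qed
  have l1: "y1 - c \<in> L" "y2 - c \<in> L" using y Pc by auto
  have n: "(norm (y1 - c))^2 = 1 - (norm c)^2" "(norm (y2 - c))^2 = 1 - (norm c)^2"
    using sph[OF l1(1)] sph[OF l1(2)] y by auto
  have "1 - (norm c)^2 > 0"
  proof (rule ccontr)
    assume "\<not> 1 - (norm c)^2 > 0"
    then have "(norm (y1 - c))^2 \<le> 0" "(norm (y2 - c))^2 \<le> 0" using n by auto
    then show False using y(3) by simp
  qed
  then have r: "r > 0" "r^2 = 1 - (norm c)^2" by (auto simp: r_def)
  have "norm (c + l) = 1 \<longleftrightarrow> norm l = r" if "l \<in> L" for l
    unfolding sph[OF that] r(2)[symmetric] using norm_eq_iff_square[of r l] r(1) by simp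
  note n2 = this
  have "sphere 0 1 \<inter> P = {c + l | l. l \<in> L \<and> norm l = r}"
  proof (intro equalityI subsetI)
    fix t assume t: "t \<in> sphere 0 1 \<inter> P"
    then have "t - c \<in> L" "norm (c + (t - c)) = 1" using Pc by simp_all
    then have "t = c + (t - c)" "t - c \<in> L" "norm (t - c) = r" using n2[of "t - c"] by simp_all
    then show "t \<in> {c + l | l. l \<in> L \<and> norm l = r}" by blast
  qed (use Pc n2 in auto)
  then show ?thesis unfolding is_circle_iff_subspace using r(1) L dimL by blast
qed

text \<open>
  The plane of the circle works. Opposite points \<open>c + l\<close> and \<open>c - l\<close> have the same norm, so the centre
  \<open>c\<close> is orthogonal to the directions of the plane, and Pythagoras shows that the sphere cuts the
  plane in nothing but the circle.
\<close>
lemma circle_in_unit_sphere: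
  fixes C :: "'a::euclidean_space set"
  assumes "is_circle C" "C \<subseteq> sphere 0 1"
  obtains P where "affine P" "aff_dim P = 2" "C = sphere 0 1 \<inter> P"
proof -
  obtain c r L where *: "r > 0" "subspace L" "dim L = 2" "C = {c + l | l. l \<in> L \<and> norm l = r}"
    using assms unfolding is_circle_iff_subspace by blast
  have n1: "c \<bullet> l = 0 \<and> (norm c)^2 + r^2 = 1" if "l \<in> L" "norm l = r" for l
  proof -
    have "-l \<in> L" "norm (-l) = r" using that *(2) by (auto simp: subspace_neg)
    then have "c + l \<in> C" "c + - l \<in> C" using that unfolding *(4) by blast+
    then have "c + l \<in> sphere 0 1" "c + - l \<in> sphere 0 1" using assms(2) by blast+
    then have "norm (c + l) = 1" "norm (c - l) = 1" by simp_all
    then have "(c + l) \<bullet> (c + l) = 1" "(c - l) \<bullet> (c - l) = 1" by (simp_all add: norm_eq_1)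
    then have "c \<bullet> c + 2 * (c \<bullet> l) + l \<bullet> l = 1" "c \<bullet> c - 2 * (c \<bullet> l) + l \<bullet> l = 1"
      by (simp_all add: inner_add_left inner_add_right inner_diff_left inner_diff_right inner_commute)
    moreover have "l \<bullet> l = r^2" "c \<bullet> c = (norm c)^2"
      using that(2) by (simp_all add: power2_norm_eq_inner[symmetric])
    ultimately have "c \<bullet> l = 0" "(norm c)^2 + r^2 = 1" by linarith+
    then show ?thesis by blast
  qed
  obtain u where u: "u \<in> L" "norm u = 1" using obtain_unit_vector[OF *(2)] *(3) by auto
  have cr: "(norm c)^2 + r^2 = 1"
  proof -
    have "r *\<^sub>R u \<in> L" "norm (r *\<^sub>R u) = r" using u *(1,2) by (auto simp: subspace_scale)
    then show ?thesis using n1 by blast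
  qed
  have perp: "c \<bullet> l = 0" if "l \<in> L" for l
  proof (cases "l = 0")
    case False
    have "(r / norm l) *\<^sub>R l \<in> L" "norm ((r / norm l) *\<^sub>R l) = r"
      using False that *(1,2) by (auto simp: subspace_scale)
    then have "c \<bullet> ((r / norm l) *\<^sub>R l) = 0" using n1 by blast
    then show ?thesis using False *(1) by simp
  qed simp
  have n2: "norm (c + l) = 1 \<longleftrightarrow> norm l = r" if "l \<in> L" for l
  proof -
    have "(norm (c + l))^2 = (norm c)^2 + (norm l)^2"
      using perp[OF that] unfolding power2_norm_eq_inner by (simp add: inner_add_left inner_add_right inner_commute)
    then have "(norm (c + l))^2 = 1 \<longleftrightarrow> (norm l)^2 = r^2" using cr by linarith
    moreover have "norm (c + l) = 1 \<longleftrightarrow> (norm (c + l))^2 = 1" "norm l = r \<longleftrightarrow> (norm l)^2 = r^2"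
      using norm_eq_iff_square[of 1 "c + l"] norm_eq_iff_square[of r l] *(1) by simp_all
    ultimately show ?thesis by blast
  qed
  have eq: "C = sphere 0 1 \<inter> (+) c ` L" unfolding *(4) by (auto simp: n2)
  have "affine ((+) c ` L)" using *(2) by (simp add: affine_translation[symmetric] subspace_imp_affine)
  moreover have "aff_dim ((+) c ` L) = 2" using *(2,3) by (simp add: aff_dim_translation_eq aff_dim_subspace)
  ultimately show ?thesis by (rule that) (rule eq)
qed

lemma sphere_not_collinear:
  fixes x y z :: "'a::euclidean_space"
  assumes "norm x = 1" "norm y = 1" "norm z = 1" "x \<noteq> y" "x \<noteq> z" "y \<noteq> z"
  shows "\<not> collinear {x, y, z}"
proof
  assume "collinear {x, y, z}"
  then obtain s where s: "y = s *\<^sub>R x + (1 - s) *\<^sub>R z"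
    unfolding collinear_3_expand using assms by auto
  have "x \<bullet> x = 1" "y \<bullet> y = 1" "z \<bullet> z = 1" using assms by (auto simp: norm_eq_1)
  then have "s^2 + (1 - s)^2 + 2 * s * (1 - s) * (x \<bullet> z) = 1"
    unfolding s by (simp add: inner_add_left inner_add_right inner_commute power2_eq_square algebra_simps)
  then have "2 * s * (1 - s) * (x \<bullet> z - 1) = 0"
    by (simp add: power2_eq_square algebra_simps)
  moreover have "x \<bullet> z \<noteq> 1"
  proof
    assume "x \<bullet> z = 1"
    then have "(x - z) \<bullet> (x - z) = 0" using \<open>x \<bullet> x = 1\<close> \<open>z \<bullet> z = 1\<close>
      by (simp add: inner_diff_left inner_diff_right inner_commute)
    then show False using assms by simp
  qed
  ultimately have "s = 0 \<or> s = 1" by auto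
  then show False using s assms by auto
qed

text \<open>
  Three points of a sphere are not collinear, so they determine the plane that cuts out the circle.
\<close>
lemma circles_in_sphere_eqI:
  fixes C C' :: "'a::euclidean_space set"
  assumes C: "is_circle C" "C \<subseteq> sphere 0 1" and C': "is_circle C'" "C' \<subseteq> sphere 0 1"
    and inf: "infinite (C \<inter> C')"
  shows "C = C'"
proof -
  obtain P where P: "affine P" "aff_dim P = 2" "C = sphere 0 1 \<inter> P" using circle_in_unit_sphere[OF C] .
  obtain P' where P': "affine P'" "aff_dim P' = 2" "C' = sphere 0 1 \<inter> P'" using circle_in_unit_sphere[OF C'] .
  obtain T where T: "T \<subseteq> C \<inter> C'" "finite T" "card T = 3" using infinite_arbitrarily_large[OF inf] by blast
  then obtain x y z where xyz: "T = {x, y, z}" "x \<noteq> y" "x \<noteq> z" "y \<noteq> z" by (auto simp: card_3_iff)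
  have "\<not> collinear T" unfolding xyz(1)
    by (rule sphere_not_collinear) (use T xyz C in \<open>auto simp: dist_norm\<close>)
  then have "aff_dim (affine hull T) \<ge> 2" by (simp add: collinear_aff_dim)
  moreover have "T \<subseteq> P" "T \<subseteq> P'" using T(1) P(3) P'(3) by auto
  then have sub: "affine hull T \<subseteq> P" "affine hull T \<subseteq> P'"
    using hull_minimal[of T P affine, OF _ P(1)] hull_minimal[of T P' affine, OF _ P'(1)] by blast+
  ultimately have ad: "aff_dim (affine hull T) = 2" using aff_dim_subset[OF sub(1)] P(2) by linarith
  have ne: "affine hull T \<noteq> {}" using xyz by auto
  have "affine hull T = P" "affine hull T = P'"
    using affine_dim_equal[OF affine_affine_hull P(1) ne sub(1)] affine_dim_equal[OF affine_affine_hull P'(1) ne sub(2)]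
      ad P(2) P'(2) by simp_all
  then show ?thesis using P(3) P'(3) by simp
qed

section \<open>Stereographic projection\<close>

definition istereo :: "real^3 \<Rightarrow> real^4" where
  "istereo x = (1 / (x \<bullet> x + 1)) *\<^sub>R vector [2 * x$1, 2 * x$2, 2 * x$3, x \<bullet> x - 1]"

lemma inner_3: "x \<bullet> y = x$1 * y$1 + x$2 * y$2 + x$3 * y$3" for x y :: "real^3"
  by (simp add: inner_vec_def sum_3)

lemma inner_4: "x \<bullet> y = x$1 * y$1 + x$2 * y$2 + x$3 * y$3 + x$4 * y$4" for x y :: "real^4"
  by (simp add: inner_vec_def sum_4)

lemma istereo_4: "istereo x $ 4 = (x \<bullet> x - 1) / (x \<bullet> x + 1)"
  by (simp add: istereo_def)

lemma istereo_height: "1 - istereo x $ 4 = 2 / (x \<bullet> x + 1)"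
proof -
  have "x \<bullet> x + 1 > 0" using inner_ge_zero[of x] by linarith
  then show ?thesis by (simp add: istereo_4 field_simps)
qed

lemma istereo_4_neq_1: "istereo x $ 4 \<noteq> 1"
proof -
  have "x \<bullet> x + 1 > 0" using inner_ge_zero[of x] by linarith
  then show ?thesis using istereo_height[of x] by auto
qed

lemma istereo_in_sphere: "istereo x \<in> sphere 0 1"
proof -
  have d: "x \<bullet> x + 1 > 0" using inner_ge_zero[of x] by linarith
  let ?v = "vector [2 * x$1, 2 * x$2, 2 * x$3, x \<bullet> x - 1] :: real^4"
  have "?v \<bullet> ?v = 4 * (x \<bullet> x) + (x \<bullet> x - 1)^2"
    unfolding inner_4 by (simp add: inner_3 power2_eq_square algebra_simps)
  also have "\<dots> = (x \<bullet> x + 1)^2" by (simp add: power2_eq_square algebra_simps)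
  finally have "norm ?v = x \<bullet> x + 1" using d by (simp add: norm_eq_sqrt_inner)
  then have "norm (istereo x) = 1" using d by (simp add: istereo_def)
  then show ?thesis by simp
qed

lemma stereo_istereo: "stereo (istereo x) = x"
proof -
  have d: "x \<bullet> x + 1 > 0" using inner_ge_zero[of x] by linarith
  show ?thesis
    unfolding stereo_def istereo_height
    using d by (simp add: vec_eq_iff forall_3 istereo_def)
qed

lemma istereo_stereo:
  assumes "y \<in> sphere 0 1" "y $ 4 \<noteq> 1"
  shows "istereo (stereo y) = y"
proof -
  have "norm y = 1" using assms(1) by simp
  then have "y \<bullet> y = 1" by (simp add: norm_eq_1)
  then have s: "(y$1)^2 + (y$2)^2 + (y$3)^2 = (1 - y$4) * (1 + y$4)"
    by (simp add: inner_4 power2_eq_square algebra_simps)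
  have h: "1 - y$4 \<noteq> 0" using assms(2) by simp
  have "stereo y \<bullet> stereo y = ((y$1)^2 + (y$2)^2 + (y$3)^2) / (1 - y$4)^2"
    by (simp add: inner_3 stereo_def power2_eq_square add_divide_distrib)
  also have "\<dots> = (1 + y$4) / (1 - y$4)" unfolding s using h by (simp add: power2_eq_square)
  finally have n: "stereo y \<bullet> stereo y = (1 + y$4) / (1 - y$4)" .
  have n1: "stereo y \<bullet> stereo y + 1 = 2 / (1 - y$4)" "stereo y \<bullet> stereo y - 1 = 2 * y$4 / (1 - y$4)"
    unfolding n using h by (simp_all add: field_simps)
  show ?thesis
    unfolding istereo_def n1 using h by (simp add: vec_eq_iff forall_4 stereo_def)
qed

lemma stereo_preimage_eq_image: "stereo_preimage Z = istereo ` Z"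
proof (intro equalityI subsetI)
  fix y assume "y \<in> stereo_preimage Z"
  then show "y \<in> istereo ` Z"
    unfolding stereo_preimage_def using istereo_stereo[of y] by (auto simp: image_iff intro!: bexI[of _ "stereo y"])
next
  fix y assume "y \<in> istereo ` Z"
  then show "y \<in> stereo_preimage Z"
    unfolding stereo_preimage_def using istereo_in_sphere istereo_4_neq_1 stereo_istereo by auto
qed

lemma inj_istereo: "inj istereo"
  by (rule inj_on_inverseI[of _ stereo]) (rule stereo_istereo)

definition lift4 :: "real^3 \<Rightarrow> real \<Rightarrow> real^4" where
  "lift4 x t = vector [x$1, x$2, x$3, t]"

lemma lift4_nth [simp]:
  "lift4 x t $ 1 = x $ 1" "lift4 x t $ 2 = x $ 2" "lift4 x t $ 3 = x $ 3" "lift4 x t $ 4 = t"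
  by (simp_all add: lift4_def)

text \<open>
  On the circle \<open>D\<close> the function \<open>x \<bullet> x\<close> agrees with an affine function, so \<open>istereo\<close> agrees there with
  a projective map. Hence the image lies in a plane \<open>P\<close>. Conversely, \<open>P\<close> does not contain the
  projection centre, so every point of the sphere on \<open>P\<close> has a stereographic image, which turns out
  to satisfy the equation of \<open>D\<close>.
\<close>
lemma is_circle_istereo_image:
  assumes "is_circle D"
  shows "is_circle (istereo ` D)" "istereo ` D \<subseteq> sphere 0 1"
proof -
  show "istereo ` D \<subseteq> sphere 0 1" using istereo_in_sphere by blast
  obtain c p q r where D: "r > 0" "norm p = 1" "norm q = 1" "p \<bullet> q = 0"
    "D = {c + x *\<^sub>R p + y *\<^sub>R q | x y. x^2 + y^2 = r^2}"
    by (rule circle_paramE[OF assms])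
  have pq: "p \<bullet> p = 1" "q \<bullet> q = 1" "q \<bullet> p = 0" using D by (auto simp: norm_eq_1 inner_commute)
  define m d2 d3 where "m = c \<bullet> c + r^2" and "d2 = 2 * (c \<bullet> p)" and "d3 = 2 * (c \<bullet> q)"
  define d1 where "d1 = m + 1"
  have d1: "d1 > 0" using inner_ge_zero[of c] zero_le_power2[of r] unfolding d1_def m_def by linarith
  have nrm: "(c + x *\<^sub>R p + y *\<^sub>R q) \<bullet> (c + x *\<^sub>R p + y *\<^sub>R q) = c \<bullet> c + x * d2 + y * d3 + x^2 + y^2" for x y
    using pq D(4) unfolding d2_def d3_def
    by (simp add: inner_add_left inner_add_right inner_commute[of p c] inner_commute[of q c] power2_eq_square algebra_simps)
  \<comment> \<open>Multiplied by \<open>x \<bullet> x + 1 = d1 + x1 d2 + x2 d3\<close>, the image of \<open>x = c + x1 p + x2 q\<close> is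
    \<open>V1 + x1 V2 + x2 V3\<close>. The plane \<open>P\<close> consists of the combinations of \<open>V1, V2, V3\<close> on which the
    denominator is 1.\<close>
  define V1 V2 V3 where "V1 = lift4 (2 *\<^sub>R c) (m - 1)" and "V2 = lift4 (2 *\<^sub>R p) d2" and "V3 = lift4 (2 *\<^sub>R q) d3"
  define e0 where "e0 = (1 / d1) *\<^sub>R V1"
  define W2 W3 where "W2 = V2 - d2 *\<^sub>R e0" and "W3 = V3 - d3 *\<^sub>R e0"
  define P where "P = (+) e0 ` span {W2, W3}"
  have pt: "e0 + al *\<^sub>R W2 + be *\<^sub>R W3 = ((1 - al * d2 - be * d3) / d1) *\<^sub>R V1 + al *\<^sub>R V2 + be *\<^sub>R V3" for al be
    unfolding W2_def W3_def e0_def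
    by (simp add: scaleR_diff_right scaleR_diff_left diff_divide_distrib)
  have pt4: "(t *\<^sub>R V1 + al *\<^sub>R V2 + be *\<^sub>R V3) $ 4 = 1 - 2 * t" if "t * d1 = 1 - al * d2 - be * d3" for t al be
    using that unfolding V1_def V2_def V3_def d1_def by (simp add: algebra_simps)
  have indep: "al = 0 \<and> be = 0" if "al *\<^sub>R p + be *\<^sub>R q = 0" for al be
  proof -
    have "(al *\<^sub>R p + be *\<^sub>R q) \<bullet> p = al" "(al *\<^sub>R p + be *\<^sub>R q) \<bullet> q = be"
      using pq D(4) by (simp_all add: inner_add_left)
    then show ?thesis unfolding that by simp
  qed
  have "dim (span {W2, W3}) = 2"
  proof (rule dim_span_pair)
    fix al be assume 0: "al *\<^sub>R W2 + be *\<^sub>R W3 = 0"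
    define s where "s = (al * d2 + be * d3) / d1"
    have eq: "al *\<^sub>R V2 + be *\<^sub>R V3 = s *\<^sub>R V1"
      using 0 unfolding W2_def W3_def e0_def s_def
      by (simp add: scaleR_diff_right add_divide_distrib scaleR_add_left algebra_simps)
    from arg_cong[OF this, of "\<lambda>v. v $ 4"] have "al * d2 + be * d3 = s * (m - 1)"
      by (simp add: V1_def V2_def V3_def)
    moreover have "al * d2 + be * d3 = s * (m + 1)" using d1 by (simp add: s_def d1_def)
    ultimately have "s = 0" by (simp add: algebra_simps)
    then have "al *\<^sub>R V2 + be *\<^sub>R V3 = 0" using eq by simp
    then have "al *\<^sub>R p + be *\<^sub>R q = 0"
      by (simp add: V2_def V3_def vec_eq_iff forall_3 forall_4)
    then show "al = 0 \<and> be = 0" by (rule indep)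
  qed
  then have P: "affine P" "aff_dim P = 2"
    unfolding P_def by (simp_all add: affine_translation[symmetric] subspace_imp_affine aff_dim_translation_eq aff_dim_subspace)
  have "istereo ` D = sphere 0 1 \<inter> P"
  proof (intro equalityI subsetI)
    fix y assume "y \<in> istereo ` D"
    then obtain x1 x2 where x: "x1^2 + x2^2 = r^2" and y: "y = istereo (c + x1 *\<^sub>R p + x2 *\<^sub>R q)"
      unfolding D(5) by blast
    let ?X = "c + x1 *\<^sub>R p + x2 *\<^sub>R q"
    define d where "d = d1 + x1 * d2 + x2 * d3"
    have XX: "?X \<bullet> ?X + 1 = d" "?X \<bullet> ?X - 1 = m - 1 + x1 * d2 + x2 * d3"
      unfolding nrm d_def d1_def m_def using x by simp_all
    then have d: "d > 0" using inner_ge_zero[of ?X] by linarith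
    have "1 - x1 / d * d2 - x2 / d * d3 = (d - x1 * d2 - x2 * d3) / d"
      using d by (simp add: diff_divide_distrib)
    also have "\<dots> = d1 / d" by (simp add: d_def)
    finally have "(1 - x1 / d * d2 - x2 / d * d3) / d1 = 1 / d" using d1 by simp
    then have "e0 + (x1 / d) *\<^sub>R W2 + (x2 / d) *\<^sub>R W3 = (1 / d) *\<^sub>R V1 + (x1 / d) *\<^sub>R V2 + (x2 / d) *\<^sub>R V3"
      unfolding pt by simp
    also have "\<dots> = istereo ?X"
      unfolding istereo_def XX
      by (simp add: vec_eq_iff forall_4 V1_def V2_def V3_def add_divide_distrib diff_divide_distrib algebra_simps)
    finally have "y = e0 + ((x1 / d) *\<^sub>R W2 + (x2 / d) *\<^sub>R W3)" using y by (simp add: add.assoc)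
    then have "y \<in> P" unfolding P_def span_pair by blast
    then show "y \<in> sphere 0 1 \<inter> P" using istereo_in_sphere y by blast
  next
    fix y assume "y \<in> sphere 0 1 \<inter> P"
    then obtain al be where y: "y = e0 + al *\<^sub>R W2 + be *\<^sub>R W3" and sph: "y \<in> sphere 0 1"
      unfolding P_def span_pair by (auto simp: add.assoc)
    define t where "t = (1 - al * d2 - be * d3) / d1"
    have td: "t * d1 = 1 - al * d2 - be * d3" using d1 by (simp add: t_def)
    have yV: "y = t *\<^sub>R V1 + al *\<^sub>R V2 + be *\<^sub>R V3" unfolding y pt t_def ..
    have y4: "y $ 4 = 1 - 2 * t" unfolding yV by (rule pt4[OF td])
    have y123: "y $ i = 2 * (t *\<^sub>R c + al *\<^sub>R p + be *\<^sub>R q) $ j" if "(i, j) \<in> {(1, 1), (2, 2), (3, 3)}" for i j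
      using that unfolding yV V1_def V2_def V3_def by (auto simp: algebra_simps)
    have "norm y = 1" using sph by simp
    then have yy: "y \<bullet> y = 1" by (simp add: norm_eq_1)
    have "t \<noteq> 0"
    proof
      assume t0: "t = 0"
      then have "(y$1)^2 + (y$2)^2 + (y$3)^2 = 0"
        using yy y4 unfolding inner_4 by (simp add: power2_eq_square)
      then have "(y$1)^2 = 0" "(y$2)^2 = 0" "(y$3)^2 = 0"
        using zero_le_power2[of "y$1"] zero_le_power2[of "y$2"] zero_le_power2[of "y$3"] by linarith+
      then have "y$1 = 0" "y$2 = 0" "y$3 = 0" by simp_all
      then have "al *\<^sub>R p + be *\<^sub>R q = 0"
        using y123[of 1 1] y123[of 2 2] y123[of 3 3] t0 by (simp add: vec_eq_iff forall_3)
      then show False using indep[of al be] td t0 by simp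
    qed
    define x1 x2 where "x1 = al / t" and "x2 = be / t"
    have ne: "y $ 4 \<noteq> 1" using y4 \<open>t \<noteq> 0\<close> by simp
    have st: "stereo y = c + x1 *\<^sub>R p + x2 *\<^sub>R q"
      unfolding stereo_def using y4 \<open>t \<noteq> 0\<close> y123[of 1 1] y123[of 2 2] y123[of 3 3]
      by (simp add: vec_eq_iff forall_3 x1_def x2_def add_divide_distrib)
    have "istereo (stereo y) = y" by (rule istereo_stereo[OF sph ne])
    then have "(stereo y \<bullet> stereo y - 1) / (stereo y \<bullet> stereo y + 1) = 1 - 2 * t" using y4 istereo_4 by metis
    moreover have "stereo y \<bullet> stereo y + 1 > 0" using inner_ge_zero[of "stereo y"] by linarith
    ultimately have "stereo y \<bullet> stereo y - 1 = (1 - 2 * t) * (stereo y \<bullet> stereo y + 1)" by (simp add: divide_eq_eq)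
    then have "t * (stereo y \<bullet> stereo y) = 1 - t" by (simp add: algebra_simps)
    then have "t * (c \<bullet> c + x1 * d2 + x2 * d3 + x1^2 + x2^2) = 1 - t" unfolding st nrm .
    moreover have "t * (x1 * d2 + x2 * d3) = 1 - t * d1" using \<open>t \<noteq> 0\<close> td by (simp add: x1_def x2_def algebra_simps)
    ultimately have "t * (x1^2 + x2^2 - r^2) = 0" unfolding d1_def m_def by (simp add: algebra_simps)
    then have "x1^2 + x2^2 = r^2" using \<open>t \<noteq> 0\<close> by simp
    then have "stereo y \<in> D" unfolding D(5) st by blast
    then show "y \<in> istereo ` D" using \<open>istereo (stereo y) = y\<close> by (metis imageI)
  qed
  note eq = this
  obtain T where T: "T \<subseteq> D" "finite T" "card T = 2"
    using infinite_arbitrarily_large[OF infinite_circle[OF assms]] by blast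
  then obtain x y where "x \<in> D" "y \<in> D" "x \<noteq> y" by (auto simp: card_2_iff)
  then have "istereo x \<in> sphere 0 1 \<inter> P" "istereo y \<in> sphere 0 1 \<inter> P" "istereo x \<noteq> istereo y"
    unfolding eq[symmetric] using inj_istereo by (auto dest: injD)
  then show "is_circle (istereo ` D)" unfolding eq by (rule is_circle_sphere_section[OF P])
qed

section \<open>The quartic of a sum of circles\<close>

text \<open>
  From \<open>p\<^sup>2 + s\<^sup>2 = a\<^sup>2\<close>, \<open>q\<^sup>2 + r\<^sup>2 = b\<^sup>2\<close> and \<open>x = p + q\<close> follows \<open>2 x p = x\<^sup>2 + a\<^sup>2 - b\<^sup>2 + r\<^sup>2 - s\<^sup>2\<close>. The
  quartic is the square of this relation with \<open>a\<^sup>2 - s\<^sup>2\<close> in place of \<open>p\<^sup>2\<close>, homogenized by \<open>h\<close>.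
\<close>
definition quartic :: "real \<Rightarrow> real \<Rightarrow> 'f::real_field \<Rightarrow> 'f \<Rightarrow> 'f \<Rightarrow> 'f \<Rightarrow> 'f" where
  "quartic a b h x s r = (x^2 + of_real (a^2 - b^2) * h^2 + r^2 - s^2)^2 - 4 * x^2 * (of_real (a^2) * h^2 - s^2)"

text \<open>
  For \<open>h = 1\<close> it says that \<open>m\<close> is the squared length of \<open>x u + s v + r w\<close>, where \<open>u\<close> is a unit vector
  orthogonal to the unit vectors \<open>v\<close> and \<open>w\<close>, and \<open>v \<bullet> w = k\<close>.
\<close>
definition quadric :: "real \<Rightarrow> 'f::real_field \<Rightarrow> 'f \<Rightarrow> 'f \<Rightarrow> 'f \<Rightarrow> 'f \<Rightarrow> 'f" where
  "quadric k h x s r m = h * m - (x^2 + s^2 + r^2 + 2 * of_real k * s * r)"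

lemma quartic_scale: "quartic a b (t * h) (t * x) (t * s) (t * r) = t^4 * quartic a b h x s r"
  unfolding quartic_def by (simp add: power_mult_distrib algebra_simps power2_eq_square power4_eq_xxxx)

lemma quadric_scale: "quadric k (t * h) (t * x) (t * s) (t * r) (t * m) = t^2 * quadric k h x s r m"
  unfolding quadric_def by (simp add: power_mult_distrib algebra_simps power2_eq_square)

lemma quartic_of_real:
  "quartic a b (of_real h) (of_real x) (of_real s) (of_real r) = (of_real (quartic a b h x s r) :: 'f::real_field)"
  unfolding quartic_def by simp

lemma quadric_of_real:
  "quadric k (of_real h) (of_real x) (of_real s) (of_real r) (of_real m) =
    (of_real (quadric k h x s r m) :: 'f::real_field)"
  unfolding quadric_def by simp

lemma quartic_param:
  fixes p q s r :: "'f::real_field"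
  assumes "p^2 + s^2 = of_real (a^2)" "q^2 + r^2 = of_real (b^2)"
  shows "quartic a b 1 (p + q) s r = 0"
proof -
  have "quartic a b 1 (p + q) s r = ((p + q)^2 + ((p^2 + s^2) - (q^2 + r^2)) + r^2 - s^2)^2 - 4 * (p + q)^2 * ((p^2 + s^2) - s^2)"
    unfolding assms by (simp add: quartic_def)
  also have "\<dots> = 0" by (simp add: power2_eq_square algebra_simps)
  finally show ?thesis .
qed

text \<open>
  Where \<open>x \<noteq> 0\<close>, the relation behind the quartic can be solved for \<open>p\<close>. As \<open>p\<close> is a rational
  expression, it is real at real points, so a real point with \<open>x \<noteq> 0\<close> belongs to the sum itself and
  not only to its complexification.
\<close>
lemma quartic_point:
  fixes x s r :: "'f::real_field"
  assumes "quartic a b 1 x s r = 0" "x \<noteq> 0"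
  defines "p \<equiv> (x^2 + of_real (a^2 - b^2) + r^2 - s^2) / (2 * x)"
  shows "p^2 + s^2 = of_real (a^2)" "(x - p)^2 + r^2 = of_real (b^2)"
proof -
  have px: "2 * x * p = x^2 + of_real (a^2 - b^2) + r^2 - s^2" using assms(2) by (simp add: p_def)
  have "(2 * x * p)^2 = 4 * x^2 * (of_real (a^2) - s^2)"
    unfolding px using assms(1) by (simp add: quartic_def)
  then have "4 * x^2 * (p^2 - (of_real (a^2) - s^2)) = 0"
    by (simp add: power_mult_distrib algebra_simps)
  then have "p^2 - (of_real (a^2) - s^2) = 0" using assms(2) by simp
  then show 1: "p^2 + s^2 = of_real (a^2)" by (simp add: algebra_simps)
  have "(x - p)^2 + r^2 = x^2 - 2 * x * p + p^2 + r^2" by (simp add: power2_eq_square algebra_simps)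
  also have "\<dots> = p^2 + s^2 - of_real (a^2 - b^2)" unfolding px by (simp add: algebra_simps)
  also have "\<dots> = of_real (b^2)" unfolding 1 by simp
  finally show "(x - p)^2 + r^2 = of_real (b^2)" .
qed

text \<open>
  The difference of the two equations determines \<open>p\<^sup>2 - q\<^sup>2\<close>, hence \<open>p - q\<close> after division by \<open>p + q\<close>.
\<close>
lemma torus_point_unique:
  fixes p q s r p' q' :: "'f::real_field"
  assumes "p^2 + s^2 = A" "q^2 + r^2 = B" "p'^2 + s^2 = A" "q'^2 + r^2 = B"
    and "p + q = p' + q'" "p + q \<noteq> 0"
  shows "p = p'" "q = q'"
proof -
  have "p^2 = A - s^2" "q^2 = B - r^2" "p'^2 = A - s^2" "q'^2 = B - r^2"
    using assms(1-4) by (simp_all add: eq_diff_eq)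
  then have "p^2 - q^2 = p'^2 - q'^2" by simp
  then have "(p + q) * (p - q) = (p' + q') * (p' - q')" by (simp add: power2_eq_square algebra_simps)
  then have "p - q = p' - q'" using assms(5,6) by simp
  then have "(p + q) + (p - q) = (p' + q') + (p' - q')" using assms(5) by simp
  then show "p = p'" by simp
  then show "q = q'" using assms(5) by simp
qed

text \<open>
  Modulo the quadric, the quartic reduces for \<open>h = 0\<close> to \<open>4 (k\<^sup>2 - 1) s\<^sup>2 r\<^sup>2\<close>.
\<close>
lemma quartic_at_infinity:
  fixes x s r :: "'f::real_field"
  assumes "quartic a b 0 x s r = 0" "x^2 + s^2 + r^2 + 2 * of_real k * s * r = 0" "k^2 < 1"
  shows "s = 0 \<or> r = 0"
proof -
  have x2: "x^2 = - (s^2) - r^2 - 2 * of_real k * s * r" using assms(2) by (simp add: algebra_simps eq_neg_iff_add_eq_0)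
  have "quartic a b 0 x s r = (x^2 + r^2 - s^2)^2 + 4 * x^2 * s^2" by (simp add: quartic_def)
  also have "\<dots> = 4 * (s * r)^2 * (of_real k^2 - 1)"
    unfolding x2 by (simp add: power2_eq_square algebra_simps)
  finally have "4 * (s * r)^2 * (of_real k^2 - 1) = 0" using assms(1) by simp
  moreover have "(of_real k^2 - 1 :: 'f) \<noteq> 0"
    using assms(3) by (metis eq_iff_diff_eq_0 less_irrefl of_real_1 of_real_eq_iff of_real_power)
  ultimately show ?thesis by simp
qed

section \<open>Coordinates adapted to the two planes\<close>

lemma orthogonal_complement_R3:
  fixes u v w d :: "real^3"
  assumes "u \<bullet> u = 1" "v \<bullet> v = 1" "w \<bullet> w = 1" "u \<bullet> v = 0" "u \<bullet> w = 0" "(v \<bullet> w)^2 < 1"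
    and d: "d \<bullet> u = 0" "d \<bullet> v = 0" "d \<bullet> w = 0"
  shows "d = 0"
proof -
  have vw: "x = 0 \<and> y = 0" if 0: "x *\<^sub>R v + y *\<^sub>R w = 0" for x y
  proof -
    have "(x *\<^sub>R v + y *\<^sub>R w) \<bullet> v = x + y * (v \<bullet> w)" "(x *\<^sub>R v + y *\<^sub>R w) \<bullet> w = x * (v \<bullet> w) + y"
      using assms by (simp_all add: inner_add_left inner_commute[of w v])
    then have e: "x + y * (v \<bullet> w) = 0" "x * (v \<bullet> w) + y = 0" unfolding 0 by simp_all
    have "y * (1 - (v \<bullet> w)^2) = (x * (v \<bullet> w) + y) - (v \<bullet> w) * (x + y * (v \<bullet> w))"
      by (simp add: power2_eq_square algebra_simps)
    then have "y * (1 - (v \<bullet> w)^2) = 0" unfolding e by simp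
    then have "y = 0" using assms(6) by auto
    then show "x = 0 \<and> y = 0" using e by simp
  qed
  have ind: "independent {v, w}" "v \<noteq> w"
    by (rule independent_pair(1); use vw in blast) (rule independent_pair(2); use vw in blast)
  have perp: "u \<bullet> t = 0" if "t \<in> span {v, w}" for t
    using orthogonal_to_span[OF that, of u] assms(4,5) by (auto simp: orthogonal_def)
  have "u \<notin> span {v, w}" using perp[of u] assms(1) by auto
  then have "independent {u, v, w}" "card {u, v, w} = 3"
    using ind by (auto simp: independent_insert card_insert_if span_base)
  then have "dim {u, v, w} = 3" by (simp add: dim_eq_card_independent)
  then have "span {u, v, w} = UNIV" by (simp add: dim_eq_full[symmetric])
  then have "orthogonal d d"
    by (intro orthogonal_to_span[of d "{u, v, w}"]) (use d in \<open>auto simp: orthogonal_def\<close>)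
  then show "d = 0" by (simp add: orthogonal_def)
qed

definition emb :: "real^4 \<Rightarrow> complex^5" where
  "emb y = vector [1, complex_of_real (y $ 1), complex_of_real (y $ 2),
                   complex_of_real (y $ 3), complex_of_real (y $ 4)]"

lemma proj_embed_eq: "proj_embed y = proj_point (emb y)"
  by (simp add: proj_embed_def emb_def)

lemma emb_nonzero: "emb y \<noteq> 0"
proof
  assume "emb y = 0"
  then have "emb y $ 1 = 0" by simp
  then show False by (simp add: emb_def)
qed

definition cdot :: "real^3 \<Rightarrow> complex^5 \<Rightarrow> complex" where
  "cdot n y = n $ 1 * y $ 2 + n $ 2 * y $ 3 + n $ 3 * y $ 4"

text \<open>
  The linear form of the tangent hyperplane at the projection centre \<open>(0, 0, 0, 1)\<close>.
\<close>
definition hgt :: "complex^5 \<Rightarrow> complex" where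
  "hgt y = y $ 1 - y $ 5"

lemma cdot_emb_istereo: "cdot n (emb (istereo x)) = complex_of_real (2 / (x \<bullet> x + 1) * (n \<bullet> x))"
  by (simp add: cdot_def emb_def istereo_def inner_3 algebra_simps add_divide_distrib)

lemma hgt_emb: "hgt (emb y) = complex_of_real (1 - y $ 4)"
  by (simp add: hgt_def emb_def)

lemma poly_fun_cdot: "complex_polynomial_function (cdot n)"
  unfolding cdot_def[abs_def] by (intro complex_polynomial_function_intros)

lemma poly_fun_hgt: "complex_polynomial_function hgt"
  unfolding hgt_def[abs_def] by (intro complex_polynomial_function_intros)

lemma cdot_scale: "cdot n (t *s y) = t * cdot n y"
  by (simp add: cdot_def algebra_simps)

lemma hgt_scale: "hgt (t *s y) = t * hgt y"
  by (simp add: hgt_def algebra_simps)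

text \<open>
  The circles have radii \<open>a\<close> and \<open>b\<close> and lie in planes with directions \<open>u, v\<close> and \<open>u, w\<close>; the point
  \<open>c\<close> is the sum of their centres.
\<close>
locale circle_sum =
  fixes a b k :: real and u v w c :: "real^3"
  assumes a_pos: "a > 0" and b_pos: "b > 0" and k_sq: "k^2 < 1"
    and uu: "u \<bullet> u = 1" and vv: "v \<bullet> v = 1" and ww: "w \<bullet> w = 1"
    and uv: "u \<bullet> v = 0" and uw: "u \<bullet> w = 0" and vw: "v \<bullet> w = k"
begin

text \<open>
  The basis dual to \<open>u, v, w\<close> is \<open>u, vd, wd\<close>.
\<close>
definition vd where "vd = (1 / (1 - k^2)) *\<^sub>R (v - k *\<^sub>R w)"
definition wd where "wd = (1 / (1 - k^2)) *\<^sub>R (w - k *\<^sub>R v)"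

lemma dual:
  "vd \<bullet> u = 0" "vd \<bullet> v = 1" "vd \<bullet> w = 0" "wd \<bullet> u = 0" "wd \<bullet> v = 0" "wd \<bullet> w = 1"
proof -
  have sym: "v \<bullet> u = 0" "w \<bullet> u = 0" "w \<bullet> v = k" using uv uw vw by (simp_all add: inner_commute)
  have k1: "1 - k^2 \<noteq> 0" using k_sq by simp
  have "vd \<bullet> t = (v \<bullet> t - k * (w \<bullet> t)) / (1 - k^2)" "wd \<bullet> t = (w \<bullet> t - k * (v \<bullet> t)) / (1 - k^2)" for t
    by (simp_all add: vd_def wd_def inner_diff_left)
  then show "vd \<bullet> u = 0" "vd \<bullet> v = 1" "vd \<bullet> w = 0" "wd \<bullet> u = 0" "wd \<bullet> v = 0" "wd \<bullet> w = 1"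
    using k1 by (simp_all add: sym vv ww vw power2_eq_square)
qed

lemma v_eq: "v = vd + k *\<^sub>R wd" and w_eq: "w = wd + k *\<^sub>R vd"
proof -
  have k1: "1 - k^2 \<noteq> 0" using k_sq by simp
  have "(1 - k^2) *\<^sub>R vd = v - k *\<^sub>R w" "(1 - k^2) *\<^sub>R wd = w - k *\<^sub>R v"
    using k1 by (simp_all add: vd_def wd_def)
  then have "(1 - k^2) *\<^sub>R (vd + k *\<^sub>R wd) = (v - k *\<^sub>R w) + k *\<^sub>R (w - k *\<^sub>R v)"
    "(1 - k^2) *\<^sub>R (wd + k *\<^sub>R vd) = (w - k *\<^sub>R v) + k *\<^sub>R (v - k *\<^sub>R w)"
    unfolding scaleR_add_right scaleR_left_commute[of "1 - k^2" k] by simp_all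
  moreover have "(v - k *\<^sub>R w) + k *\<^sub>R (w - k *\<^sub>R v) = (1 - k^2) *\<^sub>R v"
     "(w - k *\<^sub>R v) + k *\<^sub>R (v - k *\<^sub>R w) = (1 - k^2) *\<^sub>R w"
    by (simp_all add: scaleR_diff_right scaleR_diff_left power2_eq_square)
  ultimately have "(1 - k^2) *\<^sub>R (vd + k *\<^sub>R wd) = (1 - k^2) *\<^sub>R v" "(1 - k^2) *\<^sub>R (wd + k *\<^sub>R vd) = (1 - k^2) *\<^sub>R w"
    by simp_all
  then show "v = vd + k *\<^sub>R wd" "w = wd + k *\<^sub>R vd" using k1 by (simp_all only: scaleR_cancel_left) simp_all
qed

lemma expansion: "x = (u \<bullet> x) *\<^sub>R u + (vd \<bullet> x) *\<^sub>R v + (wd \<bullet> x) *\<^sub>R w"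
proof -
  define d where "d = x - ((u \<bullet> x) *\<^sub>R u + (vd \<bullet> x) *\<^sub>R v + (wd \<bullet> x) *\<^sub>R w)"
  have "u \<bullet> d = 0" "vd \<bullet> d = 0" "wd \<bullet> d = 0"
    using dual uu uv uw by (simp_all add: d_def inner_diff_right inner_add_right)
  moreover from this have "(vd + k *\<^sub>R wd) \<bullet> d = 0" "(wd + k *\<^sub>R vd) \<bullet> d = 0"
    by (simp_all add: inner_add_left)
  then have "v \<bullet> d = 0" "w \<bullet> d = 0" using v_eq w_eq by metis+
  ultimately have "d = 0"
    using orthogonal_complement_R3[OF uu vv ww uv uw, of d] k_sq vw by (simp add: inner_commute)
  then show ?thesis by (simp add: d_def)
qed

definition rX where "rX x = u \<bullet> (x - c)"
definition rS where "rS x = vd \<bullet> (x - c)"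
definition rR where "rR x = wd \<bullet> (x - c)"

lemma point_coords: "x = c + rX x *\<^sub>R u + rS x *\<^sub>R v + rR x *\<^sub>R w"
  using expansion[of "x - c"] by (simp add: rX_def rS_def rR_def algebra_simps)

lemma coords_point:
  "rX (c + x *\<^sub>R u + s *\<^sub>R v + r *\<^sub>R w) = x"
  "rS (c + x *\<^sub>R u + s *\<^sub>R v + r *\<^sub>R w) = s"
  "rR (c + x *\<^sub>R u + s *\<^sub>R v + r *\<^sub>R w) = r"
  using dual uu uv uw by (simp_all add: rX_def rS_def rR_def inner_add_right add.assoc)

lemma dist_coords: "(x - c) \<bullet> (x - c) = (rX x)^2 + (rS x)^2 + (rR x)^2 + 2 * k * rS x * rR x"
proof -
  have "x - c = rX x *\<^sub>R u + rS x *\<^sub>R v + rR x *\<^sub>R w"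
    using point_coords[of x] by (simp add: algebra_simps)
  then have "(x - c) \<bullet> (x - c) = (rX x *\<^sub>R u + rS x *\<^sub>R v + rR x *\<^sub>R w) \<bullet> (rX x *\<^sub>R u + rS x *\<^sub>R v + rR x *\<^sub>R w)"
    by simp
  also have "\<dots> = (rX x)^2 + (rS x)^2 + (rR x)^2 + 2 * k * rS x * rR x"
    using uu vv ww uv uw vw
    by (simp add: inner_add_left inner_add_right inner_commute[of v u] inner_commute[of w u] inner_commute[of w v]
        power2_eq_square algebra_simps)
  finally show ?thesis .
qed

definition Z where
  "Z = {c + (p + q) *\<^sub>R u + s *\<^sub>R v + r *\<^sub>R w | p q s r. p^2 + s^2 = a^2 \<and> q^2 + r^2 = b^2}"

text \<open>
  Homogeneous versions of the coordinates: at the image of a point \<open>x\<close> under \<open>istereo\<close>, the quotients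
  of \<open>cX, cS, cR, cM\<close> by \<open>hgt\<close> are \<open>rX x\<close>, \<open>rS x\<close>, \<open>rR x\<close> and the squared distance of \<open>x\<close> from \<open>c\<close>.
\<close>
definition cX where "cX y = cdot u y - of_real (u \<bullet> c) * hgt y"
definition cS where "cS y = cdot vd y - of_real (vd \<bullet> c) * hgt y"
definition cR where "cR y = cdot wd y - of_real (wd \<bullet> c) * hgt y"
definition cM where "cM y = y $ 1 + y $ 5 - 2 * cdot c y + of_real (c \<bullet> c) * hgt y"

lemma coords_scale:
  "cX (t *s y) = t * cX y" "cS (t *s y) = t * cS y" "cR (t *s y) = t * cR y" "cM (t *s y) = t * cM y"
  by (simp_all add: cX_def cS_def cR_def cM_def cdot_scale hgt_scale algebra_simps)

lemma coords_emb:
  fixes x defines "t \<equiv> 2 / (x \<bullet> x + 1)"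
  shows "hgt (emb (istereo x)) = of_real t"
    "cX (emb (istereo x)) = of_real (t * rX x)"
    "cS (emb (istereo x)) = of_real (t * rS x)"
    "cR (emb (istereo x)) = of_real (t * rR x)"
    "cM (emb (istereo x)) = of_real (t * ((x - c) \<bullet> (x - c)))"
    "t > 0"
proof -
  have d: "x \<bullet> x + 1 > 0" using inner_ge_zero[of x] by linarith
  then show "t > 0" by (simp add: t_def)
  show h: "hgt (emb (istereo x)) = of_real t"
    unfolding hgt_emb istereo_height t_def ..
  show "cX (emb (istereo x)) = of_real (t * rX x)"
    unfolding cX_def h cdot_emb_istereo t_def[symmetric] by (simp add: rX_def inner_diff_right algebra_simps)
  show "cS (emb (istereo x)) = of_real (t * rS x)"
    unfolding cS_def h cdot_emb_istereo t_def[symmetric] by (simp add: rS_def inner_diff_right algebra_simps)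
  show "cR (emb (istereo x)) = of_real (t * rR x)"
    unfolding cR_def h cdot_emb_istereo t_def[symmetric] by (simp add: rR_def inner_diff_right algebra_simps)
  have "1 + istereo x $ 4 = t * (x \<bullet> x)" using d by (simp add: istereo_4 t_def field_simps)
  then have "emb (istereo x) $ 1 + emb (istereo x) $ 5 = of_real (t * (x \<bullet> x))"
    by (simp add: emb_def) (metis of_real_1 of_real_add of_real_mult)
  then show "cM (emb (istereo x)) = of_real (t * ((x - c) \<bullet> (x - c)))"
    unfolding cM_def h cdot_emb_istereo t_def[symmetric]
    by (simp add: inner_diff_right inner_diff_left inner_commute[of x c] algebra_simps)
qed

text \<open>
  The values of \<open>hgt, cX, cS, cR, cM\<close> determine the vector: \<open>mid\<close> recovers its three middle components
  and \<open>nrm\<close> the sum of the first and the last one, whose difference is \<open>hgt\<close>.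
\<close>
definition mid :: "complex \<Rightarrow> complex \<Rightarrow> complex \<Rightarrow> complex \<Rightarrow> 3 \<Rightarrow> complex" where
  "mid h x s r i = h * c $ i + x * u $ i + s * v $ i + r * w $ i"

definition nrm :: "complex \<Rightarrow> complex \<Rightarrow> complex \<Rightarrow> complex \<Rightarrow> complex \<Rightarrow> complex" where
  "nrm h x s r m = m + 2 * (h * (c \<bullet> c) + x * (c \<bullet> u) + s * (c \<bullet> v) + r * (c \<bullet> w)) - of_real (c \<bullet> c) * h"

definition of_coords :: "complex \<Rightarrow> complex \<Rightarrow> complex \<Rightarrow> complex \<Rightarrow> complex \<Rightarrow> complex^5" where
  "of_coords h x s r m = vector [(nrm h x s r m + h) / 2, mid h x s r 1, mid h x s r 2, mid h x s r 3, (nrm h x s r m - h) / 2]"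

lemma of_coords_scale: "of_coords (t * h) (t * x) (t * s) (t * r) (t * m) = t *s of_coords h x s r m"
  by (simp add: vec_eq_iff forall_5 of_coords_def mid_def nrm_def algebra_simps add_divide_distrib diff_divide_distrib)

lemma cdot_of_coords: "cdot n (of_coords h x s r m) = h * of_real (n \<bullet> c) + x * of_real (n \<bullet> u) + s * of_real (n \<bullet> v) + r * of_real (n \<bullet> w)"
  by (simp add: cdot_def of_coords_def mid_def inner_3 algebra_simps)

lemma hgt_of_coords: "hgt (of_coords h x s r m) = h"
  by (simp add: hgt_def of_coords_def diff_divide_distrib[symmetric])

lemma coords_of_coords:
  "cX (of_coords h x s r m) = x" "cS (of_coords h x s r m) = s" "cR (of_coords h x s r m) = r" "cM (of_coords h x s r m) = m"
proof -
  show "cX (of_coords h x s r m) = x" "cS (of_coords h x s r m) = s" "cR (of_coords h x s r m) = r"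
    unfolding cX_def cS_def cR_def cdot_of_coords hgt_of_coords using dual uu uv uw by (simp_all add: inner_commute)
  have "of_coords h x s r m $ 1 + of_coords h x s r m $ 5 = nrm h x s r m"
    by (simp add: of_coords_def add_divide_distrib[symmetric])
  then show "cM (of_coords h x s r m) = m"
    unfolding cM_def cdot_of_coords hgt_of_coords by (simp add: nrm_def)
qed

lemma complex_expansion:
  assumes "(i, j) \<in> {(1::3, 2::5), (2, 3), (3, 4)}"
  shows "cdot u y * u $ i + cdot vd y * v $ i + cdot wd y * w $ i = y $ j"
proof -
  \<comment> \<open>Complex linear identities follow from the real ones by splitting into real and imaginary parts.\<close>
  define yr yi :: "real^3" where "yr = vector [Re (y$2), Re (y$3), Re (y$4)]" and "yi = vector [Im (y$2), Im (y$3), Im (y$4)]"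
  have cd: "cdot n y = of_real (n \<bullet> yr) + \<i> * of_real (n \<bullet> yi)" for n
    by (simp add: complex_eq_iff cdot_def inner_3 yr_def yi_def)
  have "yr $ i = (u \<bullet> yr) * u $ i + (vd \<bullet> yr) * v $ i + (wd \<bullet> yr) * w $ i"
    by (subst expansion[of yr]) simp
  moreover have "yi $ i = (u \<bullet> yi) * u $ i + (vd \<bullet> yi) * v $ i + (wd \<bullet> yi) * w $ i"
    by (subst expansion[of yi]) simp
  moreover have "yr $ i = Re (y $ j)" "yi $ i = Im (y $ j)"
    using assms by (auto simp: yr_def yi_def)
  ultimately show ?thesis unfolding cd complex_eq_iff by (simp add: algebra_simps)
qed

lemma of_coords_coords: "of_coords (hgt y) (cX y) (cS y) (cR y) (cM y) = y"
proof -
  have cexp: "of_real (u \<bullet> c) * of_real (u $ i) + of_real (vd \<bullet> c) * of_real (v $ i) + of_real (wd \<bullet> c) * of_real (w $ i) = complex_of_real (c $ i)" for i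
    unfolding of_real_mult[symmetric] of_real_add[symmetric] by (subst (4) expansion[of c]) simp
  have m: "mid (hgt y) (cX y) (cS y) (cR y) i = y $ j" if "(i, j) \<in> {(1::3, 2::5), (2, 3), (3, 4)}" for i j
  proof -
    have "mid (hgt y) (cX y) (cS y) (cR y) i = (cdot u y * u $ i + cdot vd y * v $ i + cdot wd y * w $ i)
       + hgt y * (complex_of_real (c $ i) - (complex_of_real (u \<bullet> c) * complex_of_real (u $ i)
         + complex_of_real (vd \<bullet> c) * complex_of_real (v $ i) + complex_of_real (wd \<bullet> c) * complex_of_real (w $ i)))"
      unfolding mid_def cX_def cS_def cR_def by (simp add: algebra_simps)
    also have "\<dots> = y $ j + hgt y * (complex_of_real (c $ i) - complex_of_real (c $ i))"
      by (subst complex_expansion[OF that], subst cexp, rule refl)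
    finally show ?thesis by simp
  qed
  have ms: "mid (hgt y) (cX y) (cS y) (cR y) 1 = y $ 2" "mid (hgt y) (cX y) (cS y) (cR y) 2 = y $ 3"
    "mid (hgt y) (cX y) (cS y) (cR y) 3 = y $ 4"
    using m by auto
  have "hgt y * (c \<bullet> c) + cX y * (c \<bullet> u) + cS y * (c \<bullet> v) + cR y * (c \<bullet> w) =
    c $ 1 * mid (hgt y) (cX y) (cS y) (cR y) 1 + c $ 2 * mid (hgt y) (cX y) (cS y) (cR y) 2 + c $ 3 * mid (hgt y) (cX y) (cS y) (cR y) 3"
    by (simp add: mid_def inner_3 algebra_simps)
  also have "\<dots> = cdot c y" unfolding ms by (simp add: cdot_def)
  finally have n: "nrm (hgt y) (cX y) (cS y) (cR y) (cM y) = y $ 1 + y $ 5"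
    unfolding nrm_def by (simp add: cM_def)
  show ?thesis
    unfolding of_coords_def ms n by (simp add: vec_eq_iff forall_5 hgt_def)
qed

lemma emb_istereo: "emb (istereo x) = complex_of_real (2 / (x \<bullet> x + 1)) *s
   of_coords 1 (of_real (rX x)) (of_real (rS x)) (of_real (rR x)) (of_real ((x - c) \<bullet> (x - c)))"
  using of_coords_coords[of "emb (istereo x)"] unfolding coords_emb of_coords_scale[symmetric] of_real_mult by simp

lemma point_in_Z_iff: "x \<in> Z \<longleftrightarrow> (\<exists>p q. p + q = rX x \<and> p^2 + (rS x)^2 = a^2 \<and> q^2 + (rR x)^2 = b^2)"
proof
  assume "x \<in> Z"
  then obtain p q s r where x: "x = c + (p + q) *\<^sub>R u + s *\<^sub>R v + r *\<^sub>R w" "p^2 + s^2 = a^2" "q^2 + r^2 = b^2"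
    unfolding Z_def by blast
  have "rX x = p + q" "rS x = s" "rR x = r" unfolding x(1) by (rule coords_point)+
  then show "\<exists>p q. p + q = rX x \<and> p^2 + (rS x)^2 = a^2 \<and> q^2 + (rR x)^2 = b^2"
    using x(2,3) by (intro exI[of _ p] exI[of _ q]) simp
next
  assume "\<exists>p q. p + q = rX x \<and> p^2 + (rS x)^2 = a^2 \<and> q^2 + (rR x)^2 = b^2"
  then obtain p q where pq: "p + q = rX x" "p^2 + (rS x)^2 = a^2" "q^2 + (rR x)^2 = b^2" by blast
  have "x = c + (p + q) *\<^sub>R u + rS x *\<^sub>R v + rR x *\<^sub>R w" unfolding pq by (rule point_coords)
  then show "x \<in> Z" unfolding Z_def using pq by blast
qed

section \<open>Equations of the closure\<close>

abbreviation X where "X \<equiv> moebius_closure Z"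

lemma X_hull: "X = proj_zariski_closed hull ((\<lambda>x. proj_point (emb (istereo x))) ` Z)"
  unfolding moebius_closure_def stereo_preimage_eq_image image_image proj_embed_eq ..

lemma form_vanishes_on_X:
  assumes "homogeneous_form F" "\<And>x. x \<in> Z \<Longrightarrow> F (emb (istereo x)) = 0" "proj_point y \<in> X"
  shows "F y = 0"
  using proj_hull_form_zero[OF assms(1) _ assms(3)[unfolded X_hull]] assms(2) emb_nonzero by blast

lemma poly_fun_coords:
  "complex_polynomial_function cX" "complex_polynomial_function cS" "complex_polynomial_function cR"
  "complex_polynomial_function cM"
  unfolding cX_def[abs_def] cS_def[abs_def] cR_def[abs_def] cM_def[abs_def]
  by (intro complex_polynomial_function_intros poly_fun_cdot poly_fun_hgt)+

lemma quartic_on_X: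
  assumes "proj_point y \<in> X"
  shows "quartic a b (hgt y) (cX y) (cS y) (cR y) = 0"
proof (rule form_vanishes_on_X[OF _ _ assms])
  have "complex_polynomial_function (\<lambda>y. quartic a b (hgt y) (cX y) (cS y) (cR y))"
    unfolding quartic_def by (intro complex_polynomial_function_intros poly_fun_coords poly_fun_hgt)
  then show "homogeneous_form (\<lambda>y. quartic a b (hgt y) (cX y) (cS y) (cR y))"
    unfolding homogeneous_form_def hgt_scale coords_scale quartic_scale by blast
  fix x assume "x \<in> Z"
  then obtain p q where pq: "p + q = rX x" "p^2 + (rS x)^2 = a^2" "q^2 + (rR x)^2 = b^2"
    unfolding point_in_Z_iff by blast
  have "quartic a b 1 (rX x) (rS x) (rR x) = 0"
    using quartic_param[of p "rS x" a q "rR x" b] pq by simp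
  then have "quartic a b (2 / (x \<bullet> x + 1) * 1) (2 / (x \<bullet> x + 1) * rX x) (2 / (x \<bullet> x + 1) * rS x) (2 / (x \<bullet> x + 1) * rR x) = 0"
    unfolding quartic_scale by simp
  then show "quartic a b (hgt (emb (istereo x))) (cX (emb (istereo x))) (cS (emb (istereo x))) (cR (emb (istereo x))) = 0"
    unfolding coords_emb quartic_of_real by simp
qed

lemma quadric_on_X:
  assumes "proj_point y \<in> X"
  shows "quadric k (hgt y) (cX y) (cS y) (cR y) (cM y) = 0"
proof (rule form_vanishes_on_X[OF _ _ assms])
  have "complex_polynomial_function (\<lambda>y. quadric k (hgt y) (cX y) (cS y) (cR y) (cM y))"
    unfolding quadric_def by (intro complex_polynomial_function_intros poly_fun_coords poly_fun_hgt)
  then show "homogeneous_form (\<lambda>y. quadric k (hgt y) (cX y) (cS y) (cR y) (cM y))"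
    unfolding homogeneous_form_def hgt_scale coords_scale quadric_scale by blast
  fix x assume "x \<in> Z"
  have "quadric k 1 (rX x) (rS x) (rR x) ((x - c) \<bullet> (x - c)) = 0"
    unfolding dist_coords by (simp add: quadric_def)
  then have "quadric k (2 / (x \<bullet> x + 1) * 1) (2 / (x \<bullet> x + 1) * rX x) (2 / (x \<bullet> x + 1) * rS x) (2 / (x \<bullet> x + 1) * rR x)
     (2 / (x \<bullet> x + 1) * ((x - c) \<bullet> (x - c))) = 0"
    unfolding quadric_scale by simp
  then show "quadric k (hgt (emb (istereo x))) (cX (emb (istereo x))) (cS (emb (istereo x))) (cR (emb (istereo x))) (cM (emb (istereo x))) = 0"
    unfolding coords_emb quadric_of_real by simp
qed

section \<open>Complex parameters on the closure\<close>

text \<open>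
  A linear change of coordinates, chosen so that the parametrization of the closure becomes \<open>biquad\<close>;
  its inverse is \<open>to_torus\<close>.
\<close>
definition of_torus :: "complex^5 \<Rightarrow> complex^5" where
  "of_torus e = of_coords (e $ 1) (e $ 2 / 2) (a * e $ 3 / (2 * \<i>)) (b * e $ 4 / (2 * \<i>)) ((a^2 + b^2) * e $ 1 + a * b * e $ 5 / 2)"

definition to_torus :: "complex^5 \<Rightarrow> complex^5" where
  "to_torus y = vector [hgt y, 2 * cX y, 2 * \<i> * cS y / a, 2 * \<i> * cR y / b, 2 * (cM y - (a^2 + b^2) * hgt y) / (a * b)]"

lemma of_torus_to_torus: "of_torus (to_torus y) = y"
proof -
  have "of_torus (to_torus y) = of_coords (hgt y) (cX y) (cS y) (cR y) (cM y)"
    using a_pos b_pos by (simp add: of_torus_def to_torus_def) (simp add: diff_divide_distrib)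
  then show ?thesis unfolding of_coords_coords .
qed

lemma to_torus_of_torus: "to_torus (of_torus e) = e"
  using a_pos b_pos by (simp add: of_torus_def to_torus_def coords_of_coords hgt_of_coords vec_eq_iff forall_5)

text \<open>
  The assumptions express \<open>a z = p + \<i> s\<close>, \<open>a / z = p - \<i> s\<close>, \<open>b w' = q + \<i> r\<close> and \<open>b / w' = q - \<i> r\<close>
  without denominators.
\<close>
lemma of_torus_biquad:
  fixes z w' p q s r :: complex
  assumes "z \<noteq> 0" "w' \<noteq> 0"
    and "2 * z * p = a * (z^2 + 1)" "2 * w' * q = b * (w'^2 + 1)"
    and "2 * \<i> * z * s = a * (z^2 - 1)" "2 * \<i> * w' * r = b * (w'^2 - 1)"
  shows "of_torus (biquad a b k z w') = (z * w') *s of_coords 1 (p + q) s r ((p + q)^2 + s^2 + r^2 + 2 * k * s * r)"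
    and "p^2 + s^2 = a^2" "q^2 + r^2 = b^2"
proof -
  have "4 * z^2 * (p^2 + s^2) = (2 * z * p)^2 - (2 * \<i> * z * s)^2"
    by (simp add: power_mult_distrib algebra_simps)
  also have "\<dots> = 4 * z^2 * a^2" unfolding assms by (simp add: power2_eq_square algebra_simps)
  finally show ps: "p^2 + s^2 = a^2" using assms(1) by simp
  have "4 * w'^2 * (q^2 + r^2) = (2 * w' * q)^2 - (2 * \<i> * w' * r)^2"
    by (simp add: power_mult_distrib algebra_simps)
  also have "\<dots> = 4 * w'^2 * b^2" unfolding assms by (simp add: power2_eq_square algebra_simps)
  finally show qr: "q^2 + r^2 = b^2" using assms(2) by simp
  let ?e = "biquad a b k z w'"
  have e1: "?e $ 1 = (z * w') * 1" by (simp add: biquad_def)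
  have "?e $ 2 = w' * (a * (z^2 + 1)) + z * (b * (w'^2 + 1))" by (simp add: biquad_def mult_ac)
  then have e2: "?e $ 2 / 2 = (z * w') * (p + q)" unfolding assms(3,4)[symmetric] by (simp add: algebra_simps)
  have "a * ?e $ 3 = w' * (a * (z^2 - 1))" by (simp add: biquad_def mult_ac)
  then have e3: "a * ?e $ 3 / (2 * \<i>) = (z * w') * s" unfolding assms(5)[symmetric] by (simp add: mult_ac)
  have "b * ?e $ 4 = z * (b * (w'^2 - 1))" by (simp add: biquad_def mult_ac)
  then have e4: "b * ?e $ 4 / (2 * \<i>) = (z * w') * r" unfolding assms(6)[symmetric] by (simp add: mult_ac)
  have "a * b * ?e $ 5 = (a * (z^2 + 1)) * (b * (w'^2 + 1)) - k * (a * (z^2 - 1)) * (b * (w'^2 - 1))"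
    by (simp add: biquad_def algebra_simps)
  then have "a * b * ?e $ 5 / 2 = (z * w') * (2 * p * q + 2 * k * s * r)"
    unfolding assms(3-6)[symmetric] by (simp add: algebra_simps)
  moreover have "(p + q)^2 + s^2 + r^2 + 2 * k * s * r = (p^2 + s^2) + (q^2 + r^2) + 2 * p * q + 2 * k * s * r"
    by (simp add: power2_eq_square algebra_simps)
  ultimately have e5: "(a^2 + b^2) * ?e $ 1 + a * b * ?e $ 5 / 2 = (z * w') * ((p + q)^2 + s^2 + r^2 + 2 * k * s * r)"
    unfolding ps qr e1 by (simp add: algebra_simps)
  show "of_torus ?e = (z * w') *s of_coords 1 (p + q) s r ((p + q)^2 + s^2 + r^2 + 2 * k * s * r)"
    unfolding of_torus_def e1 e2 e3 e4 e5[unfolded e1] of_coords_scale ..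
qed

text \<open>
  Parameters of modulus 1 belong to the real points of the sum.
\<close>
lemma real_torus_zero:
  assumes F: "homogeneous_form F" "\<And>x. x \<in> Z \<Longrightarrow> F (emb (istereo x)) = 0"
    and z: "cmod z = 1" "cmod w' = 1"
  shows "F (of_torus (biquad a b k z w')) = 0"
proof -
  define p s q r where "p = a * Re z" and "s = a * Im z" and "q = b * Re w'" and "r = b * Im w'"
  have "z \<noteq> 0" "w' \<noteq> 0" using z by auto
  then have eb: "of_torus (biquad a b k z w') = (z * w') *s of_coords 1 (of_real p + of_real q) (of_real s) (of_real r)
      ((of_real p + of_real q)^2 + (of_real s)^2 + (of_real r)^2 + 2 * k * of_real s * of_real r)"
    and c1: "complex_of_real p^2 + complex_of_real s^2 = a^2" and c2: "complex_of_real q^2 + complex_of_real r^2 = b^2"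
    using of_torus_biquad[of z w' "of_real p" "of_real q" "of_real s" "of_real r"] unit_circle_identities[OF z(1)] unit_circle_identities[OF z(2)]
    by (simp_all add: p_def q_def s_def r_def mult_ac)
  have "complex_of_real (p^2 + s^2) = complex_of_real (a^2)" "complex_of_real (q^2 + r^2) = complex_of_real (b^2)"
    using c1 c2 by simp_all
  then have pq: "p^2 + s^2 = a^2" "q^2 + r^2 = b^2" by (simp_all only: of_real_eq_iff)
  define x where "x = c + (p + q) *\<^sub>R u + s *\<^sub>R v + r *\<^sub>R w"
  have x: "x \<in> Z" unfolding Z_def x_def using pq by blast
  have co: "rX x = p + q" "rS x = s" "rR x = r" unfolding x_def by (rule coords_point)+
  define t where "t = 2 / (x \<bullet> x + 1)"
  have "t > 0" unfolding t_def by (rule coords_emb(6))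
  have "F (complex_of_real t *s of_coords 1 (of_real (rX x)) (of_real (rS x)) (of_real (rR x)) (of_real ((x - c) \<bullet> (x - c)))) = 0"
    using F(2)[OF x] unfolding emb_istereo t_def[symmetric] .
  then have "F (of_coords 1 (of_real (rX x)) (of_real (rS x)) (of_real (rR x)) (of_real ((x - c) \<bullet> (x - c)))) = 0"
    using homogeneous_form_scale_zero[OF F(1)] \<open>t > 0\<close> by simp
  then have "F (of_coords 1 (of_real p + of_real q) (of_real s) (of_real r)
      ((of_real p + of_real q)^2 + (of_real s)^2 + (of_real r)^2 + 2 * k * of_real s * of_real r)) = 0"
    unfolding dist_coords co by simp
  then show ?thesis
    unfolding eb using homogeneous_form_scale_zero[OF F(1)] \<open>z \<noteq> 0\<close> \<open>w' \<noteq> 0\<close> by simp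
qed

lemma is_poly_fun_of_torus:
  assumes "\<And>j. is_poly_fun (\<lambda>z. g z $ j)"
  shows "is_poly_fun (\<lambda>z. of_torus (g z) $ j)"
  using exhaust_5[of j] unfolding of_torus_def of_coords_def nrm_def mid_def
  by (elim disjE) (simp_all, (intro is_poly_fun_intros assms)+)

text \<open>
  The value of a form is a polynomial in each parameter. It vanishes when both have modulus 1, hence
  for all \<open>z\<close> when \<open>w'\<close> has modulus 1, hence always.
\<close>
lemma torus_zero:
  assumes F: "homogeneous_form F" "\<And>x. x \<in> Z \<Longrightarrow> F (emb (istereo x)) = 0"
  shows "F (of_torus (biquad a b k z w')) = 0"
proof -
  have cp: "complex_polynomial_function F" using F(1) unfolding homogeneous_form_def by blast
  have bz: "is_poly_fun (\<lambda>z. biquad a b k z w' $ j)" for j w'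
    using exhaust_5[of j] unfolding biquad_def
    by (elim disjE) (simp_all, (intro is_poly_fun_intros)+)
  have bw: "is_poly_fun (\<lambda>w'. biquad a b k z w' $ j)" for j z
    using exhaust_5[of j] unfolding biquad_def
    by (elim disjE) (simp_all, (intro is_poly_fun_intros)+)
  have 1: "F (of_torus (biquad a b k z w')) = 0" if w: "cmod w' = 1" for z w'
  proof -
    have "\<exists>p. \<forall>z. F (of_torus (biquad a b k z w')) = poly p z"
      using is_poly_fun_of_torus[OF bz] unfolding is_poly_fun_def by (intro complex_polynomial_function_along_curve[OF cp]) blast
    then obtain p where p: "\<And>z. F (of_torus (biquad a b k z w')) = poly p z" by blast
    have "p = 0" by (rule poly_eq_0_if_unit_circle) (use real_torus_zero[OF F _ w] p in metis)
    then show ?thesis using p by simp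
  qed
  have "\<exists>p. \<forall>w'. F (of_torus (biquad a b k z w')) = poly p w'"
    using is_poly_fun_of_torus[OF bw] unfolding is_poly_fun_def by (intro complex_polynomial_function_along_curve[OF cp]) blast
  then obtain p where p: "\<And>w'. F (of_torus (biquad a b k z w')) = poly p w'" by blast
  have "p = 0" by (rule poly_eq_0_if_unit_circle) (use 1 p in metis)
  then show ?thesis using p by simp
qed

lemma hgt_of_torus: "hgt (of_torus e) = e $ 1"
  by (simp add: of_torus_def hgt_of_coords)

lemma torus_in_X:
  assumes "z \<noteq> 0" "w' \<noteq> 0"
  shows "proj_point (of_torus (biquad a b k z w')) \<in> X"
  unfolding X_hull
proof (rule proj_hull_memI)
  have "hgt (of_torus (biquad a b k z w')) \<noteq> 0" unfolding hgt_of_torus using assms by (simp add: biquad_def)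
  then show "of_torus (biquad a b k z w') \<noteq> 0" by (auto simp: hgt_def)
  fix F assume F: "homogeneous_form F"
    "\<And>s. proj_point s \<in> (\<lambda>x. proj_point (emb (istereo x))) ` Z \<Longrightarrow> F s = 0"
  show "F (of_torus (biquad a b k z w')) = 0"
    by (rule torus_zero[OF F(1)]) (use F(2) in blast)
qed

lemma affine_point:
  assumes y: "proj_point y \<in> X" "hgt y \<noteq> 0"
  obtains z w' where "z \<noteq> 0" "w' \<noteq> 0" "proj_point y = proj_point (of_torus (biquad a b k z w'))"
proof -
  define h x s r m where "h = hgt y" and "x = cX y / h" and "s = cS y / h" and "r = cR y / h" and "m = cM y / h"
  have h: "h \<noteq> 0" using y(2) by (simp add: h_def)
  have co: "hgt y = h * 1" "cX y = h * x" "cS y = h * s" "cR y = h * r" "cM y = h * m"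
    using h by (simp_all add: h_def x_def s_def r_def m_def)
  have Q: "quartic a b 1 x s r = 0" using quartic_on_X[OF y(1)] h unfolding co quartic_scale by simp
  have "quadric k 1 x s r m = 0" using quadric_on_X[OF y(1)] h unfolding co quadric_scale by simp
  then have m: "m = x^2 + s^2 + r^2 + 2 * k * s * r" by (simp add: quadric_def)
  have "\<exists>p q. p + q = x \<and> p^2 + s^2 = a^2 \<and> q^2 + r^2 = b^2"
  \<comment> \<open>On \<open>x = 0\<close> the quartic only says \<open>a\<^sup>2 - s\<^sup>2 = b\<^sup>2 - r\<^sup>2\<close>, and \<open>p\<close> can be either square root.\<close>
  proof (cases "x = 0")
    case False
    then show ?thesis using quartic_point[OF Q False] by (metis add_diff_cancel_left' add.commute diff_add_cancel of_real_power)
  next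
    case True
    have "of_real (a^2 - b^2) + r^2 - s^2 = 0" using Q True by (simp add: quartic_def)
    then have "csqrt (a^2 - s^2) + (- csqrt (a^2 - s^2)) = x \<and> (csqrt (a^2 - s^2))^2 + s^2 = a^2 \<and> (- csqrt (a^2 - s^2))^2 + r^2 = b^2"
      using True by (simp add: algebra_simps)
    then show ?thesis by blast
  qed
  then obtain p q where pq: "p + q = x" "p^2 + s^2 = a^2" "q^2 + r^2 = b^2" by blast
  define z w' where "z = (p + \<i> * s) / a" and "w' = (q + \<i> * r) / b"
  have par: "z \<noteq> 0 \<and> 2 * z * p = d * (z^2 + 1) \<and> 2 * \<i> * z * s = d * (z^2 - 1)"
    if "d > 0" "p^2 + s^2 = complex_of_real d^2" "z = (p + \<i> * s) / d" for d :: real and p s z :: complex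
  proof -
    have d: "complex_of_real d \<noteq> 0" using that(1) by simp
    have dz: "d * z = p + \<i> * s" using d that(3) by simp
    have "(p + \<i> * s) * (p - \<i> * s) = d^2" using that(2) by (simp add: power2_eq_square algebra_simps)
    then have "d * (z * (p - \<i> * s)) = d * d" unfolding dz[symmetric] by (simp add: power2_eq_square mult_ac)
    then have zz: "z * (p - \<i> * s) = d" using d by simp
    then have "z \<noteq> 0" using d by auto
    moreover have "d * (z^2 + 1) = z * (d * z) + d" by (simp add: power2_eq_square algebra_simps)
    then have "d * (z^2 + 1) = z * (p + \<i> * s) + z * (p - \<i> * s)" unfolding dz zz .
    moreover have "d * (z^2 - 1) = z * (d * z) - d" by (simp add: power2_eq_square algebra_simps)
    then have "d * (z^2 - 1) = z * (p + \<i> * s) - z * (p - \<i> * s)" unfolding dz zz .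
    ultimately show ?thesis by (simp add: algebra_simps)
  qed
  have z: "z \<noteq> 0" "2 * z * p = a * (z^2 + 1)" "2 * \<i> * z * s = a * (z^2 - 1)"
    using par[OF a_pos _ z_def] pq by auto
  have w': "w' \<noteq> 0" "2 * w' * q = b * (w'^2 + 1)" "2 * \<i> * w' * r = b * (w'^2 - 1)"
    using par[OF b_pos _ w'_def] pq by auto
  have "of_torus (biquad a b k z w') = (z * w') *s of_coords 1 x s r m"
    using of_torus_biquad(1)[OF z(1) w'(1) z(2) w'(2) z(3) w'(3)] unfolding pq(1) m .
  moreover have "y = h *s of_coords 1 x s r m" using of_coords_coords[of y] unfolding co of_coords_scale by simp
  ultimately have "y = (h / (z * w')) *s of_torus (biquad a b k z w')" using z(1) w'(1) by (simp add: vector_smult_assoc)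
  then have "proj_point y = proj_point (of_torus (biquad a b k z w'))"
    unfolding proj_point_eq_iff using h z(1) w'(1) by (intro exI[of _ "h / (z * w')"]) simp
  then show ?thesis using that z(1) w'(1) by blast
qed

text \<open>
  The point determines \<open>p + q\<close>, \<open>s\<close> and \<open>r\<close>, hence \<open>p\<close> and \<open>q\<close> by \<open>torus_point_unique\<close>, and thereby
  \<open>z = P z + \<i> S z\<close>.
\<close>
lemma same_point_imp_same_parameter:
  assumes nz: "z1 \<noteq> 0" "w1 \<noteq> 0" "z2 \<noteq> 0" "w2 \<noteq> 0"
    and off: "biquad a b k z1 w1 $ 2 \<noteq> 0"
    and eq: "proj_point (of_torus (biquad a b k z1 w1)) = proj_point (of_torus (biquad a b k z2 w2))"
  shows "z1 = z2 \<and> w1 = w2"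
proof -
  obtain t where t: "t \<noteq> 0" "of_torus (biquad a b k z1 w1) = t *s of_torus (biquad a b k z2 w2)"
    using eq unfolding proj_point_eq_iff by blast
  define P where "P = (\<lambda>z::complex. (z + 1 / z) / 2)"
  define S where "S = (\<lambda>z::complex. (z - 1 / z) / (2 * \<i>))"
  have PS: "2 * z * (d * P z) = d * (z^2 + 1)" "2 * \<i> * z * (d * S z) = d * (z^2 - 1)" "P z + \<i> * S z = z"
    if "z \<noteq> 0" for z d
    using that by (simp_all add: P_def S_def power2_eq_square field_simps)
  note e1 = of_torus_biquad[OF nz(1,2) PS(1)[OF nz(1)] PS(1)[OF nz(2)] PS(2)[OF nz(1)] PS(2)[OF nz(2)]]
  note e2 = of_torus_biquad[OF nz(3,4) PS(1)[OF nz(3)] PS(1)[OF nz(4)] PS(2)[OF nz(3)] PS(2)[OF nz(4)]]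
  have h: "z1 * w1 = t * (z2 * w2)"
    using arg_cong[OF t(2), of hgt] unfolding hgt_scale hgt_of_torus by (simp add: biquad_def)
  have x: "a * P z1 + b * P w1 = a * P z2 + b * P w2"
    and s: "a * S z1 = a * S z2" and r: "b * S w1 = b * S w2"
    using arg_cong[OF t(2), of cX] arg_cong[OF t(2), of cS] arg_cong[OF t(2), of cR] nz h t(1)
    unfolding e1(1) e2(1) coords_scale coords_of_coords by (simp_all add: mult.assoc[symmetric])
  have "cX (of_torus (biquad a b k z1 w1)) = biquad a b k z1 w1 $ 2 / 2" unfolding of_torus_def coords_of_coords ..
  then have "z1 * w1 * (a * P z1 + b * P w1) = biquad a b k z1 w1 $ 2 / 2"
    unfolding e1(1) coords_scale coords_of_coords .
  then have x0: "a * P z1 + b * P w1 \<noteq> 0" using off by auto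
  have "a * P z1 = a * P z2" "b * P w1 = b * P w2"
    using torus_point_unique[OF e1(2,3) e2(2,3)[folded s r] x x0] by auto
  then have "P z1 = P z2" "P w1 = P w2" "S z1 = S z2" "S w1 = S w2" using s r a_pos b_pos by auto
  then show ?thesis using PS(3)[OF nz(1)] PS(3)[OF nz(2)] PS(3)[OF nz(3)] PS(3)[OF nz(4)] by metis
qed

section \<open>The number of points on a general linear section\<close>

text \<open>
  By \<open>quartic_at_infinity\<close> the point lies on one of the four lines in \<open>misses_infinity\<close>. On these the
  two linear equations have only the zero solution.
\<close>
lemma point_at_infinity:
  assumes y: "proj_point y \<in> X" "hgt y = 0" and eq: "lin_comb (fst x) (to_torus y) = 0" "lin_comb (snd x) (to_torus y) = 0"
    and miss: "misses_infinity a b x"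
  shows "y = 0"
proof -
  have Q: "quartic a b 0 (cX y) (cS y) (cR y) = 0" using quartic_on_X[OF y(1)] y(2) by simp
  have q: "(cX y)^2 + (cS y)^2 + (cR y)^2 + 2 * complex_of_real k * cS y * cR y = 0"
    using quadric_on_X[OF y(1)] unfolding quadric_def y(2)
    by (simp only: mult_zero_left diff_0 neg_equal_0_iff_equal)
  have two: "s = 0 \<and> t = 0" if "p1 * s + q1 * t = 0" "p2 * s + q2 * t = 0" "p1 * q2 \<noteq> p2 * q1" for s t p1 q1 p2 q2 :: complex
  proof -
    have "(p1 * q2 - p2 * q1) * s = q2 * (p1 * s + q1 * t) - q1 * (p2 * s + q2 * t)"
      "(p1 * q2 - p2 * q1) * t = p1 * (p2 * s + q2 * t) - p2 * (p1 * s + q1 * t)" by (simp_all add: algebra_simps)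
    then have "(p1 * q2 - p2 * q1) * s = 0" "(p1 * q2 - p2 * q1) * t = 0" unfolding that(1,2) by simp_all
    moreover have "p1 * q2 - p2 * q1 \<noteq> 0" using that(3) by simp
    ultimately show ?thesis unfolding mult_eq_0_iff by blast
  qed
  have sq: "\<exists>\<sigma>\<in>{-1, 1}. 2 * p = \<sigma> * (2 * \<i> * q)" if "p^2 + q^2 = 0" for p q :: complex
  proof -
    have "(p - \<i> * q) * (p + \<i> * q) = 0" using that by (simp add: power2_eq_square algebra_simps)
    then have "p = \<i> * q \<or> p = - (\<i> * q)" by (simp add: eq_neg_iff_add_eq_0)
    then show ?thesis by auto
  qed
  define e where "e = to_torus y"
  have e1: "e $ 1 = 0" and e2: "e $ 2 = 2 * cX y" and e3: "a * e $ 3 = 2 * \<i> * cS y" and e4: "b * e $ 4 = 2 * \<i> * cR y"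
    using y(2) a_pos b_pos by (simp_all add: e_def to_torus_def)
  have l: "fst x $ 2 * e $ 2 + fst x $ 3 * e $ 3 + fst x $ 4 * e $ 4 + fst x $ 5 * e $ 5 = 0"
    "snd x $ 2 * e $ 2 + snd x $ 3 * e $ 3 + snd x $ 4 * e $ 4 + snd x $ 5 * e $ 5 = 0"
    using eq e1 unfolding lin_comb_def sum_5 e_def[symmetric] by simp_all
  have "e = 0"
  proof (cases "cS y = 0")
    case True
    then have "(cX y)^2 + (cR y)^2 = 0" using q by simp
    from sq[OF this] obtain \<sigma> where \<sigma>: "\<sigma> \<in> {-1, 1}" "e $ 2 = \<sigma> * (b * e $ 4)" unfolding e2 e4 by blast
    have e3': "e $ 3 = 0" using e3 True a_pos by simp
    have "e $ 4 = 0 \<and> e $ 5 = 0"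
    proof (rule two)
      show "(\<sigma> * b * fst x $ 2 + fst x $ 4) * e $ 4 + fst x $ 5 * e $ 5 = 0"
        "(\<sigma> * b * snd x $ 2 + snd x $ 4) * e $ 4 + snd x $ 5 * e $ 5 = 0"
        using l unfolding \<sigma>(2) e3' by (simp_all add: algebra_simps)
      show "(\<sigma> * b * fst x $ 2 + fst x $ 4) * snd x $ 5 \<noteq> (\<sigma> * b * snd x $ 2 + snd x $ 4) * fst x $ 5"
        using miss \<sigma>(1) unfolding misses_infinity_def by blast
    qed
    then show ?thesis using e1 e3' \<sigma>(2) by (simp add: vec_eq_iff forall_5)
  next
    case False
    then have R: "cR y = 0" using quartic_at_infinity[OF Q _ k_sq] q by auto
    then have "(cX y)^2 + (cS y)^2 = 0" using q by simp
    from sq[OF this] obtain \<sigma> where \<sigma>: "\<sigma> \<in> {-1, 1}" "e $ 2 = \<sigma> * (a * e $ 3)" unfolding e2 e3 by blast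
    have e4': "e $ 4 = 0" using e4 R b_pos by simp
    have "e $ 3 = 0 \<and> e $ 5 = 0"
    proof (rule two)
      show "(\<sigma> * a * fst x $ 2 + fst x $ 3) * e $ 3 + fst x $ 5 * e $ 5 = 0"
        "(\<sigma> * a * snd x $ 2 + snd x $ 3) * e $ 3 + snd x $ 5 * e $ 5 = 0"
        using l unfolding \<sigma>(2) e4' by (simp_all add: algebra_simps)
      show "(\<sigma> * a * fst x $ 2 + fst x $ 3) * snd x $ 5 \<noteq> (\<sigma> * a * snd x $ 2 + snd x $ 3) * fst x $ 5"
        using miss \<sigma>(1) unfolding misses_infinity_def by blast
    qed
    then show ?thesis using e1 e4' \<sigma>(2) by (simp add: vec_eq_iff forall_5)
  qed
  have "y = of_torus e" unfolding e_def of_torus_to_torus ..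
  then show "y = 0" unfolding \<open>e = 0\<close> by (simp add: of_torus_def of_coords_def nrm_def mid_def vec_eq_iff forall_5)
qed

text \<open>
  Coefficients of the equations \<open>L\<close> with respect to the coordinates of \<open>biquad\<close>.
\<close>
definition pull :: "complex^(2 \<times> 5) \<Rightarrow> 2 \<Rightarrow> complex^5" where
  "pull L i = (\<chi> j. \<Sum>l\<in>UNIV. L $ (i, l) * of_torus (axis j 1) $ l)"

lemma of_torus_linear: "of_torus e $ l = (\<Sum>j\<in>UNIV. e $ j * of_torus (axis j 1) $ l)"
  using exhaust_5[of l]
  by (elim disjE) (simp_all add: sum_5 of_torus_def of_coords_def nrm_def mid_def axis_def algebra_simps add_divide_distrib diff_divide_distrib)

lemma to_torus_linear: "to_torus y $ j = (\<Sum>l\<in>UNIV. y $ l * to_torus (axis l 1) $ j)"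
  using exhaust_5[of j]
  by (elim disjE) (simp_all add: sum_5 to_torus_def cX_def cS_def cR_def cM_def cdot_def hgt_def axis_def algebra_simps add_divide_distrib diff_divide_distrib)

lemma lin_comb_pull: "lin_comb (pull L i) e = (\<Sum>l\<in>UNIV. L $ (i, l) * of_torus e $ l)"
proof -
  have "lin_comb (pull L i) e = (\<Sum>j\<in>UNIV. \<Sum>l\<in>UNIV. L $ (i, l) * of_torus (axis j 1) $ l * e $ j)"
    by (simp add: lin_comb_def pull_def sum_distrib_right)
  also have "\<dots> = (\<Sum>l\<in>UNIV. \<Sum>j\<in>UNIV. L $ (i, l) * of_torus (axis j 1) $ l * e $ j)" by (rule sum.swap)
  also have "\<dots> = (\<Sum>l\<in>UNIV. L $ (i, l) * of_torus e $ l)"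
    by (subst (2) of_torus_linear) (simp add: sum_distrib_left mult_ac)
  finally show ?thesis .
qed

lemma pull_surj: "\<exists>L. (pull L 1, pull L 2) = x"
proof -
  define row where "row = (\<lambda>i::2. if i = 1 then fst x else snd x)"
  define L :: "complex^(2 \<times> 5)" where "L = (\<chi> il. lin_comb (row (fst il)) (to_torus (axis (snd il) 1)))"
  have "pull L i $ j = row i $ j" for i j
  proof -
    have "pull L i $ j = (\<Sum>l\<in>UNIV. \<Sum>m\<in>UNIV. row i $ m * (of_torus (axis j 1) $ l * to_torus (axis l 1) $ m))"
      by (simp add: pull_def L_def lin_comb_def sum_distrib_left sum_distrib_right mult_ac)
    also have "\<dots> = (\<Sum>m\<in>UNIV. \<Sum>l\<in>UNIV. row i $ m * (of_torus (axis j 1) $ l * to_torus (axis l 1) $ m))" by (rule sum.swap)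
    also have "\<dots> = (\<Sum>m\<in>UNIV. row i $ m * to_torus (of_torus (axis j 1)) $ m)"
      by (subst (2) to_torus_linear) (simp add: sum_distrib_left)
    also have "\<dots> = row i $ j" unfolding to_torus_of_torus by (simp add: axis_def if_distrib cong: if_cong)
    finally show ?thesis .
  qed
  then have "pull L i = row i" for i by (simp add: vec_eq_iff)
  then have "(pull L 1, pull L 2) = x" by (simp add: row_def)
  then show ?thesis by blast
qed

lemma tendsto_pull: "((\<lambda>L. (pull L 1, pull L 2)) \<longlongrightarrow> (pull L0 1, pull L0 2)) (nhds L0)"
  unfolding pull_def
  by (intro tendsto_Pair vec_tendstoI) (simp_all, (intro tendsto_intros tendsto_vec_nth filterlim_ident)+)

lemma section_card:
  assumes fin: "finite (solutions a b k x)" and card: "card (solutions a b k x) = 8"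
    and off: "off_double_curve a b k x" and miss: "misses_infinity a b x"
    and L: "(pull L 1, pull L 2) = x"
  defines "S \<equiv> X \<inter> {proj_point v | v. v \<noteq> 0 \<and> (\<forall>i. (\<Sum>j\<in>UNIV. L $ (i, j) * v $ j) = 0)}"
  shows "finite S \<and> card S = 8"
proof -
  let ?f = "\<lambda>(z, w'). proj_point (of_torus (biquad a b k z w'))"
  have x: "fst x = pull L 1" "snd x = pull L 2" using L by auto
  have lin: "(\<forall>i. (\<Sum>j\<in>UNIV. L $ (i, j) * of_torus e $ j) = 0) \<longleftrightarrow> lin_comb (fst x) e = 0 \<and> lin_comb (snd x) e = 0" for e
    unfolding x lin_comb_pull forall_2 ..
  have hom: "(\<forall>i. (\<Sum>j\<in>UNIV. L $ (i, j) * (t *s v) $ j) = 0) \<longleftrightarrow> (\<forall>i. (\<Sum>j\<in>UNIV. L $ (i, j) * v $ j) = 0)" if "t \<noteq> 0" for t v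
  proof -
    have "(\<Sum>j\<in>UNIV. L $ (i, j) * (t *s v) $ j) = t * (\<Sum>j\<in>UNIV. L $ (i, j) * v $ j)" for i
      by (simp add: sum_distrib_left mult_ac)
    then show ?thesis using that by simp
  qed
  have nonzero: "of_torus (biquad a b k z w') \<noteq> 0" if "z \<noteq> 0" "w' \<noteq> 0" for z w'
  proof -
    have "hgt (of_torus (biquad a b k z w')) \<noteq> 0" unfolding hgt_of_torus using that by (simp add: biquad_def)
    then show ?thesis by (auto simp: hgt_def)
  qed
  have "S = ?f ` solutions a b k x"
  proof (intro equalityI subsetI)
    fix t assume "t \<in> S"
    then obtain y where y: "t = proj_point y" "y \<noteq> 0" "proj_point y \<in> X" "\<forall>i. (\<Sum>j\<in>UNIV. L $ (i, j) * y $ j) = 0"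
      unfolding S_def by blast
    have "lin_comb (fst x) (to_torus y) = 0 \<and> lin_comb (snd x) (to_torus y) = 0"
      using lin[of "to_torus y"] y(4) unfolding of_torus_to_torus by blast
    then have "hgt y \<noteq> 0" using point_at_infinity[OF y(3) _ _ _ miss] y(2) by blast
    then obtain z w' where zw: "z \<noteq> 0" "w' \<noteq> 0" "proj_point y = proj_point (of_torus (biquad a b k z w'))"
      using affine_point[OF y(3)] by blast
    then obtain s where s: "s \<noteq> 0" "of_torus (biquad a b k z w') = s *s y" using proj_point_eq_iff by metis
    have "\<forall>i. (\<Sum>j\<in>UNIV. L $ (i, j) * of_torus (biquad a b k z w') $ j) = 0"
      unfolding s(2) hom[OF s(1)] by (rule y(4))
    then have "(z, w') \<in> solutions a b k x" unfolding lin solutions_def using zw by blast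
    then show "t \<in> ?f ` solutions a b k x" using zw(3) y(1) by force
  next
    fix t assume "t \<in> ?f ` solutions a b k x"
    then obtain z w' where zw: "(z, w') \<in> solutions a b k x" "t = proj_point (of_torus (biquad a b k z w'))" by auto
    then have "z \<noteq> 0" "w' \<noteq> 0" "lin_comb (fst x) (biquad a b k z w') = 0 \<and> lin_comb (snd x) (biquad a b k z w') = 0"
      by (auto simp: solutions_def)
    then show "t \<in> S" unfolding S_def zw(2) lin[symmetric] using torus_in_X nonzero by blast
  qed
  moreover have "inj_on ?f (solutions a b k x)"
  proof (rule inj_onI, clarify)
    fix z1 w1 z2 w2
    assume s: "(z1, w1) \<in> solutions a b k x" "(z2, w2) \<in> solutions a b k x"
      and eq: "proj_point (of_torus (biquad a b k z1 w1)) = proj_point (of_torus (biquad a b k z2 w2))"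
    have "biquad a b k z1 w1 $ 2 \<noteq> 0" using off s(1) unfolding off_double_curve_def by blast
    then show "z1 = z2 \<and> w1 = w2"
      using same_point_imp_same_parameter[OF _ _ _ _ _ eq] s by (auto simp: solutions_def)
  qed
  ultimately show ?thesis using fin card by (simp add: card_image)
qed

text \<open>
  The polynomial \<open>D\<close> that describes general sections does not vanish identically on the open set of
  sections with exactly eight points.
\<close>
theorem degree_8:
  assumes "moebius_degree Z d"
  shows "d = 8"
proof -
  obtain D L1 where D: "complex_polynomial_function D" "D L1 \<noteq> 0"
    and deg: "\<And>L. D L \<noteq> 0 \<Longrightarrow> card (X \<inter> {proj_point v | v. v \<noteq> 0 \<and> (\<forall>i. (\<Sum>j\<in>UNIV. (L :: complex^(2 \<times> 5)) $ (i, j) * v $ j) = 0)}) = d"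
    using assms unfolding moebius_degree_def surface_degree_def Let_def by blast
  obtain x0 where ev: "\<forall>\<^sub>F x in nhds x0. finite (solutions a b k x) \<and> card (solutions a b k x) = 8 \<and>
    off_double_curve a b k x \<and> misses_infinity a b x"
    using eight_solutions_generically[OF a_pos b_pos k_sq] by blast
  obtain L0 where L0: "(pull L0 1, pull L0 2) = x0" using pull_surj by blast
  have "\<forall>\<^sub>F L in nhds L0. finite (solutions a b k (pull L 1, pull L 2)) \<and> card (solutions a b k (pull L 1, pull L 2)) = 8 \<and>
    off_double_curve a b k (pull L 1, pull L 2) \<and> misses_infinity a b (pull L 1, pull L 2)"
    using tendsto_pull[of L0] ev unfolding L0 filterlim_iff by blast
  then obtain L where L: "finite (solutions a b k (pull L 1, pull L 2)) \<and> card (solutions a b k (pull L 1, pull L 2)) = 8 \<and>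
    off_double_curve a b k (pull L 1, pull L 2) \<and> misses_infinity a b (pull L 1, pull L 2)" "D L \<noteq> 0"
    using nonzero_in_every_open_set[OF D] by blast
  show "d = 8" using section_card[OF _ _ _ _ refl, of L] L(1) deg[OF L(2)] by simp
qed

end

section \<open>Lines and circles on the quartic\<close>

text \<open>
  The coefficient of \<open>t\<^sup>4\<close> is a sum of two squares, and once these vanish the same holds for the
  coefficient of \<open>t\<^sup>2\<close> if \<open>s1 \<noteq> 0\<close>. So a line on the quartic lies in the plane \<open>x = 0\<close>.
\<close>
lemma line_on_quartic:
  fixes x0 x1 s0 s1 r0 r1 :: real
  assumes "\<And>t. quartic a b 1 (x0 + x1 * t) (s0 + s1 * t) (r0 + r1 * t) = 0"
  shows "(x1 = 0 \<and> s1 = 0 \<and> r1 = 0) \<or> (x0 = 0 \<and> x1 = 0)"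
proof -
  define A B C where "A = x0^2 + (a^2 - b^2) + r0^2 - s0^2" and "B = 2 * (x0 * x1 + r0 * r1 - s0 * s1)"
    and "C = x1^2 + r1^2 - s1^2"
  define D0 D1 D2 where "D0 = a^2 - s0^2" and "D1 = - 2 * s0 * s1" and "D2 = - (s1^2)"
  define P where "P = [:A^2 - 4 * x0^2 * D0,
    2 * A * B - 4 * (x0^2 * D1 + 2 * x0 * x1 * D0),
    B^2 + 2 * A * C - 4 * (x0^2 * D2 + 2 * x0 * x1 * D1 + x1^2 * D0),
    2 * B * C - 4 * (2 * x0 * x1 * D2 + x1^2 * D1),
    C^2 - 4 * x1^2 * D2:]"
  have "poly P t = 0" for t
  proof -
    have 1: "(x0 + x1 * t)^2 + (a^2 - b^2) + (r0 + r1 * t)^2 - (s0 + s1 * t)^2 = A + B * t + C * t^2"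
      by (simp add: A_def B_def C_def power2_eq_square algebra_simps)
    have 2: "a^2 - (s0 + s1 * t)^2 = D0 + D1 * t + D2 * t^2"
      by (simp add: D0_def D1_def D2_def power2_eq_square algebra_simps)
    have "quartic a b 1 (x0 + x1 * t) (s0 + s1 * t) (r0 + r1 * t) =
        (A + B * t + C * t^2)^2 - 4 * (x0 + x1 * t)^2 * (D0 + D1 * t + D2 * t^2)"
      unfolding quartic_def 1[symmetric] 2[symmetric] by simp
    also have "\<dots> = poly P t" by (simp add: P_def power2_eq_square algebra_simps)
    finally show ?thesis using assms[of t] by simp
  qed
  then have "P = 0" using poly_all_0_iff_0 by blast
  then have c4: "C^2 - 4 * x1^2 * D2 = 0"
    and c2: "B^2 + 2 * A * C - 4 * (x0^2 * D2 + 2 * x0 * x1 * D1 + x1^2 * D0) = 0"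
    unfolding P_def by simp_all
  have "C^2 + 4 * (x1 * s1)^2 = 0" using c4 by (simp add: D2_def power_mult_distrib)
  moreover have "C^2 \<ge> 0" "(x1 * s1)^2 \<ge> 0" by simp_all
  ultimately have "C^2 = 0" "(x1 * s1)^2 = 0" by linarith+
  then have C: "C = 0" and xs: "x1 = 0 \<or> s1 = 0" by simp_all
  show ?thesis
  proof (cases "s1 = 0")
    case True
    then have "x1^2 + r1^2 = 0" using C by (simp add: C_def)
    then show ?thesis using True by (simp add: sum_power2_eq_zero_iff)
  next
    case False
    then have x1: "x1 = 0" using xs by simp
    have "B^2 + 4 * (x0 * s1)^2 = 0" using c2 unfolding C x1 D2_def by (simp add: power_mult_distrib)
    moreover have "B^2 \<ge> 0" "(x0 * s1)^2 \<ge> 0" by simp_all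
    ultimately have "(x0 * s1)^2 = 0" by linarith
    then show ?thesis using False x1 by simp
  qed
qed

text \<open>
  An affine function on a circle that is parametrized by a complex number \<open>z\<close> of modulus 1; on the unit
  circle \<open>trig_poly\<close> is its product with \<open>z\<close>.
\<close>
definition trig :: "real \<times> real \<times> real \<Rightarrow> complex \<Rightarrow> real" where
  "trig A z = fst A + fst (snd A) * Re z + snd (snd A) * Im z"

definition trig_poly :: "real \<times> real \<times> real \<Rightarrow> complex poly" where
  "trig_poly A = [:Complex (fst (snd A) / 2) (snd (snd A) / 2), of_real (fst A), Complex (fst (snd A) / 2) (- snd (snd A) / 2):]"

lemma poly_trig_poly:
  assumes "cmod z = 1"
  shows "poly (trig_poly A) z = z * of_real (trig A z)"
proof -
  have "2 * poly (trig_poly A) z = 2 * fst A * z + fst (snd A) * (z^2 + 1) - \<i> * snd (snd A) * (z^2 - 1)"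
    by (simp add: trig_poly_def Complex_eq algebra_simps power2_eq_square)
  also have "\<dots> = 2 * (z * of_real (trig A z))"
    unfolding unit_circle_identities[OF assms, symmetric] trig_def by (simp add: algebra_simps)
  finally show ?thesis by simp
qed

text \<open>
  Reality of \<open>trig\<close> makes the list of coefficients of \<open>trig_poly\<close> invariant under reversal combined
  with conjugation.
\<close>
lemma poly_trig_poly_conj:
  assumes "z \<noteq> 0" "poly (trig_poly A) z = 0"
  shows "poly (trig_poly A) (1 / cnj z) = 0"
proof -
  have *: "x^2 * (p + 1 / x * (q + 1 / x * r)) = r + x * (q + x * p)" if "x \<noteq> 0" for x p q r :: complex
    using that by (simp add: field_simps power2_eq_square)
  have "cnj (poly (trig_poly A) z) = Complex (fst (snd A) / 2) (- snd (snd A) / 2) + cnj z * (of_real (fst A) + cnj z * Complex (fst (snd A) / 2) (snd (snd A) / 2))"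
    by (simp add: trig_poly_def complex_eq_iff algebra_simps)
  also have "\<dots> = cnj z^2 * poly (trig_poly A) (1 / cnj z)"
    using *[of "cnj z" "Complex (fst (snd A) / 2) (snd (snd A) / 2)" "of_real (fst A)" "Complex (fst (snd A) / 2) (- snd (snd A) / 2)"] assms(1)
    by (simp add: trig_poly_def)
  finally show ?thesis using assms by simp
qed

text \<open>
  The two quadratic polynomials share the root \<open>z\<close> and its mirror image \<open>1 / cnj z\<close>, a different
  point as \<open>z\<close> is not on the unit circle. Hence the combination \<open>T\<close>, in which the leading terms
  cancel, is zero.
\<close>
lemma trig_proportional:
  assumes S: "z \<noteq> 0" "cmod z \<noteq> 1" "poly (trig_poly S) z = 0"
    and H: "poly (trig_poly H) z = 0" and hne: "trig H \<zeta> \<noteq> 0" "cmod \<zeta> = 1"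
  shows "\<exists>\<kappa>. \<forall>\<zeta>. cmod \<zeta> = 1 \<longrightarrow> trig S \<zeta> = \<kappa> * trig H \<zeta>"
proof -
  define h1 s1 where "h1 = coeff (trig_poly H) 2" and "s1 = coeff (trig_poly S) 2"
  define T where "T = smult h1 (trig_poly S) - smult s1 (trig_poly H)"
  define t0 t1 where "t0 = coeff T 0" and "t1 = coeff T 1"
  have T: "T = [:t0, t1:]"
    by (simp add: t0_def t1_def T_def h1_def s1_def trig_poly_def numeral_2_eq_2)
  have roots: "poly T z = 0" "poly T (1 / cnj z) = 0"
    using S H poly_trig_poly_conj[OF S(1)] by (simp_all add: T_def)
  have "z \<noteq> 1 / cnj z"
  proof
    assume "z = 1 / cnj z"
    moreover have "cmod (1 / cnj z) = 1 / cmod z" by (simp add: norm_divide)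
    ultimately have "cmod z = 1 / cmod z" by metis
    then have "cmod z * cmod z = 1" using S(1) by (simp add: field_simps)
    then have "(cmod z)^2 = 1^2" by (simp add: power2_eq_square)
    then have "cmod z = 1" by (rule power2_eq_imp_eq) simp_all
    then show False using S(2) by simp
  qed
  moreover have e: "t0 + z * t1 = 0" "t0 + (1 / cnj z) * t1 = 0"
    using roots unfolding T by simp_all
  have "(z - 1 / cnj z) * t1 = (t0 + z * t1) - (t0 + (1 / cnj z) * t1)" by (simp add: left_diff_distrib)
  then have "(z - 1 / cnj z) * t1 = 0" unfolding e by simp
  ultimately have "t1 = 0" by simp
  then have T0: "T = 0" using e(1) T by simp
  have h1: "h1 \<noteq> 0"
  proof
    assume "h1 = 0"
    then have "trig_poly H = [:0, of_real (fst H):]" "snd H = (0, 0)"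
      by (auto simp: h1_def trig_poly_def numeral_2_eq_2 complex_eq_iff prod_eq_iff)
    then have "z * of_real (fst H) = 0" using H by simp
    then show False using hne \<open>snd H = (0, 0)\<close> S(1) by (simp add: trig_def)
  qed
  have pr: "h1 * of_real (trig S \<xi>) = s1 * of_real (trig H \<xi>)" if "cmod \<xi> = 1" for \<xi>
  proof -
    have "poly T \<xi> = \<xi> * (h1 * of_real (trig S \<xi>) - s1 * of_real (trig H \<xi>))"
      by (simp add: T_def poly_trig_poly[OF that] algebra_simps)
    then show ?thesis using that unfolding T0 by auto
  qed
  define \<kappa> where "\<kappa> = trig S \<zeta> / trig H \<zeta>"
  have "s1 = h1 * of_real \<kappa>" using pr[OF hne(2)] hne(1) by (simp add: \<kappa>_def field_simps)
  then have "trig S \<xi> = \<kappa> * trig H \<xi>" if "cmod \<xi> = 1" for \<xi>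
  proof -
    have "h1 * of_real (trig S \<xi>) = h1 * of_real (\<kappa> * trig H \<xi>)"
      using pr[OF that] \<open>s1 = h1 * of_real \<kappa>\<close> by (simp add: mult_ac)
    then show ?thesis using h1 by (metis mult_left_cancel of_real_eq_iff)
  qed
  then show ?thesis by blast
qed

lemma trig_root_exists:
  assumes "snd H \<noteq> (0, 0)" "\<And>\<zeta>. cmod \<zeta> = 1 \<Longrightarrow> trig H \<zeta> \<noteq> 0"
  obtains z where "z \<noteq> 0" "cmod z \<noteq> 1" "poly (trig_poly H) z = 0"
proof -
  have c: "coeff (trig_poly H) 2 \<noteq> 0" "poly (trig_poly H) 0 \<noteq> 0"
    using assms(1) by (auto simp: trig_poly_def numeral_2_eq_2 complex_eq_iff prod_eq_iff)
  then have "degree (trig_poly H) \<ge> 2" by (intro le_degree)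
  then have "\<not> constant (poly (trig_poly H))" by (simp add: constant_degree)
  then obtain z where z: "poly (trig_poly H) z = 0" using fundamental_theorem_of_algebra by blast
  have "cmod z \<noteq> 1" using poly_trig_poly[of z H] assms(2)[of z] z by auto
  moreover have "z \<noteq> 0" using c z by auto
  ultimately show ?thesis using that z by blast
qed

text \<open>
  Completing the square shows that the form is positive definite.
\<close>
lemma definite_form_zero:
  fixes x s r k :: real
  assumes "x^2 + s^2 + r^2 + 2 * k * s * r = 0" "k^2 < 1"
  shows "x = 0 \<and> s = 0 \<and> r = 0"
proof -
  have "x^2 + (s + k * r)^2 + (1 - k^2) * r^2 = 0"
    using assms(1) by (simp add: power2_eq_square algebra_simps)
  moreover have "x^2 \<ge> 0" "(s + k * r)^2 \<ge> 0" "(1 - k^2) * r^2 \<ge> 0" using assms(2) by simp_all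
  ultimately have "x^2 = 0" "(s + k * r)^2 = 0" "(1 - k^2) * r^2 = 0" by linarith+
  then show ?thesis using assms(2) by auto
qed

text \<open>
  At a complex root of \<open>H\<close>, which is a point of the circle in the hyperplane \<open>h = 0\<close>, one of \<open>S\<close> and
  \<open>R\<close> vanishes by \<open>quartic_at_infinity\<close>. If the root is not on the unit circle, the symmetry of the
  roots makes this function proportional to \<open>H\<close>. A root on the unit circle means that the circle
  passes through the projection centre and projects to a line.
\<close>
lemma circle_on_quartic:
  fixes H X S R M :: "real \<times> real \<times> real"
  assumes k: "k^2 < 1"
    and quart: "\<And>\<zeta>. cmod \<zeta> = 1 \<Longrightarrow> quartic a b (trig H \<zeta>) (trig X \<zeta>) (trig S \<zeta>) (trig R \<zeta>) = 0"
    and quad: "\<And>\<zeta>. cmod \<zeta> = 1 \<Longrightarrow> quadric k (trig H \<zeta>) (trig X \<zeta>) (trig S \<zeta>) (trig R \<zeta>) (trig M \<zeta>) = 0"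
    and nonneg: "\<And>\<zeta>. cmod \<zeta> = 1 \<Longrightarrow> trig H \<zeta> \<ge> 0"
    and \<zeta>0: "cmod \<zeta>0 = 1" "trig H \<zeta>0 \<noteq> 0" "trig X \<zeta>0 \<noteq> 0"
  shows "(\<exists>\<kappa>. \<forall>\<zeta>. cmod \<zeta> = 1 \<longrightarrow> trig S \<zeta> = \<kappa> * trig H \<zeta>) \<or> (\<exists>\<kappa>. \<forall>\<zeta>. cmod \<zeta> = 1 \<longrightarrow> trig R \<zeta> = \<kappa> * trig H \<zeta>)"
proof -
  define h x s r m where "h = trig_poly H" and "x = trig_poly X" and "s = trig_poly S" and "r = trig_poly R" and "m = trig_poly M"
  let ?g = "complex_of_real (a^2 - b^2)"
  let ?G = "(x^2 + smult ?g (h^2) + r^2 - s^2)^2 - smult 4 (x^2 * (smult (complex_of_real (a^2)) (h^2) - s^2))"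
  have evG: "poly ?G z = quartic a b (poly h z) (poly x z) (poly s z) (poly r z)" for z
    by (simp add: quartic_def)
  have "?G = 0"
  proof (rule poly_eq_0_if_unit_circle)
    fix z :: complex assume z: "cmod z = 1"
    show "poly ?G z = 0"
      unfolding evG unfolding h_def x_def s_def r_def poly_trig_poly[OF z] quartic_scale quartic_of_real quart[OF z] by simp
  qed
  then have G0: "quartic a b (poly h z) (poly x z) (poly s z) (poly r z) = 0" for z unfolding evG[symmetric] by simp
  let ?Q = "h * m - (x^2 + s^2 + r^2 + smult (2 * complex_of_real k) (s * r))"
  have evQ: "poly ?Q z = quadric k (poly h z) (poly x z) (poly s z) (poly r z) (poly m z)" for z
    by (simp add: quadric_def mult_ac)
  have "?Q = 0"
  proof (rule poly_eq_0_if_unit_circle)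
    fix z :: complex assume z: "cmod z = 1"
    show "poly ?Q z = 0"
      unfolding evQ unfolding h_def x_def s_def r_def m_def poly_trig_poly[OF z] quadric_scale quadric_of_real quad[OF z] by simp
  qed
  then have Q0: "quadric k (poly h z) (poly x z) (poly s z) (poly r z) (poly m z) = 0" for z unfolding evQ[symmetric] by simp
  have key: "poly s z = 0 \<or> poly r z = 0" if "poly h z = 0" for z
  proof (rule quartic_at_infinity[OF _ _ k])
    show "quartic a b 0 (poly x z) (poly s z) (poly r z) = 0" using G0[of z] unfolding that .
    show "(poly x z)^2 + (poly s z)^2 + (poly r z)^2 + 2 * complex_of_real k * poly s z * poly r z = 0"
      using Q0[of z] unfolding that quadric_def by (simp only: mult_zero_left diff_0 neg_equal_0_iff_equal)
  qed
  consider (const) "snd H = (0, 0)" | (pos) "snd H \<noteq> (0, 0)" "\<And>\<zeta>. cmod \<zeta> = 1 \<Longrightarrow> trig H \<zeta> \<noteq> 0"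
    | (touch) \<zeta>1 where "cmod \<zeta>1 = 1" "trig H \<zeta>1 = 0" by blast
  then show ?thesis
  proof cases
    case const
    \<comment> \<open>Here the roots of the polynomial of \<open>H\<close> are 0 and infinity.\<close>
    then have H: "trig H \<zeta> = fst H" for \<zeta> by (simp add: trig_def)
    then have H0: "fst H \<noteq> 0" using \<zeta>0 by simp
    have "poly h 0 = 0" using const by (simp add: h_def trig_poly_def Complex_eq)
    then have z: "poly s 0 = 0 \<or> poly r 0 = 0" by (rule key)
    have "\<exists>\<kappa>. \<forall>\<zeta>. cmod \<zeta> = 1 \<longrightarrow> trig S \<zeta> = \<kappa> * trig H \<zeta>" if "poly (trig_poly S) 0 = 0" for S
    proof -
      have "snd S = (0, 0)" using that by (simp add: trig_poly_def complex_eq_iff prod_eq_iff)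
      then have "trig S \<zeta> = fst S" for \<zeta> by (simp add: trig_def)
      then show ?thesis using H H0 by (intro exI[of _ "fst S / fst H"]) simp
    qed
    then show ?thesis using z unfolding s_def r_def by blast
  next
    case pos
    obtain z where z: "z \<noteq> 0" "cmod z \<noteq> 1" "poly (trig_poly H) z = 0" using trig_root_exists[OF pos] by blast
    have "poly (trig_poly S) z = 0 \<or> poly (trig_poly R) z = 0" using key[of z] z(3) unfolding h_def s_def r_def by blast
    then show ?thesis using trig_proportional[OF z(1,2) _ z(3) \<zeta>0(2,1)] by blast
  next
    case touch
    have zero: "trig X \<zeta>1 = 0 \<and> trig S \<zeta>1 = 0 \<and> trig R \<zeta>1 = 0"
    proof (rule definite_form_zero[OF _ k])
      show "(trig X \<zeta>1)^2 + (trig S \<zeta>1)^2 + (trig R \<zeta>1)^2 + 2 * k * trig S \<zeta>1 * trig R \<zeta>1 = 0"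
        using quad[OF touch(1)] unfolding touch(2) quadric_def by simp
    qed
    \<comment> \<open>Rational parametrization of the unit circle by the points of the line; the root \<open>\<zeta>1\<close> corresponds
      to \<open>t = \<infinity>\<close>.\<close>
    define par where "par = (\<lambda>t::real. \<zeta>1 * Complex ((t^2 - 1) / (t^2 + 1)) (2 * t / (t^2 + 1)))"
    define \<delta> where "\<delta> = (\<lambda>A::real \<times> real \<times> real. snd (snd A) * Re \<zeta>1 - fst (snd A) * Im \<zeta>1)"
    have tp: "t^2 + 1 > 0" for t :: real by (simp add: add_nonneg_pos)
    have par1: "cmod (par t) = 1" for t
    proof -
      have "((t^2 - 1) / (t^2 + 1))^2 + (2 * t / (t^2 + 1))^2 = ((t^2 - 1)^2 + (2 * t)^2) / (t^2 + 1)^2"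
        by (simp add: power_divide add_divide_distrib)
      also have "(t^2 - 1)^2 + (2 * t)^2 = (t^2 + 1)^2" by (simp add: power2_eq_square algebra_simps)
      finally have "((t^2 - 1) / (t^2 + 1))^2 + (2 * t / (t^2 + 1))^2 = 1" using tp[of t] by simp
      then show ?thesis unfolding par_def norm_mult touch(1) by (simp add: cmod_def)
    qed
    have val: "trig A (par t) = 2 / (t^2 + 1) * (fst A + \<delta> A * t)" if "trig A \<zeta>1 = 0" for A t
    proof -
      have A0: "fst A = - (fst (snd A) * Re \<zeta>1 + snd (snd A) * Im \<zeta>1)" using that by (simp add: trig_def)
      define co si where "co = (t^2 - 1) / (t^2 + 1)" and "si = 2 * t / (t^2 + 1)"
      have cs: "(t^2 + 1) * co = t^2 - 1" "(t^2 + 1) * si = 2 * t"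
        using tp[of t] by (simp_all add: co_def si_def)
      have "trig A (par t) = fst A + fst (snd A) * (Re \<zeta>1 * co - Im \<zeta>1 * si) + snd (snd A) * (Re \<zeta>1 * si + Im \<zeta>1 * co)"
        by (simp add: trig_def par_def co_def si_def)
      then have "(t^2 + 1) * trig A (par t) = fst A * (t^2 + 1)
          + fst (snd A) * (Re \<zeta>1 * ((t^2 + 1) * co) - Im \<zeta>1 * ((t^2 + 1) * si))
          + snd (snd A) * (Re \<zeta>1 * ((t^2 + 1) * si) + Im \<zeta>1 * ((t^2 + 1) * co))"
        by (simp only:) (simp add: algebra_simps)
      then have "(t^2 + 1) * trig A (par t) = fst A * (t^2 + 1) + (fst (snd A) * Re \<zeta>1 + snd (snd A) * Im \<zeta>1) * (t^2 - 1) + \<delta> A * (2 * t)"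
        unfolding cs by (simp add: \<delta>_def algebra_simps)
      also have "fst A * (t^2 + 1) + (fst (snd A) * Re \<zeta>1 + snd (snd A) * Im \<zeta>1) * (t^2 - 1) + \<delta> A * (2 * t) = 2 * (fst A + \<delta> A * t)"
        unfolding A0 by (simp add: algebra_simps)
      finally show ?thesis using tp[of t] by (simp add: field_simps)
    qed
    have surj: "\<zeta> = \<zeta>1 \<or> (\<exists>t. \<zeta> = par t)" if "cmod \<zeta> = 1" for \<zeta>
    proof (cases "\<zeta> = \<zeta>1")
      case False
      define \<eta> where "\<eta> = \<zeta> / \<zeta>1"
      have "\<zeta>1 \<noteq> 0" using touch(1) by auto
      then have \<eta>: "\<zeta> = \<zeta>1 * \<eta>" "\<eta> \<noteq> 1" "cmod \<eta> = 1"
        using False that touch(1) by (auto simp: \<eta>_def norm_divide)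
      then have n: "(Re \<eta>)^2 + (Im \<eta>)^2 = 1" using cmod_power2[of \<eta>] by simp
      have "Re \<eta> \<noteq> 1"
      proof
        assume "Re \<eta> = 1"
        then have "\<eta> = 1" using n by (simp add: complex_eq_iff)
        then show False using \<eta> by simp
      qed
      then have d: "1 - Re \<eta> \<noteq> 0" by simp
      define t where "t = Im \<eta> / (1 - Re \<eta>)"
      have td: "t * (1 - Re \<eta>) = Im \<eta>" using d by (simp add: t_def)
      have "t^2 * (1 - Re \<eta>)^2 = (1 - Re \<eta>) * (1 + Re \<eta>)"
        using n unfolding power_mult_distrib[symmetric] td by (simp add: power2_eq_square algebra_simps)
      then have "(1 - Re \<eta>) * (t^2 * (1 - Re \<eta>) - (1 + Re \<eta>)) = 0" by (simp add: power2_eq_square algebra_simps)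
      then have t2: "t^2 * (1 - Re \<eta>) = 1 + Re \<eta>" using d by simp
      have re: "Re \<eta> * (t^2 + 1) = t^2 - 1" using t2 by (simp add: algebra_simps)
      have "(1 - Re \<eta>) * (Im \<eta> * (t^2 + 1)) = Im \<eta> * (t^2 * (1 - Re \<eta>) + (1 - Re \<eta>))"
        by (simp add: algebra_simps)
      then have "(1 - Re \<eta>) * (Im \<eta> * (t^2 + 1)) = 2 * Im \<eta>" unfolding t2 by simp
      also have "\<dots> = (1 - Re \<eta>) * (2 * t)" unfolding td[symmetric] by simp
      finally have im: "Im \<eta> * (t^2 + 1) = 2 * t" unfolding mult_left_cancel[OF d] .
      have "\<eta> = Complex ((t^2 - 1) / (t^2 + 1)) (2 * t / (t^2 + 1))"
        using tp[of t] re im by (simp add: complex_eq_iff nonzero_eq_divide_eq)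
      then show ?thesis unfolding par_def using \<eta>(1) by blast
    qed simp
    have hn: "fst H + \<delta> H * t \<ge> 0" for t
    proof -
      have "0 \<le> 2 / (t^2 + 1) * (fst H + \<delta> H * t)" using nonneg[OF par1[of t]] unfolding val[OF touch(2)] .
      moreover have "2 / (t^2 + 1) > 0" using tp[of t] by simp
      ultimately show ?thesis unfolding zero_le_mult_iff by linarith
    qed
    \<comment> \<open>The function \<open>H\<close> does not change sign, so \<open>\<zeta>1\<close> is a double root and \<open>H\<close> becomes constant after
      removal of the denominator.\<close>
    have \<delta>H: "\<delta> H = 0"
    proof (rule ccontr)
      assume "\<delta> H \<noteq> 0"
      then show False using hn[of "- (fst H + 1) / \<delta> H"] by simp
    qed
    obtain t0 where t0: "\<zeta>0 = par t0" using surj[OF \<zeta>0(1)] \<zeta>0(2) touch(2) by blast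
    have h0: "fst H \<noteq> 0" using \<zeta>0(2) unfolding t0 val[OF touch(2)] \<delta>H by auto
    have "quartic a b 1 (fst X / fst H + \<delta> X / fst H * t) (fst S / fst H + \<delta> S / fst H * t) (fst R / fst H + \<delta> R / fst H * t) = 0" for t
    proof -
      define q where "q = 2 / (t^2 + 1) * fst H"
      have "q \<noteq> 0" using h0 tp[of t] by (simp add: q_def)
      have "quartic a b (q * 1) (q * (fst X / fst H + \<delta> X / fst H * t)) (q * (fst S / fst H + \<delta> S / fst H * t)) (q * (fst R / fst H + \<delta> R / fst H * t)) = 0"
        using quart[OF par1[of t]] h0 zero unfolding val[OF touch(2)] \<delta>H
        by (simp add: val q_def distrib_left)
      then show ?thesis using \<open>q \<noteq> 0\<close> unfolding quartic_scale by simp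
    qed
    from line_on_quartic[OF this]
    have "\<delta> S = 0 \<or> (fst X = 0 \<and> \<delta> X = 0)" using h0 by auto
    moreover have "\<not> (fst X = 0 \<and> \<delta> X = 0)"
      using \<zeta>0(3) zero unfolding t0 by (auto simp: val)
    ultimately have \<delta>S: "\<delta> S = 0" by blast
    have "trig S \<zeta> = fst S / fst H * trig H \<zeta>" if "cmod \<zeta> = 1" for \<zeta>
      using surj[OF that] zero touch(2) h0 \<delta>S \<delta>H by (auto simp: val)
    then show ?thesis by blast
  qed
qed

section \<open>Circles through a general point\<close>

definition real_affine :: "(complex^5 \<Rightarrow> complex) \<Rightarrow> bool" where
  "real_affine F \<longleftrightarrow> (\<exists>f0 n. \<forall>y. F (emb y) = of_real (f0 + n \<bullet> y))"

lemma real_affine_nth: "real_affine (\<lambda>v. v $ j)"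
proof -
  have "\<forall>y. emb y $ 1 = of_real (1 + 0 \<bullet> y)" "\<forall>y. emb y $ 2 = of_real (0 + axis 1 1 \<bullet> y)"
    "\<forall>y. emb y $ 3 = of_real (0 + axis 2 1 \<bullet> y)" "\<forall>y. emb y $ 4 = of_real (0 + axis 3 1 \<bullet> y)"
    "\<forall>y. emb y $ 5 = of_real (0 + axis 4 1 \<bullet> y)"
    by (simp_all add: emb_def inner_axis')
  then have "real_affine (\<lambda>v. v $ 1)" "real_affine (\<lambda>v. v $ 2)" "real_affine (\<lambda>v. v $ 3)"
    "real_affine (\<lambda>v. v $ 4)" "real_affine (\<lambda>v. v $ 5)" unfolding real_affine_def by blast+
  then show ?thesis using exhaust_5[of j] by metis
qed

lemma real_affine_add:
  assumes "real_affine F" "real_affine G"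
  shows "real_affine (\<lambda>v. F v + G v)"
proof -
  obtain f0 n g0 m where "\<forall>y. F (emb y) = of_real (f0 + n \<bullet> y)" "\<forall>y. G (emb y) = of_real (g0 + m \<bullet> y)"
    using assms unfolding real_affine_def by blast
  then have "\<forall>y. F (emb y) + G (emb y) = of_real ((f0 + g0) + (n + m) \<bullet> y)" by (simp add: inner_add_left)
  then show ?thesis unfolding real_affine_def by blast
qed

lemma real_affine_scale:
  assumes "real_affine F"
  shows "real_affine (\<lambda>v. of_real t * F v)"
proof -
  obtain f0 n where "\<forall>y. F (emb y) = of_real (f0 + n \<bullet> y)"
    using assms unfolding real_affine_def by blast
  then have "\<forall>y. of_real t * F (emb y) = of_real (t * f0 + (t *\<^sub>R n) \<bullet> y)" by (simp add: distrib_left)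
  then show ?thesis unfolding real_affine_def by blast
qed

lemma real_affine_diff:
  assumes "real_affine F" "real_affine G"
  shows "real_affine (\<lambda>v. F v - G v)"
  using real_affine_add[OF assms(1) real_affine_scale[OF assms(2), of "-1"]] by simp

lemma real_affine_hgt: "real_affine hgt"
  unfolding hgt_def[abs_def] by (intro real_affine_diff real_affine_nth)

lemma real_affine_cdot: "real_affine (cdot n)"
  unfolding cdot_def[abs_def] by (intro real_affine_add real_affine_scale real_affine_nth)

lemma real_affine_trig:
  assumes "real_affine F"
  shows "\<exists>A. \<forall>\<zeta>. F (emb (m + (\<rho> * Re \<zeta>) *\<^sub>R e + (\<rho> * Im \<zeta>) *\<^sub>R f)) = of_real (trig A \<zeta>)"
proof -
  obtain f0 n where F: "\<And>y. F (emb y) = of_real (f0 + n \<bullet> y)"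
    using assms unfolding real_affine_def by blast
  have "F (emb (m + (\<rho> * Re \<zeta>) *\<^sub>R e + (\<rho> * Im \<zeta>) *\<^sub>R f)) = of_real (trig (f0 + n \<bullet> m, \<rho> * (n \<bullet> e), \<rho> * (n \<bullet> f)) \<zeta>)" for \<zeta>
    unfolding F trig_def by (simp add: inner_add_right algebra_simps)
  then show ?thesis by blast
qed

lemma finite_trig_zeros:
  assumes "cmod \<zeta>0 = 1" "trig A \<zeta>0 \<noteq> 0"
  shows "finite {\<zeta>. cmod \<zeta> = 1 \<and> trig A \<zeta> = 0}"
proof -
  have "poly (trig_poly A) \<zeta>0 \<noteq> 0" using assms poly_trig_poly[OF assms(1), of A] by auto
  then have "finite {z. poly (trig_poly A) z = 0}" using poly_roots_finite[of "trig_poly A"] by force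
  moreover have "{\<zeta>. cmod \<zeta> = 1 \<and> trig A \<zeta> = 0} \<subseteq> {z. poly (trig_poly A) z = 0}"
    by (auto simp: poly_trig_poly)
  ultimately show ?thesis by (rule finite_subset[rotated])
qed

text \<open>
  The image of one of the two candidates has infinitely many points in common with \<open>C\<close> and therefore
  equals \<open>C\<close>. For the second candidate this requires that it passes through \<open>x\<close>.
\<close>
lemma circle_eq_image_if_two_candidates:
  assumes C: "is_circle C" "C \<subseteq> sphere 0 1" and D: "is_circle D1" "is_circle D2"
    and V: "infinite V" "V \<subseteq> C" "V \<subseteq> istereo ` D1 \<union> istereo ` D2"
    and x: "istereo x \<in> C" "x \<in> D2 \<Longrightarrow> D2 = D1"
  shows "C = istereo ` D1"
proof -
  have eq: "C = istereo ` D" if "is_circle D" "infinite (C \<inter> istereo ` D)" for D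
    using circles_in_sphere_eqI[OF C is_circle_istereo_image[OF that(1)] that(2)] .
  have "V \<subseteq> (C \<inter> istereo ` D1) \<union> (C \<inter> istereo ` D2)" using V by blast
  then have "infinite (C \<inter> istereo ` D1) \<or> infinite (C \<inter> istereo ` D2)"
    using V(1) by (meson finite_UnI finite_subset)
  then show ?thesis
  proof
    assume "infinite (C \<inter> istereo ` D2)"
    then have C2: "C = istereo ` D2" by (rule eq[OF D(2)])
    then have "x \<in> D2" using x(1) inj_istereo by (simp add: inj_image_mem_iff)
    then show ?thesis using x(2) C2 by simp
  qed (rule eq[OF D(1)])
qed

context circle_sum
begin

lemma real_affine_coords: "real_affine cX" "real_affine cS" "real_affine cR" "real_affine cM"
  unfolding cX_def[abs_def] cS_def[abs_def] cR_def[abs_def] cM_def[abs_def]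
proof -
  have two: "real_affine (\<lambda>v. 2 * cdot c v)" using real_affine_scale[OF real_affine_cdot, of 2] by simp
  show "real_affine (\<lambda>y. y $ 1 + y $ 5 - 2 * cdot c y + complex_of_real (c \<bullet> c) * hgt y)"
    by (intro real_affine_add real_affine_diff real_affine_scale real_affine_nth real_affine_hgt two)
qed (intro real_affine_diff real_affine_scale real_affine_cdot real_affine_hgt)+

lemma embed_in_X: "x \<in> Z \<Longrightarrow> proj_embed (istereo x) \<in> X"
  unfolding X_hull proj_embed_eq by (rule hull_inc) blast

text \<open>
  The equation of the sphere is a form that vanishes on the preimage.
\<close>
lemma norm_on_X:
  assumes "proj_embed y \<in> X"
  shows "norm y = 1"
proof -
  define F where "F = (\<lambda>v::complex^5. v $ 1 * v $ 1 - (v $ 2 * v $ 2 + v $ 3 * v $ 3 + v $ 4 * v $ 4 + v $ 5 * v $ 5))"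
  have Fe: "F (emb y) = of_real (1 - y \<bullet> y)" for y by (simp add: F_def emb_def inner_4)
  have "complex_polynomial_function F" unfolding F_def by (intro complex_polynomial_function_intros)
  moreover have "F (t *s v) = t^2 * F v" for t v by (simp add: F_def power2_eq_square algebra_simps)
  ultimately have F: "homogeneous_form F" unfolding homogeneous_form_def by blast
  have "F (emb y) = 0"
  proof (rule form_vanishes_on_X[OF F])
    fix x
    have "istereo x \<bullet> istereo x = 1" using istereo_in_sphere[of x] by (simp add: norm_eq_1)
    then show "F (emb (istereo x)) = 0" unfolding Fe by simp
  qed (use assms proj_embed_eq in simp)
  then have "1 - y \<bullet> y = 0" unfolding Fe by (simp only: of_real_eq_0_iff)
  then show ?thesis by (simp add: norm_eq_1)
qed

text \<open>
  The closure may contain further real points, but only on \<open>hgt = 0\<close> and \<open>cX = 0\<close>: elsewhere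
  \<open>quartic_point\<close> gives real \<open>p\<close> and \<open>q\<close>.
\<close>
lemma real_point_in_Z:
  assumes y: "proj_embed y \<in> X" "hgt (emb y) \<noteq> 0" "cX (emb y) \<noteq> 0"
  shows "stereo y \<in> Z" "istereo (stereo y) = y" "rX (stereo y) \<noteq> 0"
proof -
  have "y \<in> sphere 0 1" using norm_on_X[OF y(1)] by simp
  moreover have "y $ 4 \<noteq> 1" using y(2) unfolding hgt_emb by auto
  ultimately show yx: "istereo (stereo y) = y" by (rule istereo_stereo)
  define x t where "x = stereo y" and "t = 2 / (x \<bullet> x + 1)"
  have y_eq: "y = istereo x" using yx by (simp add: x_def)
  have t: "t > 0" unfolding t_def by (rule coords_emb(6))
  show rX0: "rX (stereo y) \<noteq> 0" using y(3) unfolding y_eq coords_emb stereo_istereo by auto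
  have "quartic a b (of_real (t * 1)) (of_real (t * rX x)) (of_real (t * rS x)) (complex_of_real (t * rR x)) = 0"
    using quartic_on_X[of "emb y"] y(1) unfolding proj_embed_eq y_eq coords_emb t_def[symmetric] by simp
  then have "quartic a b 1 (rX x) (rS x) (rR x) = 0"
    unfolding quartic_of_real quartic_scale using t by simp
  from quartic_point[OF this] rX0
  have "\<exists>p. p^2 + (rS x)^2 = a^2 \<and> (rX x - p)^2 + (rR x)^2 = b^2" by (auto simp: x_def)
  then obtain p where "p^2 + (rS x)^2 = a^2" "(rX x - p)^2 + (rR x)^2 = b^2" by blast
  then show "stereo y \<in> Z" unfolding x_def[symmetric] point_in_Z_iff
    by (intro exI[of _ p] exI[of _ "rX x - p"]) simp
qed

text \<open>
  The translates of the two circles that sweep out the sum, one through each choice of a point of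
  the other circle.
\<close>
definition circle_A where "circle_A q r = {c + (p + q) *\<^sub>R u + s *\<^sub>R v + r *\<^sub>R w | p s. p^2 + s^2 = a^2}"
definition circle_B where "circle_B p s = {c + (p + q) *\<^sub>R u + s *\<^sub>R v + r *\<^sub>R w | q r. q^2 + r^2 = b^2}"

lemma is_circle_A: "is_circle (circle_A q r)"
proof -
  have "is_circle {(c + q *\<^sub>R u + r *\<^sub>R w) + p *\<^sub>R u + s *\<^sub>R v | p s. p^2 + s^2 = a^2}"
    using uu vv uv a_pos by (intro is_circle_param) (simp_all add: norm_eq_1)
  moreover have "(c + q *\<^sub>R u + r *\<^sub>R w) + p *\<^sub>R u + s *\<^sub>R v = c + (p + q) *\<^sub>R u + s *\<^sub>R v + r *\<^sub>R w" for p s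
    by (simp add: algebra_simps)
  ultimately show ?thesis unfolding circle_A_def by simp
qed

lemma is_circle_B: "is_circle (circle_B p s)"
proof -
  have "is_circle {(c + p *\<^sub>R u + s *\<^sub>R v) + q *\<^sub>R u + r *\<^sub>R w | q r. q^2 + r^2 = b^2}"
    using uu ww uw b_pos by (intro is_circle_param) (simp_all add: norm_eq_1)
  moreover have "(c + p *\<^sub>R u + s *\<^sub>R v) + q *\<^sub>R u + r *\<^sub>R w = c + (p + q) *\<^sub>R u + s *\<^sub>R v + r *\<^sub>R w" for q r
    by (simp add: algebra_simps)
  ultimately show ?thesis unfolding circle_B_def by simp
qed

lemma circle_A_iff: "x \<in> circle_A q r \<longleftrightarrow> rR x = r \<and> (rX x - q)^2 + (rS x)^2 = a^2"
proof
  assume "x \<in> circle_A q r"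
  then obtain p s where x: "x = c + (p + q) *\<^sub>R u + s *\<^sub>R v + r *\<^sub>R w" "p^2 + s^2 = a^2" unfolding circle_A_def by blast
  have "rX x = p + q" "rS x = s" "rR x = r" unfolding x(1) by (rule coords_point)+
  then show "rR x = r \<and> (rX x - q)^2 + (rS x)^2 = a^2" using x(2) by simp
next
  assume *: "rR x = r \<and> (rX x - q)^2 + (rS x)^2 = a^2"
  have "x = c + ((rX x - q) + q) *\<^sub>R u + rS x *\<^sub>R v + r *\<^sub>R w" using point_coords[of x] * by simp
  then show "x \<in> circle_A q r" unfolding circle_A_def using * by blast
qed

lemma circle_B_iff: "x \<in> circle_B p s \<longleftrightarrow> rS x = s \<and> (rX x - p)^2 + (rR x)^2 = b^2"
proof
  assume "x \<in> circle_B p s"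
  then obtain q r where x: "x = c + (p + q) *\<^sub>R u + s *\<^sub>R v + r *\<^sub>R w" "q^2 + r^2 = b^2" unfolding circle_B_def by blast
  have "rX x = p + q" "rS x = s" "rR x = r" unfolding x(1) by (rule coords_point)+
  then show "rS x = s \<and> (rX x - p)^2 + (rR x)^2 = b^2" using x(2) by simp
next
  assume *: "rS x = s \<and> (rX x - p)^2 + (rR x)^2 = b^2"
  have "x = c + (p + (rX x - p)) *\<^sub>R u + s *\<^sub>R v + rR x *\<^sub>R w" using point_coords[of x] * by simp
  then show "x \<in> circle_B p s" unfolding circle_B_def using * by blast
qed

text \<open>
  By \<open>circle_on_quartic\<close> the coordinate \<open>rS\<close> or \<open>rR\<close> is constant along the projected circle. If \<open>rS\<close> is
  constant, then \<open>p\<^sup>2\<close> is so as well, and the circle lies in the union of two translates that belong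
  to \<open>p\<close> and \<open>- p\<close>. Because \<open>rX x \<noteq> 0\<close>, both pass through \<open>x\<close> only if they coincide. The
  other case is symmetric.
\<close>
lemma circle_through_cases:
  assumes x: "p + q = rX x" "p^2 + (rS x)^2 = a^2" "q^2 + (rR x)^2 = b^2" "rX x \<noteq> 0"
    and C: "C \<in> circles_through X (istereo x)"
  shows "C = istereo ` circle_A q (rR x) \<or> C = istereo ` circle_B p (rS x)"
proof -
  have circ: "is_circle C" "C \<subseteq> sphere 0 1" and CX: "proj_embed ` C \<subseteq> X" and xC: "istereo x \<in> C"
    using C unfolding circles_through_def by auto
  obtain m e f \<rho> where par: "\<rho> > 0" "norm e = 1" "norm f = 1" "e \<bullet> f = 0"
    "C = {m + x *\<^sub>R e + y *\<^sub>R f | x y. x^2 + y^2 = \<rho>^2}" by (rule circle_paramE[OF circ(1)])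
  define \<gamma> where "\<gamma> = (\<lambda>\<zeta>::complex. m + (\<rho> * Re \<zeta>) *\<^sub>R e + (\<rho> * Im \<zeta>) *\<^sub>R f)"
  have \<gamma>C: "\<gamma> \<zeta> \<in> C" if "cmod \<zeta> = 1" for \<zeta>
  proof -
    have "(Re \<zeta>)^2 + (Im \<zeta>)^2 = 1" using that cmod_power2[of \<zeta>] by simp
    then have "(\<rho> * Re \<zeta>)^2 + (\<rho> * Im \<zeta>)^2 = \<rho>^2" unfolding power_mult_distrib by (metis distrib_left mult.right_neutral)
    then show ?thesis unfolding par(5) \<gamma>_def by blast
  qed
  have \<gamma>inj: "inj \<gamma>"
  proof (rule injI)
    fix z z' assume eq: "\<gamma> z = \<gamma> z'"
    have "(\<gamma> z - m) \<bullet> e = \<rho> * Re z" "(\<gamma> z - m) \<bullet> f = \<rho> * Im z" for z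
      using par by (simp_all add: \<gamma>_def inner_add_left norm_eq_1 inner_commute[of f e])
    then have "\<rho> * Re z = \<rho> * Re z'" "\<rho> * Im z = \<rho> * Im z'" using eq by metis+
    then show "z = z'" using par(1) by (simp add: complex_eq_iff)
  qed
  obtain \<zeta>0 where \<zeta>0: "cmod \<zeta>0 = 1" "\<gamma> \<zeta>0 = istereo x"
  proof -
    obtain x1 x2 where 1: "istereo x = m + x1 *\<^sub>R e + x2 *\<^sub>R f" "x1^2 + x2^2 = \<rho>^2" using xC unfolding par(5) by blast
    have "cmod (Complex (x1 / \<rho>) (x2 / \<rho>)) = 1"
      using 1(2) par(1) by (simp add: cmod_def power_divide add_divide_distrib[symmetric])
    moreover have "\<gamma> (Complex (x1 / \<rho>) (x2 / \<rho>)) = istereo x" using par(1) by (simp add: \<gamma>_def 1(1))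
    ultimately show ?thesis using that by blast
  qed
  obtain H A S R M where co:
    "\<And>\<zeta>. hgt (emb (\<gamma> \<zeta>)) = of_real (trig H \<zeta>)" "\<And>\<zeta>. cX (emb (\<gamma> \<zeta>)) = of_real (trig A \<zeta>)"
    "\<And>\<zeta>. cS (emb (\<gamma> \<zeta>)) = of_real (trig S \<zeta>)" "\<And>\<zeta>. cR (emb (\<gamma> \<zeta>)) = of_real (trig R \<zeta>)"
    "\<And>\<zeta>. cM (emb (\<gamma> \<zeta>)) = of_real (trig M \<zeta>)"
    unfolding \<gamma>_def using real_affine_trig[OF real_affine_hgt] real_affine_trig[OF real_affine_coords(1)]
      real_affine_trig[OF real_affine_coords(2)] real_affine_trig[OF real_affine_coords(3)]
      real_affine_trig[OF real_affine_coords(4)] by meson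
  have inX: "proj_point (emb (\<gamma> \<zeta>)) \<in> X" if "cmod \<zeta> = 1" for \<zeta>
    using \<gamma>C[OF that] CX unfolding proj_embed_eq by blast
  define t where "t = 2 / (x \<bullet> x + 1)"
  have t: "t > 0" unfolding t_def by (rule coords_emb(6))
  have "complex_of_real (trig H \<zeta>0) = of_real t" "complex_of_real (trig A \<zeta>0) = of_real (t * rX x)"
    "complex_of_real (trig S \<zeta>0) = of_real (t * rS x)" "complex_of_real (trig R \<zeta>0) = of_real (t * rR x)"
    unfolding co[symmetric] \<zeta>0(2) t_def by (rule coords_emb)+
  then have at0: "trig H \<zeta>0 = t" "trig A \<zeta>0 = t * rX x" "trig S \<zeta>0 = t * rS x" "trig R \<zeta>0 = t * rR x"
    by (simp_all only: of_real_eq_iff)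
  have ne: "trig H \<zeta>0 \<noteq> 0" "trig A \<zeta>0 \<noteq> 0" using at0 t x(4) by auto
  have alt: "(\<exists>\<kappa>. \<forall>\<zeta>. cmod \<zeta> = 1 \<longrightarrow> trig S \<zeta> = \<kappa> * trig H \<zeta>) \<or> (\<exists>\<kappa>. \<forall>\<zeta>. cmod \<zeta> = 1 \<longrightarrow> trig R \<zeta> = \<kappa> * trig H \<zeta>)"
  proof (rule circle_on_quartic[OF k_sq _ _ _ \<zeta>0(1) ne])
    fix \<zeta> :: complex assume \<zeta>: "cmod \<zeta> = 1"
    show "quartic a b (trig H \<zeta>) (trig A \<zeta>) (trig S \<zeta>) (trig R \<zeta>) = 0"
      using quartic_on_X[OF inX[OF \<zeta>]] unfolding co quartic_of_real of_real_eq_0_iff .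
    show "quadric k (trig H \<zeta>) (trig A \<zeta>) (trig S \<zeta>) (trig R \<zeta>) (trig M \<zeta>) = 0"
      using quadric_on_X[OF inX[OF \<zeta>]] unfolding co quadric_of_real of_real_eq_0_iff .
    have "norm (\<gamma> \<zeta>) = 1" using \<gamma>C[OF \<zeta>] circ(2) by auto
    then have "\<gamma> \<zeta> $ 4 \<le> 1" using component_le_norm_cart[of "\<gamma> \<zeta>" 4] by simp
    moreover have "trig H \<zeta> = 1 - \<gamma> \<zeta> $ 4" using co(1)[of \<zeta>] unfolding hgt_emb of_real_eq_iff by simp
    ultimately show "trig H \<zeta> \<ge> 0" by simp
  qed
  \<comment> \<open>At these points of \<open>C\<close> the lemma \<open>real_point_in_Z\<close> applies.\<close>
  define U where "U = {\<zeta>. cmod \<zeta> = 1 \<and> trig H \<zeta> \<noteq> 0 \<and> trig A \<zeta> \<noteq> 0}"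
  have "infinite U"
  proof
    assume "finite U"
    then have "finite (U \<union> {\<zeta>. cmod \<zeta> = 1 \<and> trig H \<zeta> = 0} \<union> {\<zeta>. cmod \<zeta> = 1 \<and> trig A \<zeta> = 0})"
      using finite_trig_zeros[OF \<zeta>0(1) ne(1)] finite_trig_zeros[OF \<zeta>0(1) ne(2)] by simp
    moreover have "{z::complex. cmod z = 1} \<subseteq> U \<union> {\<zeta>. cmod \<zeta> = 1 \<and> trig H \<zeta> = 0} \<union> {\<zeta>. cmod \<zeta> = 1 \<and> trig A \<zeta> = 0}"
      unfolding U_def by blast
    ultimately show False using infinite_unit_circle finite_subset by blast
  qed
  then have V: "infinite (\<gamma> ` U)"
    using finite_imageD[of \<gamma> U] inj_on_subset[OF \<gamma>inj] by blast
  have VC: "\<gamma> ` U \<subseteq> C" using \<gamma>C unfolding U_def by blast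
  have pt: "\<exists>x'. \<gamma> \<zeta> = istereo x' \<and> x' \<in> Z \<and> trig S \<zeta> = rS x' * trig H \<zeta> \<and> trig R \<zeta> = rR x' * trig H \<zeta>"
    if "\<zeta> \<in> U" for \<zeta>
  proof -
    have \<zeta>: "cmod \<zeta> = 1" "hgt (emb (\<gamma> \<zeta>)) \<noteq> 0" "cX (emb (\<gamma> \<zeta>)) \<noteq> 0" using that unfolding U_def co by auto
    note rp = real_point_in_Z[OF inX[OF \<zeta>(1), folded proj_embed_eq] \<zeta>(2,3)]
    define x' where "x' = stereo (\<gamma> \<zeta>)"
    have g: "\<gamma> \<zeta> = istereo x'" using rp(2) by (simp add: x'_def)
    define t' where "t' = 2 / (x' \<bullet> x' + 1)"
    have "complex_of_real (trig H \<zeta>) = of_real t'" "complex_of_real (trig S \<zeta>) = of_real (t' * rS x')"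
      "complex_of_real (trig R \<zeta>) = of_real (t' * rR x')"
      unfolding co[symmetric] g t'_def by (rule coords_emb)+
    then have "trig H \<zeta> = t'" "trig S \<zeta> = t' * rS x'" "trig R \<zeta> = t' * rR x'" by (simp_all only: of_real_eq_iff)
    then have "trig S \<zeta> = rS x' * trig H \<zeta>" "trig R \<zeta> = rR x' * trig H \<zeta>" by (simp_all only: mult.commute)
    moreover have "x' \<in> Z" unfolding x'_def by (rule rp(1))
    ultimately show ?thesis using g by blast
  qed
  from alt show ?thesis
  proof
    assume "\<exists>\<kappa>. \<forall>\<zeta>. cmod \<zeta> = 1 \<longrightarrow> trig S \<zeta> = \<kappa> * trig H \<zeta>"
    then obtain \<kappa> where \<kappa>: "\<And>\<zeta>. cmod \<zeta> = 1 \<Longrightarrow> trig S \<zeta> = \<kappa> * trig H \<zeta>" by blast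
    have "\<kappa> = rS x" using \<kappa>[OF \<zeta>0(1)] at0 t by simp
    have sub: "\<gamma> ` U \<subseteq> istereo ` circle_B p (rS x) \<union> istereo ` circle_B (- p) (rS x)"
    proof
      fix y assume "y \<in> \<gamma> ` U"
      then obtain \<zeta> where \<zeta>: "\<zeta> \<in> U" "y = \<gamma> \<zeta>" by blast
      then obtain x' where x': "\<gamma> \<zeta> = istereo x'" "x' \<in> Z" "trig S \<zeta> = rS x' * trig H \<zeta>" using pt by blast
      have s: "rS x' = rS x" using \<kappa>[of \<zeta>] \<zeta>(1) x'(3) \<open>\<kappa> = rS x\<close> unfolding U_def by simp
      obtain p' q' where pq': "p' + q' = rX x'" "p'^2 + (rS x')^2 = a^2" "q'^2 + (rR x')^2 = b^2"
        using x'(2) unfolding point_in_Z_iff by blast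
      have "p'^2 = p^2" using pq'(2) x(2) s by simp
      then have "p' = p \<or> p' = - p" by (simp add: power2_eq_iff)
      moreover have "x' \<in> circle_B p' (rS x)" unfolding circle_B_iff using pq' s by (simp add: pq'(1)[symmetric])
      ultimately show "y \<in> istereo ` circle_B p (rS x) \<union> istereo ` circle_B (- p) (rS x)" using \<zeta>(2) x'(1) by blast
    qed
    have "C = istereo ` circle_B p (rS x)"
    proof (rule circle_eq_image_if_two_candidates[OF circ is_circle_B is_circle_B V VC sub xC])
      assume "x \<in> circle_B (- p) (rS x)"
      then have "(rX x + p)^2 + (rR x)^2 = b^2" unfolding circle_B_iff by simp
      moreover have "(- p)^2 + (rS x)^2 = a^2" "(- p) + (rX x + p) = p + q" using x by simp_all
      ultimately have "- p = p" using torus_point_unique(1)[of "- p" "rS x" "a^2" "rX x + p" "rR x" "b^2" p q] x by simp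
      then show "circle_B (- p) (rS x) = circle_B p (rS x)" by simp
    qed
    then show ?thesis by blast
  next
    assume "\<exists>\<kappa>. \<forall>\<zeta>. cmod \<zeta> = 1 \<longrightarrow> trig R \<zeta> = \<kappa> * trig H \<zeta>"
    then obtain \<kappa> where \<kappa>: "\<And>\<zeta>. cmod \<zeta> = 1 \<Longrightarrow> trig R \<zeta> = \<kappa> * trig H \<zeta>" by blast
    have "\<kappa> = rR x" using \<kappa>[OF \<zeta>0(1)] at0 t by simp
    have sub: "\<gamma> ` U \<subseteq> istereo ` circle_A q (rR x) \<union> istereo ` circle_A (- q) (rR x)"
    proof
      fix y assume "y \<in> \<gamma> ` U"
      then obtain \<zeta> where \<zeta>: "\<zeta> \<in> U" "y = \<gamma> \<zeta>" by blast
      then obtain x' where x': "\<gamma> \<zeta> = istereo x'" "x' \<in> Z" "trig R \<zeta> = rR x' * trig H \<zeta>" using pt by blast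
      have r: "rR x' = rR x" using \<kappa>[of \<zeta>] \<zeta>(1) x'(3) \<open>\<kappa> = rR x\<close> unfolding U_def by simp
      obtain p' q' where pq': "p' + q' = rX x'" "p'^2 + (rS x')^2 = a^2" "q'^2 + (rR x')^2 = b^2"
        using x'(2) unfolding point_in_Z_iff by blast
      have "q'^2 = q^2" using pq'(3) x(3) r by simp
      then have "q' = q \<or> q' = - q" by (simp add: power2_eq_iff)
      moreover have "x' \<in> circle_A q' (rR x)" unfolding circle_A_iff using pq' r by (simp add: pq'(1)[symmetric])
      ultimately show "y \<in> istereo ` circle_A q (rR x) \<union> istereo ` circle_A (- q) (rR x)" using \<zeta>(2) x'(1) by blast
    qed
    have "C = istereo ` circle_A q (rR x)"
    proof (rule circle_eq_image_if_two_candidates[OF circ is_circle_A is_circle_A V VC sub xC])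
      assume "x \<in> circle_A (- q) (rR x)"
      then have "(rX x + q)^2 + (rS x)^2 = a^2" unfolding circle_A_iff by simp
      moreover have "(- q)^2 + (rR x)^2 = b^2" "(rX x + q) + (- q) = p + q" using x by simp_all
      ultimately have "- q = q" using torus_point_unique(2)[of "rX x + q" "rS x" "a^2" "- q" "rR x" "b^2" p q] x by simp
      then show "circle_A (- q) (rR x) = circle_A q (rR x)" by simp
    qed
    then show ?thesis by blast
  qed
qed

lemma image_in_X:
  assumes "D \<subseteq> Z"
  shows "proj_embed ` istereo ` D \<subseteq> X"
  using assms embed_in_X by auto

lemma two_circles_through:
  assumes x: "p + q = rX x" "p^2 + (rS x)^2 = a^2" "q^2 + (rR x)^2 = b^2"
  shows "istereo ` circle_A q (rR x) \<in> circles_through X (istereo x)" "istereo ` circle_B p (rS x) \<in> circles_through X (istereo x)"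
    "istereo ` circle_A q (rR x) \<noteq> istereo ` circle_B p (rS x)"
proof -
  have "circle_A q (rR x) \<subseteq> Z"
  proof
    fix x' assume "x' \<in> circle_A q (rR x)"
    then have "rR x' = rR x" "(rX x' - q)^2 + (rS x')^2 = a^2" unfolding circle_A_iff by blast+
    then show "x' \<in> Z" unfolding point_in_Z_iff using x(3) by (intro exI[of _ "rX x' - q"] exI[of _ q]) simp
  qed
  moreover have "circle_B p (rS x) \<subseteq> Z"
  proof
    fix x' assume "x' \<in> circle_B p (rS x)"
    then have "rS x' = rS x" "(rX x' - p)^2 + (rR x')^2 = b^2" unfolding circle_B_iff by blast+
    then show "x' \<in> Z" unfolding point_in_Z_iff using x(2) by (intro exI[of _ p] exI[of _ "rX x' - p"]) simp
  qed
  ultimately have sub: "proj_embed ` istereo ` circle_A q (rR x) \<subseteq> X" "proj_embed ` istereo ` circle_B p (rS x) \<subseteq> X"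
    using image_in_X by blast+
  have mem: "x \<in> circle_A q (rR x)" "x \<in> circle_B p (rS x)"
    unfolding circle_A_iff circle_B_iff using x by (simp_all add: x(1)[symmetric])
  show "istereo ` circle_A q (rR x) \<in> circles_through X (istereo x)"
    unfolding circles_through_def mem_Collect_eq
    by (intro conjI is_circle_istereo_image is_circle_A imageI sub mem)
  show "istereo ` circle_B p (rS x) \<in> circles_through X (istereo x)"
    unfolding circles_through_def mem_Collect_eq
    by (intro conjI is_circle_istereo_image is_circle_B imageI sub mem)
  show "istereo ` circle_A q (rR x) \<noteq> istereo ` circle_B p (rS x)"
  proof
    assume "istereo ` circle_A q (rR x) = istereo ` circle_B p (rS x)"
    then have eq: "circle_A q (rR x) = circle_B p (rS x)" using inj_istereo by (simp add: inj_image_eq_iff)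
    let ?x1 = "c + (0 + q) *\<^sub>R u + a *\<^sub>R v + rR x *\<^sub>R w" and ?x2 = "c + (0 + q) *\<^sub>R u + (- a) *\<^sub>R v + rR x *\<^sub>R w"
    have "?x1 \<in> circle_A q (rR x)" "?x2 \<in> circle_A q (rR x)" unfolding circle_A_iff coords_point by simp_all
    then have "a = rS x" "- a = rS x" unfolding eq circle_B_iff coords_point by simp_all
    then show False using a_pos by simp
  qed
qed

lemma at_least_2_circled: "at_least_circled 2 Z"
proof -
  define F where "F = (\<lambda>y. hgt y * cX y)"
  have "complex_polynomial_function F" unfolding F_def
    by (intro complex_polynomial_function_intros poly_fun_coords poly_fun_hgt)
  moreover have "F (t *s y) = t^2 * F y" for t y by (simp add: F_def hgt_scale coords_scale power2_eq_square)
  ultimately have F: "homogeneous_form F" unfolding homogeneous_form_def by blast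
  let ?W = "{proj_point v | v. v \<noteq> 0 \<and> (\<forall>G\<in>{F}. G v = 0)}"
  have W: "proj_zariski_closed ?W" unfolding proj_zariski_closed_def using F by (intro exI[of _ "{F}"]) auto
  have memW: "proj_embed y \<in> ?W \<longleftrightarrow> F (emb y) = 0" for y
    using proj_zariski_closed_mem_iff[of "{F}" "emb y"] F emb_nonzero[of y] unfolding proj_embed_eq by simp
  \<comment> \<open>The outermost point of the sum in direction \<open>u\<close> has \<open>rX = a + b\<close>.\<close>
  have "\<not> X \<subseteq> ?W"
  proof -
    define x where "x = c + (a + b) *\<^sub>R u + 0 *\<^sub>R v + 0 *\<^sub>R w"
    have co: "rX x = a + b" "rS x = 0" "rR x = 0" unfolding x_def by (rule coords_point)+
    have xZ: "x \<in> Z" unfolding point_in_Z_iff co by (intro exI[of _ a] exI[of _ b]) simp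
    have rX0: "rX x \<noteq> 0" using co a_pos b_pos by simp
    define t where "t = 2 / (x \<bullet> x + 1)"
    have "t > 0" unfolding t_def by (rule coords_emb(6))
    then have "complex_of_real t * complex_of_real (t * rX x) \<noteq> 0" using rX0 by simp
    then have "F (emb (istereo x)) \<noteq> 0" unfolding F_def coords_emb t_def .
    then have "proj_embed (istereo x) \<notin> ?W" unfolding memW .
    then show ?thesis using embed_in_X[OF xZ] by (meson subsetD)
  qed
  moreover have two: "2 \<le> ecard (circles_through X y)" if y: "proj_embed y \<in> X - ?W" for y
  proof -
    have yX: "proj_embed y \<in> X" using y by (rule DiffD1)
    have "proj_embed y \<notin> ?W" using y by (elim DiffE)
    then have "F (emb y) \<noteq> 0" unfolding memW .
    then have ne: "hgt (emb y) \<noteq> 0" "cX (emb y) \<noteq> 0" by (auto simp: F_def)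
    note rp = real_point_in_Z[OF yX ne]
    obtain p q where pq: "p + q = rX (stereo y)" "p^2 + (rS (stereo y))^2 = a^2" "q^2 + (rR (stereo y))^2 = b^2"
      using rp(1) unfolding point_in_Z_iff by blast
    note tc = two_circles_through[OF pq, unfolded rp(2)]
    show ?thesis
    proof (cases "finite (circles_through X y)")
      case True
      define T where "T = {istereo ` circle_A q (rR (stereo y)), istereo ` circle_B p (rS (stereo y))}"
      have "card T = 2" unfolding T_def card_2_iff using tc(3) by blast
      moreover have "T \<subseteq> circles_through X y" unfolding T_def using tc(1,2) by simp
      then have "card T \<le> card (circles_through X y)" using True by (rule card_mono[rotated])
      ultimately have "2 \<le> card (circles_through X y)" by simp
      then show ?thesis using True by (simp add: ecard_def numeral_eq_enat)
    qed (simp add: ecard_def)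
  qed
  ultimately show ?thesis
    unfolding at_least_circled_def using W by (intro exI[of _ ?W] conjI allI impI two) assumption+
qed

text \<open>
  Along the translate of the first circle through \<open>x0\<close>, both \<open>F\<close> and \<open>rX\<close> are, up to nonzero factors,
  nonzero polynomials in a unit complex number, and so is their product.
\<close>
lemma generic_real_point:
  assumes F: "homogeneous_form F" and x0: "x0 \<in> Z" "F (emb (istereo x0)) \<noteq> 0"
  obtains x where "x \<in> Z" "F (emb (istereo x)) \<noteq> 0" "rX x \<noteq> 0"
proof -
  obtain p0 q where pq: "p0 + q = rX x0" "p0^2 + (rS x0)^2 = a^2" "q^2 + (rR x0)^2 = b^2"
    using x0(1) unfolding point_in_Z_iff by blast
  define \<gamma> where "\<gamma> = (\<lambda>\<zeta>::complex. c + (a * Re \<zeta> + q) *\<^sub>R u + (a * Im \<zeta>) *\<^sub>R v + rR x0 *\<^sub>R w)"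
  have co: "rX (\<gamma> \<zeta>) = a * Re \<zeta> + q" "rS (\<gamma> \<zeta>) = a * Im \<zeta>" "rR (\<gamma> \<zeta>) = rR x0" for \<zeta> :: complex
    unfolding \<gamma>_def by (rule coords_point)+
  have unit: "(a * Re \<zeta>)^2 + (a * Im \<zeta>)^2 = a^2" if "cmod \<zeta> = 1" for \<zeta> :: complex
  proof -
    have "(Re \<zeta>)^2 + (Im \<zeta>)^2 = 1" using that cmod_power2[of \<zeta>] by simp
    then show ?thesis unfolding power_mult_distrib by (metis distrib_left mult.right_neutral)
  qed
  have \<gamma>Z: "\<gamma> \<zeta> \<in> Z" if "cmod \<zeta> = 1" for \<zeta> :: complex
    unfolding point_in_Z_iff co using unit[OF that] pq(3) by (intro exI[of _ "a * Re \<zeta>"] exI[of _ q]) simp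
  define \<zeta>0 where "\<zeta>0 = Complex (p0 / a) (rS x0 / a)"
  have \<zeta>0: "cmod \<zeta>0 = 1" "\<gamma> \<zeta>0 = x0"
  proof -
    show "cmod \<zeta>0 = 1" using pq(2) a_pos by (simp add: \<zeta>0_def cmod_def power_divide add_divide_distrib[symmetric])
    have "\<gamma> \<zeta>0 = c + rX x0 *\<^sub>R u + rS x0 *\<^sub>R v + rR x0 *\<^sub>R w"
      unfolding \<gamma>_def \<zeta>0_def pq(1)[symmetric] using a_pos by simp
    then show "\<gamma> \<zeta>0 = x0" using point_coords[of x0] by simp
  qed
  \<comment> \<open>The circle \<open>\<gamma>\<close> in homogeneous coordinates, multiplied by \<open>z\<close> so that all components are
    polynomials in \<open>z\<close>.\<close>
  define g where "g = (\<lambda>z::complex. of_coords z (a * (z^2 + 1) / 2 + q * z) (a * (z^2 - 1) / (2 * \<i>)) (rR x0 * z)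
     ((a^2 + q^2 + (rR x0)^2) * z + a * q * (z^2 + 1) + 2 * k * rR x0 * (a * (z^2 - 1) / (2 * \<i>))))"
  have gE: "g \<zeta> = \<zeta> *s of_coords 1 (of_real (rX (\<gamma> \<zeta>))) (of_real (rS (\<gamma> \<zeta>))) (of_real (rR (\<gamma> \<zeta>)))
      (of_real ((\<gamma> \<zeta> - c) \<bullet> (\<gamma> \<zeta> - c)))" if "cmod \<zeta> = 1" for \<zeta> :: complex
  proof -
    note ui = unit_circle_identities[OF that]
    have "(rX (\<gamma> \<zeta>))^2 + (rS (\<gamma> \<zeta>))^2 + (rR (\<gamma> \<zeta>))^2 + 2 * k * rS (\<gamma> \<zeta>) * rR (\<gamma> \<zeta>) =
       ((a * Re \<zeta>)^2 + (a * Im \<zeta>)^2) + q^2 + (rR x0)^2 + 2 * a * q * Re \<zeta> + 2 * k * rR x0 * (a * Im \<zeta>)"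
      unfolding co by (simp add: power2_eq_square algebra_simps)
    then have m: "(\<gamma> \<zeta> - c) \<bullet> (\<gamma> \<zeta> - c) = a^2 + q^2 + (rR x0)^2 + 2 * a * q * Re \<zeta> + 2 * k * rR x0 * (a * Im \<zeta>)"
      unfolding dist_coords unit[OF that] .
    show ?thesis
      unfolding m co g_def ui[symmetric] of_coords_scale[symmetric] by (simp add: algebra_simps)
  qed
  have zero: "F (g \<zeta>) = 0 \<longleftrightarrow> F (emb (istereo (\<gamma> \<zeta>))) = 0" if "cmod \<zeta> = 1" for \<zeta> :: complex
  proof -
    have "\<zeta> \<noteq> 0" using that by auto
    moreover have "complex_of_real (2 / (\<gamma> \<zeta> \<bullet> \<gamma> \<zeta> + 1)) \<noteq> 0"
      using coords_emb(6)[of "\<gamma> \<zeta>"] unfolding of_real_eq_0_iff by linarith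
    ultimately show ?thesis
      unfolding gE[OF that] emb_istereo using homogeneous_form_scale_zero[OF F] by simp
  qed
  have ip: "is_poly_fun (\<lambda>z. g z $ j)" for j
    using exhaust_5[of j] unfolding g_def of_coords_def nrm_def mid_def
    by (elim disjE) (simp_all, (intro is_poly_fun_intros)+)
  have "complex_polynomial_function F" using F unfolding homogeneous_form_def by blast
  then have "\<exists>P. \<forall>z. F (g z) = poly P z"
    using ip[unfolded is_poly_fun_def] by (rule complex_polynomial_function_along_curve)
  then obtain P where P: "\<And>z. F (g z) = poly P z" by blast
  have P0: "P \<noteq> 0" using zero[OF \<zeta>0(1)] x0(2) P[of \<zeta>0] unfolding \<zeta>0(2) by auto
  define Q where "Q = trig_poly (q, a, 0)"
  have Q0: "Q \<noteq> 0" using a_pos by (simp add: Q_def trig_poly_def complex_eq_iff)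
  have "P * Q \<noteq> 0" using P0 Q0 by simp
  then have "\<exists>\<zeta>. cmod \<zeta> = 1 \<and> poly (P * Q) \<zeta> \<noteq> 0" using poly_eq_0_if_unit_circle by blast
  then obtain \<zeta> where \<zeta>: "cmod \<zeta> = 1" "poly P \<zeta> \<noteq> 0" "poly Q \<zeta> \<noteq> 0" by auto
  have "F (emb (istereo (\<gamma> \<zeta>))) \<noteq> 0" using zero[OF \<zeta>(1)] \<zeta>(2) P by auto
  moreover have "rX (\<gamma> \<zeta>) \<noteq> 0"
  proof -
    have "trig (q, a, 0) \<zeta> \<noteq> 0"
      using \<zeta>(3) unfolding Q_def poly_trig_poly[OF \<zeta>(1)] by (metis mult_zero_right of_real_0)
    then show ?thesis unfolding co by (simp add: trig_def add.commute)
  qed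
  ultimately show ?thesis using that \<gamma>Z[OF \<zeta>(1)] by blast
qed

text \<open>
  An exceptional set \<open>W\<close> omits a point of the sum, hence by \<open>generic_real_point\<close> one with \<open>rX \<noteq> 0\<close>.
  All circles through this point are given by \<open>circle_through_cases\<close>.
\<close>
lemma not_3_circled: "\<not> at_least_circled 3 Z"
proof
  assume "at_least_circled 3 Z"
  then obtain W where W: "proj_zariski_closed W" "\<not> X \<subseteq> W"
    and three: "\<And>y. proj_embed y \<in> X - W \<Longrightarrow> 3 \<le> ecard (circles_through X y)"
    unfolding at_least_circled_def by blast
  obtain H where H: "H \<subseteq> Collect homogeneous_form" "W = {proj_point v | v. v \<noteq> 0 \<and> (\<forall>F\<in>H. F v = 0)}"
    using W(1) unfolding proj_zariski_closed_def by blast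
  have memW: "proj_point v \<in> W \<longleftrightarrow> v \<noteq> 0 \<and> (\<forall>F\<in>H. F v = 0)" for v
    unfolding H(2) by (rule proj_zariski_closed_mem_iff[OF H(1)])
  have "\<not> (\<lambda>x. proj_point (emb (istereo x))) ` Z \<subseteq> W"
  proof
    assume "(\<lambda>x. proj_point (emb (istereo x))) ` Z \<subseteq> W"
    then have "proj_zariski_closed hull ((\<lambda>x. proj_point (emb (istereo x))) ` Z) \<subseteq> W"
      using W(1) by (rule hull_minimal)
    then show False using W(2) unfolding X_hull by (rule notE[rotated])
  qed
  then obtain x0 where x0: "x0 \<in> Z" "proj_point (emb (istereo x0)) \<notin> W"
    unfolding image_subset_iff by blast
  then obtain F where F: "F \<in> H" "F (emb (istereo x0)) \<noteq> 0"
    unfolding memW using emb_nonzero by blast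
  have Fh: "homogeneous_form F" using F(1) H(1) by blast
  obtain x where x: "x \<in> Z" "F (emb (istereo x)) \<noteq> 0" "rX x \<noteq> 0"
    by (rule generic_real_point[OF Fh x0(1) F(2)])
  obtain p q where pq: "p + q = rX x" "p^2 + (rS x)^2 = a^2" "q^2 + (rR x)^2 = b^2"
    using x(1) unfolding point_in_Z_iff by blast
  have "proj_embed (istereo x) \<notin> W"
    unfolding proj_embed_eq memW using F(1) x(2) by blast
  then have "proj_embed (istereo x) \<in> X - W" using embed_in_X[OF x(1)] by simp
  then have 3: "3 \<le> ecard (circles_through X (istereo x))" by (rule three)
  define T where "T = {istereo ` circle_A q (rR x), istereo ` circle_B p (rS x)}"
  have T: "finite T" "card T \<le> 2" unfolding T_def by (simp_all add: card_insert_if)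
  have sub: "circles_through X (istereo x) \<subseteq> T"
  proof
    fix C assume "C \<in> circles_through X (istereo x)"
    from circle_through_cases[OF pq x(3) this] show "C \<in> T" unfolding T_def by simp
  qed
  then have fin: "finite (circles_through X (istereo x))" using T(1) by (rule finite_subset)
  have "3 \<le> card (circles_through X (istereo x))" using 3 fin by (simp add: ecard_def numeral_eq_enat)
  also have "\<dots> \<le> card T" using T(1) sub by (rule card_mono)
  finally show False using T(2) by simp
qed

end

section \<open>Sums of two circles in general position\<close>

lemma at_least_circled_mono:
  assumes "at_least_circled l' Z" "l \<le> l'"
  shows "at_least_circled l Z"
  using assms unfolding at_least_circled_def by (meson order_trans)

lemma circled_unique:
  assumes "circled l Z" "at_least_circled 2 Z" "\<not> at_least_circled 3 Z"
  shows "l = 2"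
proof (rule antisym)
  show "l \<le> 2"
  proof (rule ccontr)
    assume "\<not> l \<le> 2"
    then have "eSuc 2 \<le> l" by (intro ileI1) simp
    then have "3 \<le> l" by (simp add: eSuc_numeral)
    then show False using assms(1,3) at_least_circled_mono unfolding circled_def by blast
  qed
  show "2 \<le> l"
  proof (rule ccontr)
    assume "\<not> 2 \<le> l"
    then have l: "l < 2" by simp
    then have "eSuc l \<le> 2" by (rule ileI1)
    then have "l + 1 \<le> 2" by (simp add: plus_1_eSuc)
    moreover have "l < \<infinity>" using l by (metis enat_ord_simps(4) less_trans numeral_eq_enat)
    ultimately show False using assms(1,2) at_least_circled_mono unfolding circled_def by blast
  qed
qed

text \<open>
  The sum lies in a translate of \<open>L\<close>.
\<close>
lemma coplanar_sum_parallel: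
  fixes L :: "(real^3) set"
  assumes L: "subspace L" "dim L = 2"
    and A: "A = {cA + l | l. l \<in> L \<and> norm l = ra}" and B: "B = {cB + l | l. l \<in> L \<and> norm l = rb}"
  shows "coplanar {a + b | a b. a \<in> A \<and> b \<in> B}"
proof -
  have "dim L \<ge> 1" using L(2) by simp
  then obtain p where p: "p \<in> L" "norm p = 1" by (rule obtain_unit_vector[OF L(1)])
  obtain q where "q \<in> L" "norm q = 1" "p \<bullet> q = 0" and q: "L = {x *\<^sub>R p + y *\<^sub>R q | x y. True}"
    by (rule plane_basis[OF L p])
  define t where "t = cA + cB"
  have "{a + b | a b. a \<in> A \<and> b \<in> B} \<subseteq> affine hull {t, t + p, t + q}"
  proof
    fix z assume "z \<in> {a + b | a b. a \<in> A \<and> b \<in> B}"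
    then obtain l l' where z: "z = (cA + l) + (cB + l')" "l \<in> L" "l' \<in> L" unfolding A B by blast
    then have "l + l' \<in> L" using L(1) by (simp add: subspace_add)
    then obtain x y where xy: "l + l' = x *\<^sub>R p + y *\<^sub>R q" unfolding q by blast
    have "z = (1 - x - y) *\<^sub>R t + x *\<^sub>R (t + p) + y *\<^sub>R (t + q)"
      using z(1) xy by (simp add: t_def algebra_simps)
    then show "z \<in> affine hull {t, t + p, t + q}" unfolding affine_hull_3
      by (intro CollectI exI[of _ "1 - x - y"] exI[of _ x] exI[of _ y]) simp
  qed
  then show ?thesis unfolding coplanar_def by blast
qed

text \<open>
  The two plane directions differ, as the sum would be coplanar otherwise. For dimension reasons they
  meet in a line, which is spanned by \<open>u\<close>.
\<close>
lemma circle_sum_parametrization: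
  fixes A B :: "(real^3) set"
  assumes "is_circle A" "is_circle B" and np: "\<not> coplanar {a + b | a b. a \<in> A \<and> b \<in> B}"
  shows "\<exists>ra rb k u v w c. circle_sum ra rb k u v w \<and> {a + b | a b. a \<in> A \<and> b \<in> B} = circle_sum.Z ra rb u v w c"
proof -
  obtain cA ra LA where A: "ra > 0" "subspace LA" "dim LA = 2" "A = {cA + l | l. l \<in> LA \<and> norm l = ra}"
    using assms(1) unfolding is_circle_iff_subspace by blast
  obtain cB rb LB where B: "rb > 0" "subspace LB" "dim LB = 2" "B = {cB + l | l. l \<in> LB \<and> norm l = rb}"
    using assms(2) unfolding is_circle_iff_subspace by blast
  have ne: "LA \<noteq> LB"
  proof
    assume "LA = LB"
    then show False using np coplanar_sum_parallel[OF A(2,3,4)] B(4) by blast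
  qed
  have "dim {x + y | x y. x \<in> LA \<and> y \<in> LB} + dim (LA \<inter> LB) = 4"
    using dim_sums_Int[OF A(2) B(2)] A(3) B(3) by simp
  moreover have "dim {x + y | x y. x \<in> LA \<and> y \<in> LB} \<le> 3"
    using dim_subset_UNIV[of "{x + y | x y. x \<in> LA \<and> y \<in> LB}"] by simp
  ultimately have "dim (LA \<inter> LB) \<ge> 1" by linarith
  moreover have "subspace (LA \<inter> LB)" using A(2) B(2) by (rule subspace_inter)
  ultimately obtain u where u: "u \<in> LA" "u \<in> LB" "norm u = 1" using obtain_unit_vector by blast
  obtain v where v: "v \<in> LA" "norm v = 1" "u \<bullet> v = 0" "LA = {x *\<^sub>R u + y *\<^sub>R v | x y. True}"
    by (rule plane_basis[OF A(2,3) u(1,3)])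
  obtain w where w: "w \<in> LB" "norm w = 1" "u \<bullet> w = 0" "LB = {x *\<^sub>R u + y *\<^sub>R w | x y. True}"
    by (rule plane_basis[OF B(2,3) u(2,3)])
  define k where "k = v \<bullet> w"
  have n1: "v \<bullet> v = 1" "w \<bullet> w = 1" "u \<bullet> u = 1" using u v w by (simp_all add: norm_eq_1)
  have "(v - k *\<^sub>R w) \<bullet> (v - k *\<^sub>R w) = 1 - k^2"
    using n1 by (simp add: inner_diff_left inner_diff_right inner_commute[of w v] k_def[symmetric] power2_eq_square)
  moreover have "v - k *\<^sub>R w \<noteq> 0"
  proof
    assume "v - k *\<^sub>R w = 0"
    then have vk: "v = k *\<^sub>R w" by simp
    have "LA \<subseteq> LB"
    proof
      fix t assume "t \<in> LA"
      then obtain x y where "t = x *\<^sub>R u + y *\<^sub>R v" unfolding v(4) by blast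
      then show "t \<in> LB" unfolding vk using u(2) w(1) B(2) by (simp add: subspace_add subspace_scale)
    qed
    then have "LA = LB" using A B by (intro subspace_dim_equal) simp_all
    then show False using ne by blast
  qed
  then have "(v - k *\<^sub>R w) \<bullet> (v - k *\<^sub>R w) > 0" by (simp only: inner_gt_zero_iff not_False_eq_True)
  ultimately have k: "k^2 < 1" by simp
  have cs: "circle_sum ra rb k u v w"
    by unfold_locales (use A(1) B(1) k n1 v(3) w(3) k_def in simp_all)
  have Ap: "A = {cA + x *\<^sub>R u + y *\<^sub>R v | x y. x^2 + y^2 = ra^2}"
    unfolding A(4) v(4) by (rule circle_in_basis[OF u(3) v(2,3) A(1)])
  have Bp: "B = {cB + x *\<^sub>R u + y *\<^sub>R w | x y. x^2 + y^2 = rb^2}"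
    unfolding B(4) w(4) by (rule circle_in_basis[OF u(3) w(2,3) B(1)])
  have split: "(cA + p *\<^sub>R u + s *\<^sub>R v) + (cB + q *\<^sub>R u + r *\<^sub>R w) = (cA + cB) + (p + q) *\<^sub>R u + s *\<^sub>R v + r *\<^sub>R w" for p q s r
    by (simp add: algebra_simps)
  have "{a + b | a b. a \<in> A \<and> b \<in> B} = circle_sum.Z ra rb u v w (cA + cB)"
  proof (intro equalityI subsetI)
    fix z assume "z \<in> {a + b | a b. a \<in> A \<and> b \<in> B}"
    then obtain a1 b1 where z: "z = a1 + b1" "a1 \<in> A" "b1 \<in> B" by blast
    obtain p s where a1: "a1 = cA + p *\<^sub>R u + s *\<^sub>R v" "p^2 + s^2 = ra^2" using z(2) unfolding Ap by blast
    obtain q r where b1: "b1 = cB + q *\<^sub>R u + r *\<^sub>R w" "q^2 + r^2 = rb^2" using z(3) unfolding Bp by blast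
    have "z = (cA + cB) + (p + q) *\<^sub>R u + s *\<^sub>R v + r *\<^sub>R w" unfolding z(1) a1(1) b1(1) split ..
    then show "z \<in> circle_sum.Z ra rb u v w (cA + cB)"
      unfolding circle_sum.Z_def[OF cs] using a1(2) b1(2)
      by (intro CollectI exI[of _ p] exI[of _ q] exI[of _ s] exI[of _ r] conjI)
  next
    fix z assume "z \<in> circle_sum.Z ra rb u v w (cA + cB)"
    then obtain p q s r where z: "z = (cA + cB) + (p + q) *\<^sub>R u + s *\<^sub>R v + r *\<^sub>R w"
      "p^2 + s^2 = ra^2" "q^2 + r^2 = rb^2" unfolding circle_sum.Z_def[OF cs] by (elim CollectE exE conjE)
    have "cA + p *\<^sub>R u + s *\<^sub>R v \<in> A" unfolding Ap using z(2) by (intro CollectI exI[of _ p] exI[of _ s] conjI refl)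
    moreover have "cB + q *\<^sub>R u + r *\<^sub>R w \<in> B" unfolding Bp using z(3) by (intro CollectI exI[of _ q] exI[of _ r] conjI refl)
    ultimately show "z \<in> {a + b | a b. a \<in> A \<and> b \<in> B}" unfolding z(1) split[symmetric] by blast
  qed
  then show ?thesis using cs by blast
qed

theorem corollary2:
  fixes A B :: "(real^3) set" and l :: enat and d :: nat
  assumes "is_circle A" and "is_circle B"
    and "real_surface {a + b | a b. a \<in> A \<and> b \<in> B}"
    and "\<not> coplanar {a + b | a b. a \<in> A \<and> b \<in> B}"
    and "circled l {a + b | a b. a \<in> A \<and> b \<in> B}"
    and "moebius_degree {a + b | a b. a \<in> A \<and> b \<in> B} d"
  shows "(l, d) = (2, 8)"
proof -
  obtain ra rb k u v w c where cs: "circle_sum ra rb k u v w"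
    and Z: "{a + b | a b. a \<in> A \<and> b \<in> B} = circle_sum.Z ra rb u v w c"
    using circle_sum_parametrization[OF assms(1,2,4)] by metis
  interpret circle_sum ra rb k u v w c by (rule cs)
  have "l = 2"
    using assms(5) at_least_2_circled not_3_circled unfolding Z by (rule circled_unique)
  moreover have "d = 8"
    using assms(6) unfolding Z by (rule degree_8)
  ultimately show ?thesis by simp
qed

end
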